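(* Let $C$ be a $k$-coalgebra and let $B\subseteq A$ be a $C$-cleft algebra extension. If there exist finite sets $\{v_i\}\subseteq \mathrm{Hom}_k(C,B)$ and $\{d_i\}\subseteq C$ satisfying $\sum_i v_i(d_i)=1_B$, then the category $\mathcal M_B$ of right $B$-modules is equivalent to the category $\mathcal M^{\mathcal C}$ of right comodules for the $A$-coring $\mathcal C:=A\otimes_kC$, via the induction functor $-\otimes_BA:\mathcal M_B\to\mathcal M^{\mathcal C}$.
   Context: $k$ is a commutative, associative, unital ring; algebras are associative unital $k$-algebras, coalgebras are coassociative counital $k$-coalgebras. For an algebra $A$, an $A$-coring is a comonoid $\mathcal C$ in the monoidal category of $A$-$A$ bimodules, and a right $\mathcal C$-comodule is a right $A$-module $M$ with a right $A$-linear coassociative counital coaction $M\to M\otimes_A\mathcal C$. Let $(C,\Delta,\epsilon)$ be a $k$-coalgebra and let $A$ be a $k$-algebra that is a right $C$-comodule via $\varrho^A:A\to A\otimes_kC$. Its coinvariants are $A^{coC}=\{b\in A\mid \varrho^A(ba)=b\varrho^A(a)\ \forall a\in A\}$; one says that $B\subseteq A$ is an algebra extension by $C$ if $B=A^{coC}$. An algebra extension $B\subseteq A$ by $C$ is $C$-cleft if: (1) $\mathcal C:=A\otimes_kC$ is an $A$-coring, with coproduct $A\otimes_k\Delta$ and counit $A\otimes_k\epsilon$ (under $(A\otimes_kC)\otimes_A(A\otimes_kC)\cong A\otimes_kC\otimes_kC$), the left regular $A$-module structure of the first factor, and a right $A$-module structure such that the $C$-coaction $\varrho^A:A\to A\otimes_kC=\mathcal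 C$ is a right $A$-module map; (2) there exists a right $C$-comodule map $j:C\to A$ that is invertible in the convolution algebra $\mathrm{Hom}_k(C,A)$ (product $(f,g)\mapsto \mu_A\circ(f\otimes_kg)\circ\Delta$, unit $c\mapsto\epsilon(c)1_A$). In this case $A$ is a right $\mathcal C$-comodule via $\varrho^A:A\to A\otimes_kC\cong A\otimes_A\mathcal C$, and $N\otimes_BA$ is a right $\mathcal C$-comodule via the second factor, for any right $B$-module $N$. *)

theory Defs
  imports "HOL-Algebra.Module" "HOL-Algebra.Free_Abelian_Groups"
begin

section \<open>Modules and bimodules over a not necessarily commutative ring\<close>

record ('r, 'm) rmod = "'m ring" +
  ract :: "'m \<Rightarrow> 'r \<Rightarrow> 'm" (infixl "\<triangleleft>\<index>" 70)

record ('r, 'm) bimod = "('r, 'm) rmod" +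
  lact :: "'r \<Rightarrow> 'm \<Rightarrow> 'm" (infixr "\<triangleright>\<index>" 70)

locale right_module = R?: ring R + M?: abelian_group M
  for R (structure) and M (structure) +
  assumes ract_closed: "\<lbrakk>x \<in> carrier M; a \<in> carrier R\<rbrakk> \<Longrightarrow> x \<triangleleft>\<^bsub>M\<^esub> a \<in> carrier M"
    and ract_add_left: "\<lbrakk>x \<in> carrier M; y \<in> carrier M; a \<in> carrier R\<rbrakk>
      \<Longrightarrow> (x \<oplus>\<^bsub>M\<^esub> y) \<triangleleft>\<^bsub>M\<^esub> a = x \<triangleleft>\<^bsub>M\<^esub> a \<oplus>\<^bsub>M\<^esub> y \<triangleleft>\<^bsub>M\<^esub> a"
    and ract_add_right: "\<lbrakk>x \<in> carrier M; a \<in> carrier R; b \<in> carrier R\<rbrakk>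
      \<Longrightarrow> x \<triangleleft>\<^bsub>M\<^esub> (a \<oplus>\<^bsub>R\<^esub> b) = x \<triangleleft>\<^bsub>M\<^esub> a \<oplus>\<^bsub>M\<^esub> x \<triangleleft>\<^bsub>M\<^esub> b"
    and ract_mult: "\<lbrakk>x \<in> carrier M; a \<in> carrier R; b \<in> carrier R\<rbrakk>
      \<Longrightarrow> x \<triangleleft>\<^bsub>M\<^esub> (a \<otimes>\<^bsub>R\<^esub> b) = (x \<triangleleft>\<^bsub>M\<^esub> a) \<triangleleft>\<^bsub>M\<^esub> b"
    and ract_one: "x \<in> carrier M \<Longrightarrow> x \<triangleleft>\<^bsub>M\<^esub> \<one>\<^bsub>R\<^esub> = x"

locale bimodule = right_module R M
  for R (structure) and M (structure) +
  assumes lact_closed: "\<lbrakk>x \<in> carrier M; a \<in> carrier R\<rbrakk> \<Longrightarrow> a \<triangleright>\<^bsub>M\<^esub> x \<in> carrier M"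
    and lact_add_right: "\<lbrakk>x \<in> carrier M; y \<in> carrier M; a \<in> carrier R\<rbrakk>
      \<Longrightarrow> a \<triangleright>\<^bsub>M\<^esub> (x \<oplus>\<^bsub>M\<^esub> y) = (a \<triangleright>\<^bsub>M\<^esub> x) \<oplus>\<^bsub>M\<^esub> (a \<triangleright>\<^bsub>M\<^esub> y)"
    and lact_add_left: "\<lbrakk>x \<in> carrier M; a \<in> carrier R; b \<in> carrier R\<rbrakk>
      \<Longrightarrow> (a \<oplus>\<^bsub>R\<^esub> b) \<triangleright>\<^bsub>M\<^esub> x = (a \<triangleright>\<^bsub>M\<^esub> x) \<oplus>\<^bsub>M\<^esub> (b \<triangleright>\<^bsub>M\<^esub> x)"
    and lact_mult: "\<lbrakk>x \<in> carrier M; a \<in> carrier R; b \<in> carrier R\<rbrakk>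
      \<Longrightarrow> (a \<otimes>\<^bsub>R\<^esub> b) \<triangleright>\<^bsub>M\<^esub> x = a \<triangleright>\<^bsub>M\<^esub> (b \<triangleright>\<^bsub>M\<^esub> x)"
    and lact_one: "x \<in> carrier M \<Longrightarrow> \<one>\<^bsub>R\<^esub> \<triangleright>\<^bsub>M\<^esub> x = x"
    and lact_ract: "\<lbrakk>x \<in> carrier M; a \<in> carrier R; b \<in> carrier R\<rbrakk>
      \<Longrightarrow> (a \<triangleright>\<^bsub>M\<^esub> x) \<triangleleft>\<^bsub>M\<^esub> b = a \<triangleright>\<^bsub>M\<^esub> (x \<triangleleft>\<^bsub>M\<^esub> b)"

definition rmod_hom ::
  "('r, 's) ring_scheme \<Rightarrow> ('r, 'm, 'x) rmod_scheme \<Rightarrow> ('r, 'n, 'y) rmod_scheme \<Rightarrow> ('m \<Rightarrow> 'n) set" where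
  "rmod_hom R M N = {f \<in> hom (add_monoid M) (add_monoid N).
     \<forall>x \<in> carrier M. \<forall>a \<in> carrier R. f (x \<triangleleft>\<^bsub>M\<^esub> a) = f x \<triangleleft>\<^bsub>N\<^esub> a}"

definition bimod_hom ::
  "('r, 's) ring_scheme \<Rightarrow> ('r, 'm, 'x) bimod_scheme \<Rightarrow> ('r, 'n, 'y) bimod_scheme \<Rightarrow> ('m \<Rightarrow> 'n) set" where
  "bimod_hom R M N = {f \<in> rmod_hom R M N.
     \<forall>x \<in> carrier M. \<forall>a \<in> carrier R. f (a \<triangleright>\<^bsub>M\<^esub> x) = a \<triangleright>\<^bsub>N\<^esub> f x}"

definition regular_bimod :: "('r, 's) ring_scheme \<Rightarrow> ('r, 'r) bimod" where
  "regular_bimod R = \<lparr>carrier = carrier R, monoid.mult = monoid.mult R, one = one R, ring.zero = ring.zero R,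
     add = add R, ract = monoid.mult R, lact = monoid.mult R\<rparr>"


section \<open>Tensor products\<close>

text \<open>An element of a tensor product is a coset in the free abelian group on pairs.\<close>

type_synonym ('m, 'n) tensors = "('m \<times> 'n \<Rightarrow>\<^sub>0 int) set"

definition tensor_relators ::
  "'r set \<Rightarrow> ('m, 'x) ring_scheme \<Rightarrow> ('m \<Rightarrow> 'r \<Rightarrow> 'm) \<Rightarrow> ('n, 'y) ring_scheme \<Rightarrow> ('r \<Rightarrow> 'n \<Rightarrow> 'n)
    \<Rightarrow> ('m, 'n) tensors" where
  "tensor_relators S M ra N la =
     {frag_of (x \<oplus>\<^bsub>M\<^esub> x', y) - frag_of (x, y) - frag_of (x', y) | x x' y.
        x \<in> carrier M \<and> x' \<in> carrier M \<and> y \<in> carrier N} \<union>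
     {frag_of (x, y \<oplus>\<^bsub>N\<^esub> y') - frag_of (x, y) - frag_of (x, y') | x y y'.
        x \<in> carrier M \<and> y \<in> carrier N \<and> y' \<in> carrier N} \<union>
     {frag_of (ra x s, y) - frag_of (x, la s y) | x s y.
        x \<in> carrier M \<and> s \<in> S \<and> y \<in> carrier N}"

text \<open>
  The abelian group \<open>M \<otimes>\<^sub>S N\<close>, where the scalars \<open>s \<in> S\<close> act on \<open>M\<close> from the right by \<open>ra\<close> and on
  \<open>N\<close> from the left by \<open>la\<close>. Only the additive part of the record is meaningful.
\<close>

definition tensor ::
  "'r set \<Rightarrow> ('m, 'x) ring_scheme \<Rightarrow> ('m \<Rightarrow> 'r \<Rightarrow> 'm) \<Rightarrow> ('n, 'y) ring_scheme \<Rightarrow> ('r \<Rightarrow> 'n \<Rightarrow> 'n)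
    \<Rightarrow> ('m, 'n) tensors ring" where
  "tensor S M ra N la =
     (let F = free_Abelian_group (carrier M \<times> carrier N);
          Q = F Mod generate F (tensor_relators S M ra N la)
      in \<lparr>carrier = carrier Q, monoid.mult = undefined, one = undefined, ring.zero = one Q, add = monoid.mult Q\<rparr>)"

text \<open>
  The zero of a tensor product is the subgroup of relations itself, so translating it by the
  generator \<open>(x, y)\<close> gives the class of that generator.
\<close>

definition pure_tensor ::
  "(('m, 'n) tensors, 't) ring_scheme \<Rightarrow> 'm \<Rightarrow> 'n \<Rightarrow> ('m, 'n) tensors"
  ("(_ \<boxtimes>\<index> _)" [71, 71] 70) where
  "x \<boxtimes>\<^bsub>T\<^esub> y = (\<lambda>p. p + frag_of (x, y)) ` \<zero>\<^bsub>T\<^esub>"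

text \<open>
  The additive map into the abelian group \<open>G\<close> that sends \<open>x \<otimes> y\<close> to \<open>f x y\<close>. For balanced
  biadditive \<open>f\<close>, which is the only use below, it does not depend on the chosen representative.
\<close>

definition tensor_lift ::
  "('g, 'x) ring_scheme \<Rightarrow> ('m \<Rightarrow> 'n \<Rightarrow> 'g) \<Rightarrow> ('m, 'n) tensors \<Rightarrow> 'g" where
  "tensor_lift G f X =
     (let p = SOME p. p \<in> X
      in finsum G (\<lambda>(x, y). [Poly_Mapping.lookup p (x, y)] \<cdot>\<^bsub>G\<^esub> f x y) (Poly_Mapping.keys p))"

text \<open>\<open>tensor_map T f g\<close> is \<open>f \<otimes> g\<close>, where \<open>T\<close> is the target.\<close>

definition tensor_map ::
  "(('m', 'n') tensors, 't) ring_scheme \<Rightarrow> ('m \<Rightarrow> 'm') \<Rightarrow> ('n \<Rightarrow> 'n')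
    \<Rightarrow> ('m, 'n) tensors \<Rightarrow> ('m', 'n') tensors" where
  "tensor_map T f g = tensor_lift T (\<lambda>x y. f x \<boxtimes>\<^bsub>T\<^esub> g y)"

text \<open>
  The associativity isomorphism \<open>(M \<otimes> N) \<otimes> P \<rightarrow> M \<otimes> (N \<otimes> P)\<close>, where \<open>T\<close> is the target and
  \<open>T'\<close> is \<open>N \<otimes> P\<close>.
\<close>

definition tensor_assoc ::
  "(('m, ('n, 'p) tensors) tensors, 's) ring_scheme \<Rightarrow> (('n, 'p) tensors, 't) ring_scheme
    \<Rightarrow> (('m, 'n) tensors, 'p) tensors \<Rightarrow> ('m, ('n, 'p) tensors) tensors" where
  "tensor_assoc T T' = tensor_lift T (\<lambda>u z. tensor_lift T (\<lambda>x y. x \<boxtimes>\<^bsub>T\<^esub> (y \<boxtimes>\<^bsub>T'\<^esub> z)) u)"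

text \<open>
  The scalars are given as a subset \<open>S\<close> of the ring acting on both sides, so that \<open>N \<otimes>\<^sub>B A\<close> is an
  instance for a subring \<open>B\<close> of \<open>A\<close> and a right \<open>B\<close>-module \<open>N\<close>.
\<close>

definition rmod_tensor ::
  "'r set \<Rightarrow> ('r, 'm, 'x) rmod_scheme \<Rightarrow> ('r, 'n, 'y) bimod_scheme \<Rightarrow> ('r, ('m, 'n) tensors) rmod" where
  "rmod_tensor S M N =
     (let T = tensor S M (ract M) N (lact N)
      in \<lparr>carrier = carrier T, monoid.mult = undefined, one = undefined, ring.zero = ring.zero T, add = add T,
          ract = (\<lambda>t a. tensor_map T id (\<lambda>y. y \<triangleleft>\<^bsub>N\<^esub> a) t)\<rparr>)"

definition bimod_tensor ::
  "'r set \<Rightarrow> ('r, 'm, 'x) bimod_scheme \<Rightarrow> ('r, 'n, 'y) bimod_scheme \<Rightarrow> ('r, ('m, 'n) tensors) bimod" where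
  "bimod_tensor S M N =
     (let T = rmod_tensor S M N
      in \<lparr>carrier = carrier T, monoid.mult = undefined, one = undefined, ring.zero = ring.zero T, add = add T,
          ract = ract T, lact = (\<lambda>a. tensor_map T (\<lambda>x. a \<triangleright>\<^bsub>M\<^esub> x) id)\<rparr>)"

definition kmod_tensor ::
  "('k, 's) ring_scheme \<Rightarrow> ('k, 'm, 'x) module_scheme \<Rightarrow> ('k, 'n, 'y) module_scheme
    \<Rightarrow> ('k, ('m, 'n) tensors) module" where
  "kmod_tensor k M N =
     (let T = tensor (carrier k) M (\<lambda>x c. c \<odot>\<^bsub>M\<^esub> x) N (\<lambda>c y. c \<odot>\<^bsub>N\<^esub> y)
      in \<lparr>carrier = carrier T, monoid.mult = undefined, one = undefined, ring.zero = ring.zero T, add = add T,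
          smult = (\<lambda>c. tensor_map T (\<lambda>x. c \<odot>\<^bsub>M\<^esub> x) id)\<rparr>)"


section \<open>Algebras, coalgebras and their comodules over a commutative ring\<close>

definition kmod_hom ::
  "('k, 's) ring_scheme \<Rightarrow> ('k, 'm, 'x) module_scheme \<Rightarrow> ('k, 'n, 'y) module_scheme \<Rightarrow> ('m \<Rightarrow> 'n) set" where
  "kmod_hom k M N = {f \<in> hom (add_monoid M) (add_monoid N).
     \<forall>c \<in> carrier k. \<forall>x \<in> carrier M. f (c \<odot>\<^bsub>M\<^esub> x) = c \<odot>\<^bsub>N\<^esub> f x}"

definition regular_kmod :: "('k, 's) ring_scheme \<Rightarrow> ('k, 'k) module" where
  "regular_kmod k = \<lparr>carrier = carrier k, monoid.mult = monoid.mult k, one = one k, ring.zero = ring.zero k,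
     add = add k, smult = monoid.mult k\<rparr>"

text \<open>The library locale \<open>algebra\<close> is restricted to commutative algebras.\<close>

locale k_algebra = module k A + A: ring A
  for k (structure) and A (structure) +
  assumes smult_mult_left: "\<lbrakk>c \<in> carrier k; x \<in> carrier A; y \<in> carrier A\<rbrakk>
      \<Longrightarrow> (c \<odot>\<^bsub>A\<^esub> x) \<otimes>\<^bsub>A\<^esub> y = c \<odot>\<^bsub>A\<^esub> (x \<otimes>\<^bsub>A\<^esub> y)"
    and smult_mult_right: "\<lbrakk>c \<in> carrier k; x \<in> carrier A; y \<in> carrier A\<rbrakk>
      \<Longrightarrow> x \<otimes>\<^bsub>A\<^esub> (c \<odot>\<^bsub>A\<^esub> y) = c \<odot>\<^bsub>A\<^esub> (x \<otimes>\<^bsub>A\<^esub> y)"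

record ('k, 'c) coalg = "('k, 'c) module" +
  comult :: "'c \<Rightarrow> ('c, 'c) tensors"
  counit :: "'c \<Rightarrow> 'k"

locale k_coalgebra = module k C
  for k (structure) and C :: "('k, 'c, 'z) coalg_scheme" (structure) +
  assumes comult_hom: "comult C \<in> kmod_hom k C (kmod_tensor k C C)"
    and counit_hom: "counit C \<in> kmod_hom k C (regular_kmod k)"
    and comult_coassoc: "c \<in> carrier C \<Longrightarrow>
      tensor_assoc (kmod_tensor k C (kmod_tensor k C C)) (kmod_tensor k C C)
        (tensor_map (kmod_tensor k (kmod_tensor k C C) C) (comult C) id (comult C c))
      = tensor_map (kmod_tensor k C (kmod_tensor k C C)) id (comult C) (comult C c)"
    and counit_left: "c \<in> carrier C \<Longrightarrow> tensor_lift C (\<lambda>x y. counit C x \<odot>\<^bsub>C\<^esub> y) (comult C c) = c"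
    and counit_right: "c \<in> carrier C \<Longrightarrow> tensor_lift C (\<lambda>x y. counit C y \<odot>\<^bsub>C\<^esub> x) (comult C c) = c"

locale coalgebra_comodule = k_coalgebra k C + M: module k M
  for k (structure) and C :: "('k, 'c, 'z) coalg_scheme" (structure)
    and M :: "('k, 'm, 'x) module_scheme" (structure)
    and \<rho> :: "'m \<Rightarrow> ('m, 'c) tensors" +
  assumes coaction_hom: "\<rho> \<in> kmod_hom k M (kmod_tensor k M C)"
    and coaction_coassoc: "m \<in> carrier M \<Longrightarrow>
      tensor_assoc (kmod_tensor k M (kmod_tensor k C C)) (kmod_tensor k C C)
        (tensor_map (kmod_tensor k (kmod_tensor k M C) C) \<rho> id (\<rho> m))
      = tensor_map (kmod_tensor k M (kmod_tensor k C C)) id (comult C) (\<rho> m)"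
    and coaction_counit: "m \<in> carrier M \<Longrightarrow> tensor_lift M (\<lambda>x c. counit C c \<odot>\<^bsub>M\<^esub> x) (\<rho> m) = m"

definition coalgebra_comodule_hom ::
  "('k, 's) ring_scheme \<Rightarrow> ('k, 'c, 'z) coalg_scheme
    \<Rightarrow> ('k, 'm, 'x) module_scheme \<Rightarrow> ('m \<Rightarrow> ('m, 'c) tensors)
    \<Rightarrow> ('k, 'n, 'y) module_scheme \<Rightarrow> ('n \<Rightarrow> ('n, 'c) tensors) \<Rightarrow> ('m \<Rightarrow> 'n) set" where
  "coalgebra_comodule_hom k C M \<rho> N \<sigma> = {f \<in> kmod_hom k M N.
     \<forall>m \<in> carrier M. \<sigma> (f m) = tensor_map (kmod_tensor k N C) f id (\<rho> m)}"

definition convolution ::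
  "('k, 'c, 'z) coalg_scheme \<Rightarrow> ('k, 'a, 'y) module_scheme \<Rightarrow> ('c \<Rightarrow> 'a) \<Rightarrow> ('c \<Rightarrow> 'a) \<Rightarrow> 'c \<Rightarrow> 'a" where
  "convolution C A f g c = tensor_lift A (\<lambda>x y. f x \<otimes>\<^bsub>A\<^esub> g y) (comult C c)"

definition convolution_invertible ::
  "('k, 's) ring_scheme \<Rightarrow> ('k, 'c, 'z) coalg_scheme \<Rightarrow> ('k, 'a, 'y) module_scheme \<Rightarrow> ('c \<Rightarrow> 'a) \<Rightarrow> bool" where
  "convolution_invertible k C A f \<longleftrightarrow> f \<in> kmod_hom k C A \<and>
     (\<exists>g \<in> kmod_hom k C A. \<forall>c \<in> carrier C.
        convolution C A f g c = counit C c \<odot>\<^bsub>A\<^esub> \<one>\<^bsub>A\<^esub> \<and>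
        convolution C A g f c = counit C c \<odot>\<^bsub>A\<^esub> \<one>\<^bsub>A\<^esub>)"


section \<open>Corings and their comodules\<close>

record ('a, 'm) coring = "('a, 'm) bimod" +
  ccomult :: "'m \<Rightarrow> ('m, 'm) tensors"
  ccounit :: "'m \<Rightarrow> 'a"

text \<open>
  As usual for algebras over \<open>k\<close>, the two \<open>k\<close>-actions on an \<open>A\<close>-\<open>A\<close>-bimodule are required to
  coincide.
\<close>

locale coring = k_algebra k A + X: bimodule A X
  for k (structure) and A (structure) and X :: "('a, 'm, 'x) coring_scheme" (structure) +
  assumes k_central: "\<lbrakk>c \<in> carrier k; x \<in> carrier X\<rbrakk>
      \<Longrightarrow> (c \<odot>\<^bsub>A\<^esub> \<one>\<^bsub>A\<^esub>) \<triangleright>\<^bsub>X\<^esub> x = x \<triangleleft>\<^bsub>X\<^esub> (c \<odot>\<^bsub>A\<^esub> \<one>\<^bsub>A\<^esub>)"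
    and ccomult_hom: "ccomult X \<in> bimod_hom A X (bimod_tensor (carrier A) X X)"
    and ccounit_hom: "ccounit X \<in> bimod_hom A X (regular_bimod A)"
    and ccomult_coassoc: "x \<in> carrier X \<Longrightarrow>
      tensor_assoc (bimod_tensor (carrier A) X (bimod_tensor (carrier A) X X)) (bimod_tensor (carrier A) X X)
        (tensor_map (bimod_tensor (carrier A) (bimod_tensor (carrier A) X X) X) (ccomult X) id (ccomult X x))
      = tensor_map (bimod_tensor (carrier A) X (bimod_tensor (carrier A) X X)) id (ccomult X) (ccomult X x)"
    and ccounit_left: "x \<in> carrier X \<Longrightarrow> tensor_lift X (\<lambda>y z. ccounit X y \<triangleright>\<^bsub>X\<^esub> z) (ccomult X x) = x"
    and ccounit_right: "x \<in> carrier X \<Longrightarrow> tensor_lift X (\<lambda>y z. y \<triangleleft>\<^bsub>X\<^esub> ccounit X z) (ccomult X x) = x"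

record ('a, 'm, 'x) comod = "('a, 'm) rmod" +
  coact :: "'m \<Rightarrow> ('m, 'x) tensors"

locale coring_comodule = right_module A M
  for A (structure) and X :: "('a, 'x, 'z) coring_scheme"
    and M :: "('a, 'm, 'x, 'y) comod_scheme" (structure) +
  assumes coact_hom: "coact M \<in> rmod_hom A M (rmod_tensor (carrier A) M X)"
    and coact_coassoc: "m \<in> carrier M \<Longrightarrow>
      tensor_assoc (rmod_tensor (carrier A) M (bimod_tensor (carrier A) X X)) (bimod_tensor (carrier A) X X)
        (tensor_map (rmod_tensor (carrier A) (rmod_tensor (carrier A) M X) X) (coact M) id (coact M m))
      = tensor_map (rmod_tensor (carrier A) M (bimod_tensor (carrier A) X X)) id (ccomult X) (coact M m)"
    and coact_counit: "m \<in> carrier M \<Longrightarrow> tensor_lift M (\<lambda>n x. n \<triangleleft>\<^bsub>M\<^esub> ccounit X x) (coact M m) = m"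

definition comodule_hom ::
  "('a, 's) ring_scheme \<Rightarrow> ('a, 'x, 'z) coring_scheme
    \<Rightarrow> ('a, 'm, 'x, 'y) comod_scheme \<Rightarrow> ('a, 'n, 'x, 'w) comod_scheme \<Rightarrow> ('m \<Rightarrow> 'n) set" where
  "comodule_hom A X M N = {f \<in> rmod_hom A M N.
     \<forall>m \<in> carrier M. coact N (f m) = tensor_map (rmod_tensor (carrier A) N X) f id (coact M m)}"


section \<open>Cleft extensions\<close>

text \<open>
  \<open>A \<otimes>\<^sub>k C\<close> with the left regular \<open>A\<close>-action and a given right \<open>A\<close>-action \<open>r\<close>.
\<close>

definition cleft_bimod ::
  "('k, 's) ring_scheme \<Rightarrow> ('k, 'a, 'y) module_scheme \<Rightarrow> ('k, 'c, 'z) coalg_scheme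
    \<Rightarrow> (('a, 'c) tensors \<Rightarrow> 'a \<Rightarrow> ('a, 'c) tensors) \<Rightarrow> ('a, ('a, 'c) tensors) bimod" where
  "cleft_bimod k A C r =
     (let T = kmod_tensor k A C
      in \<lparr>carrier = carrier T, monoid.mult = undefined, one = undefined, ring.zero = ring.zero T, add = add T,
          ract = r, lact = (\<lambda>a. tensor_map T (\<lambda>b. a \<otimes>\<^bsub>A\<^esub> b) id)\<rparr>)"

text \<open>
  The isomorphism \<open>A \<otimes>\<^sub>k C \<otimes>\<^sub>k C \<rightarrow> (A \<otimes>\<^sub>k C) \<otimes>\<^sub>A (A \<otimes>\<^sub>k C)\<close> sends \<open>a \<otimes> c \<otimes> d\<close> to
  \<open>(a \<otimes> c) \<otimes> (1 \<otimes> d)\<close>; the coproduct below is its composite with \<open>A \<otimes> \<Delta>\<close>. The counit is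
  \<open>A \<otimes> \<epsilon>\<close>, followed by \<open>A \<otimes>\<^sub>k k \<cong> A\<close>.
\<close>

definition cleft_coring ::
  "('k, 's) ring_scheme \<Rightarrow> ('k, 'a, 'y) module_scheme \<Rightarrow> ('k, 'c, 'z) coalg_scheme
    \<Rightarrow> (('a, 'c) tensors \<Rightarrow> 'a \<Rightarrow> ('a, 'c) tensors) \<Rightarrow> ('a, ('a, 'c) tensors) coring" where
  "cleft_coring k A C r =
     (let X = cleft_bimod k A C r; XX = bimod_tensor (carrier A) X X
      in \<lparr>carrier = carrier X, monoid.mult = undefined, one = undefined, ring.zero = ring.zero X, add = add X,
          ract = ract X, lact = lact X,
          ccomult = tensor_lift XX (\<lambda>a c. tensor_lift XX
            (\<lambda>c' c''. (a \<boxtimes>\<^bsub>X\<^esub> c') \<boxtimes>\<^bsub>XX\<^esub> (\<one>\<^bsub>A\<^esub> \<boxtimes>\<^bsub>X\<^esub> c'')) (comult C c)),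
          ccounit = tensor_lift A (\<lambda>a c. counit C c \<odot>\<^bsub>A\<^esub> a)\<rparr>)"

text \<open>
  The coinvariants of \<open>A\<close>; on the right-hand side, \<open>b\<close> acts on the first factor of \<open>A \<otimes>\<^sub>k C\<close>.
\<close>

definition coinvariants ::
  "('k, 's) ring_scheme \<Rightarrow> ('k, 'a, 'y) module_scheme \<Rightarrow> ('k, 'c, 'z) coalg_scheme
    \<Rightarrow> ('a \<Rightarrow> ('a, 'c) tensors) \<Rightarrow> 'a set" where
  "coinvariants k A C \<rho> = {b \<in> carrier A. \<forall>a \<in> carrier A.
     \<rho> (b \<otimes>\<^bsub>A\<^esub> a) = tensor_map (kmod_tensor k A C) (\<lambda>x. b \<otimes>\<^bsub>A\<^esub> x) id (\<rho> a)}"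

locale algebra_extension = k_algebra k A + coalgebra_comodule k C A \<rho>
  for k (structure) and A (structure) and C :: "('k, 'c, 'z) coalg_scheme" (structure)
    and \<rho> :: "'a \<Rightarrow> ('a, 'c) tensors" and B :: "'a set" +
  assumes B_eq: "B = coinvariants k A C \<rho>"

locale cleft_extension = algebra_extension k A C \<rho> B + coring k A "cleft_coring k A C r"
  for k (structure) and A (structure) and C :: "('k, 'c, 'z) coalg_scheme" (structure)
    and \<rho> :: "'a \<Rightarrow> ('a, 'c) tensors" and B :: "'a set"
    and r :: "('a, 'c) tensors \<Rightarrow> 'a \<Rightarrow> ('a, 'c) tensors" +
  assumes coaction_right_linear: "\<rho> \<in> rmod_hom A (regular_bimod A) (cleft_coring k A C r)"
    and cleaving_map: "\<exists>j \<in> coalgebra_comodule_hom k C C (comult C) A \<rho>. convolution_invertible k C A j"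


section \<open>Categories and equivalences\<close>

text \<open>
  Morphisms need not determine their source and target, so composition and the action of a functor
  on morphisms take the objects as arguments: \<open>Cmp D X Y Z g f\<close> is \<open>g \<circ> f\<close> for \<open>f : X \<rightarrow> Y\<close> and
  \<open>g : Y \<rightarrow> Z\<close>.
\<close>

record ('o, 'h) cat =
  Ob :: "'o set"
  Mor :: "'o \<Rightarrow> 'o \<Rightarrow> 'h set"
  Idn :: "'o \<Rightarrow> 'h"
  Cmp :: "'o \<Rightarrow> 'o \<Rightarrow> 'o \<Rightarrow> 'h \<Rightarrow> 'h \<Rightarrow> 'h"

locale category =
  fixes D :: "('o, 'h) cat"
  assumes Idn_mor: "X \<in> Ob D \<Longrightarrow> Idn D X \<in> Mor D X X"
    and Cmp_mor: "\<lbrakk>X \<in> Ob D; Y \<in> Ob D; Z \<in> Ob D; f \<in> Mor D X Y; g \<in> Mor D Y Z\<rbrakk>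
      \<Longrightarrow> Cmp D X Y Z g f \<in> Mor D X Z"
    and Cmp_Idn_right: "\<lbrakk>X \<in> Ob D; Y \<in> Ob D; f \<in> Mor D X Y\<rbrakk> \<Longrightarrow> Cmp D X X Y f (Idn D X) = f"
    and Cmp_Idn_left: "\<lbrakk>X \<in> Ob D; Y \<in> Ob D; f \<in> Mor D X Y\<rbrakk> \<Longrightarrow> Cmp D X Y Y (Idn D Y) f = f"
    and Cmp_assoc: "\<lbrakk>W \<in> Ob D; X \<in> Ob D; Y \<in> Ob D; Z \<in> Ob D; f \<in> Mor D W X; g \<in> Mor D X Y; h \<in> Mor D Y Z\<rbrakk>
      \<Longrightarrow> Cmp D W X Z (Cmp D X Y Z h g) f = Cmp D W Y Z h (Cmp D W X Y g f)"

record ('o, 'h, 'p, 'i) funct =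
  FOb :: "'o \<Rightarrow> 'p"
  FMor :: "'o \<Rightarrow> 'o \<Rightarrow> 'h \<Rightarrow> 'i"

locale is_functor = D: category D + E: category E
  for D :: "('o, 'h) cat" and E :: "('p, 'i) cat" and F :: "('o, 'h, 'p, 'i) funct" +
  assumes FOb_ob: "X \<in> Ob D \<Longrightarrow> FOb F X \<in> Ob E"
    and FMor_mor: "\<lbrakk>X \<in> Ob D; Y \<in> Ob D; f \<in> Mor D X Y\<rbrakk> \<Longrightarrow> FMor F X Y f \<in> Mor E (FOb F X) (FOb F Y)"
    and FMor_Idn: "X \<in> Ob D \<Longrightarrow> FMor F X X (Idn D X) = Idn E (FOb F X)"
    and FMor_Cmp: "\<lbrakk>X \<in> Ob D; Y \<in> Ob D; Z \<in> Ob D; f \<in> Mor D X Y; g \<in> Mor D Y Z\<rbrakk>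
      \<Longrightarrow> FMor F X Z (Cmp D X Y Z g f) = Cmp E (FOb F X) (FOb F Y) (FOb F Z) (FMor F Y Z g) (FMor F X Y f)"

definition id_functor :: "('o, 'h, 'o, 'h) funct" where
  "id_functor = \<lparr>FOb = (\<lambda>X. X), FMor = (\<lambda>X Y f. f)\<rparr>"

definition comp_functor ::
  "('p, 'i, 'q, 'l) funct \<Rightarrow> ('o, 'h, 'p, 'i) funct \<Rightarrow> ('o, 'h, 'q, 'l) funct" where
  "comp_functor G F = \<lparr>FOb = (\<lambda>X. FOb G (FOb F X)),
     FMor = (\<lambda>X Y f. FMor G (FOb F X) (FOb F Y) (FMor F X Y f))\<rparr>"

definition isos :: "('o, 'h) cat \<Rightarrow> 'o \<Rightarrow> 'o \<Rightarrow> 'h set" where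
  "isos D X Y = {f \<in> Mor D X Y. \<exists>g \<in> Mor D Y X. Cmp D X Y X g f = Idn D X \<and> Cmp D Y X Y f g = Idn D Y}"

definition naturally_isomorphic ::
  "('o, 'h) cat \<Rightarrow> ('p, 'i) cat \<Rightarrow> ('o, 'h, 'p, 'i) funct \<Rightarrow> ('o, 'h, 'p, 'i) funct \<Rightarrow> bool" where
  "naturally_isomorphic D E F G \<longleftrightarrow>
     (\<exists>\<eta>. (\<forall>X \<in> Ob D. \<eta> X \<in> isos E (FOb F X) (FOb G X)) \<and>
          (\<forall>X \<in> Ob D. \<forall>Y \<in> Ob D. \<forall>f \<in> Mor D X Y.
             Cmp E (FOb F X) (FOb F Y) (FOb G Y) (\<eta> Y) (FMor F X Y f) =
             Cmp E (FOb F X) (FOb G X) (FOb G Y) (FMor G X Y f) (\<eta> X)))"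

definition is_equivalence ::
  "('o, 'h) cat \<Rightarrow> ('p, 'i) cat \<Rightarrow> ('o, 'h, 'p, 'i) funct \<Rightarrow> bool" where
  "is_equivalence D E F \<longleftrightarrow> is_functor D E F \<and>
     (\<exists>G. is_functor E D G \<and>
          naturally_isomorphic D D id_functor (comp_functor G F) \<and>
          naturally_isomorphic E E (comp_functor F G) id_functor)"


section \<open>The module and comodule categories and the induction functor\<close>

text \<open>
  The type \<open>'u\<close> plays the role of the universe from which the carriers of the objects are taken.
  Morphisms are functions restricted to the carrier of their source, so that equality of morphisms
  is equality of functions.
\<close>

definition rmod_cat :: "('r, 's) ring_scheme \<Rightarrow> (('r, 'u) rmod, 'u \<Rightarrow> 'u) cat" where
  "rmod_cat R = \<lparr>Ob = {M. right_module R M},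
     Mor = (\<lambda>M N. extensional (carrier M) \<inter> rmod_hom R M N),
     Idn = (\<lambda>M. \<lambda>x \<in> carrier M. x),
     Cmp = (\<lambda>L M N g f. compose (carrier L) g f)\<rparr>"

definition comod_cat ::
  "('a, 's) ring_scheme \<Rightarrow> ('a, 'x, 'z) coring_scheme \<Rightarrow> (('a, 'u, 'x) comod, 'u \<Rightarrow> 'u) cat" where
  "comod_cat A X = \<lparr>Ob = {M. coring_comodule A X M},
     Mor = (\<lambda>M N. extensional (carrier M) \<inter> comodule_hom A X M N),
     Idn = (\<lambda>M. \<lambda>x \<in> carrier M. x),
     Cmp = (\<lambda>L M N g f. compose (carrier L) g f)\<rparr>"

text \<open>
  The comodule \<open>N \<otimes>\<^sub>B A\<close> with coaction \<open>N \<otimes> \<rho>\<close>. Under \<open>A \<otimes>\<^sub>k C = X \<cong> A \<otimes>\<^sub>A X\<close> the element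
  \<open>\<rho> a\<close> is \<open>1 \<otimes> \<rho> a\<close>, so \<open>n \<otimes> a\<close> is sent to \<open>(n \<otimes> 1) \<otimes> \<rho> a\<close>.
\<close>

definition induced_comodule ::
  "('a, 's) ring_scheme \<Rightarrow> 'a set \<Rightarrow> ('a, 'x, 'z) coring_scheme \<Rightarrow> ('a \<Rightarrow> 'x)
    \<Rightarrow> ('a, 'n, 'y) rmod_scheme \<Rightarrow> ('a, ('n, 'a) tensors, 'x) comod" where
  "induced_comodule A B X \<rho> N =
     (let T = rmod_tensor B N (regular_bimod A); TX = rmod_tensor (carrier A) T X
      in \<lparr>carrier = carrier T, monoid.mult = undefined, one = undefined, ring.zero = ring.zero T, add = add T,
          ract = ract T,
          coact = tensor_lift TX (\<lambda>n a. (n \<boxtimes>\<^bsub>T\<^esub> \<one>\<^bsub>A\<^esub>) \<boxtimes>\<^bsub>TX\<^esub> \<rho> a)\<rparr>)"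

text \<open>Transport of structure along a map \<open>\<theta>\<close> that is injective on the carrier.\<close>

definition transport_rmod ::
  "('m \<Rightarrow> 'u) \<Rightarrow> ('a, 'm, 'y) rmod_scheme \<Rightarrow> ('a, 'u) rmod" where
  "transport_rmod \<theta> M =
     (let \<theta>' = inv_into (carrier M) \<theta>
      in \<lparr>carrier = \<theta> ` carrier M, monoid.mult = undefined, one = undefined, ring.zero = \<theta> \<zero>\<^bsub>M\<^esub>,
          add = (\<lambda>x y. \<theta> (\<theta>' x \<oplus>\<^bsub>M\<^esub> \<theta>' y)), ract = (\<lambda>x a. \<theta> (\<theta>' x \<triangleleft>\<^bsub>M\<^esub> a))\<rparr>)"

definition transport_comod ::
  "('a, 's) ring_scheme \<Rightarrow> ('a, 'x, 'z) coring_scheme \<Rightarrow> ('m \<Rightarrow> 'u)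
    \<Rightarrow> ('a, 'm, 'x, 'y) comod_scheme \<Rightarrow> ('a, 'u, 'x) comod" where
  "transport_comod A X \<theta> M =
     (let M' = transport_rmod \<theta> M
      in \<lparr>carrier = carrier M', monoid.mult = undefined, one = undefined, ring.zero = ring.zero M', add = add M',
          ract = ract M',
          coact = (\<lambda>x. tensor_map (rmod_tensor (carrier A) M' X) \<theta> id
            (coact M (inv_into (carrier M) \<theta> x)))\<rparr>)"

text \<open>
  The carrier of \<open>N \<otimes>\<^sub>B A\<close> is brought back into the universe \<open>'u\<close> by means of an injection \<open>enc\<close>
  of formal sums into \<open>'u\<close>, applied to a chosen representative of each class. Such an injection
  exists for every infinite \<open>'u\<close> into which the type of \<open>A\<close> embeds (\<open>inj_enc_exists\<close>).
\<close>

definition tensor_code :: "(('u \<times> 'a \<Rightarrow>\<^sub>0 int) \<Rightarrow> 'u) \<Rightarrow> ('u, 'a) tensors \<Rightarrow> 'u" where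
  "tensor_code enc X = enc (SOME p. p \<in> X)"

lemma inj_enc_exists:
  fixes g :: "'a \<Rightarrow> 'u"
  assumes "infinite (UNIV :: 'u set)" "inj g"
  shows "\<exists>enc :: ('u \<times> 'a \<Rightarrow>\<^sub>0 int) \<Rightarrow> 'u. inj enc"
proof -
  have "(UNIV :: ('u \<times> 'a) set) \<lesssim> (UNIV :: ('u \<times> 'u) set)"
    unfolding lepoll_def
    by (rule exI[of _ "map_prod id g"]) (use assms(2) in \<open>auto intro: prod.inj_map\<close>)
  also have "(UNIV :: ('u \<times> 'u) set) \<lesssim> (UNIV :: 'u set)"
    using card_of_Times_same_infinite[OF assms(1)]
    by (simp add: eqpoll_iff_card_of_ordIso eqpoll_imp_lepoll)
  finally have 1: "(UNIV :: ('u \<times> 'a) set) \<lesssim> (UNIV :: 'u set)" .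
  have inf: "infinite (UNIV :: ('u \<times> 'a) set)"
    using assms(1) by (simp add: finite_prod)
  have "(UNIV :: ('u \<times> 'a \<Rightarrow>\<^sub>0 int) set) = carrier (free_Abelian_group (UNIV :: ('u \<times> 'a) set))"
    by auto
  also have "\<dots> \<lesssim> (UNIV :: ('u \<times> 'a) set)"
    using eqpoll_free_Abelian_group_infinite[OF inf] by (rule eqpoll_imp_lepoll)
  also note 1
  finally show ?thesis by (auto simp: lepoll_def)
qed

definition induction_functor ::
  "('a, 's) ring_scheme \<Rightarrow> 'a set \<Rightarrow> ('a, 'x, 'z) coring_scheme \<Rightarrow> ('a \<Rightarrow> 'x)
    \<Rightarrow> (('u \<times> 'a \<Rightarrow>\<^sub>0 int) \<Rightarrow> 'u)
    \<Rightarrow> (('a, 'u) rmod, 'u \<Rightarrow> 'u, ('a, 'u, 'x) comod, 'u \<Rightarrow> 'u) funct" where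
  "induction_functor A B X \<rho> enc =
     (let T = (\<lambda>N. induced_comodule A B X \<rho> N); \<theta> = tensor_code enc;
          F = (\<lambda>N. transport_comod A X \<theta> (T N))
      in \<lparr>FOb = F,
          FMor = (\<lambda>N N' f. \<lambda>x \<in> carrier (F N).
            \<theta> (tensor_map (T N') f id (inv_into (carrier (T N)) \<theta> x)))\<rparr>)"

end

theory Submission
  imports Defs
begin

text \<open>
  Let \<open>j\<close> be the cleaving map, \<open>i\<close> its convolution inverse, \<open>X = A \<otimes>\<^sub>k C\<close> and \<open>g = \<rho> 1\<close>. Right linearity
  of \<open>\<rho>\<close> gives \<open>\<rho> a = g a\<close>, so \<open>g\<close> is grouplike and \<open>B = {b. b g = g b}\<close>. The right adjoint of
  induction sends a comodule \<open>M\<close> to its coinvariants \<open>{m. coact m = m \<otimes> g}\<close>. The element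
  \<open>p(m) = m\<^sub>0 i(m\<^sub>1)\<close> is coinvariant for every \<open>m\<close>, and \<open>m \<mapsto> p(m\<^sub>0) \<otimes> j(m\<^sub>1)\<close> inverts the counit. By the
  triangle identity the unit \<open>\<eta>\<close> then becomes
  bijective after applying \<open>- \<otimes>\<^sub>B A\<close>. The left \<open>B\<close>-linear maps \<open>\<phi>\<^sub>l(a) = p(a\<^sub>0) v\<^sub>l(a\<^sub>1)\<close> from \<open>A\<close>
  to \<open>B\<close> satisfy \<open>\<phi>\<^sub>l(j(d\<^sub>l)) = v\<^sub>l(d\<^sub>l)\<close>, hence \<open>A\<close> is a generator of left \<open>B\<close>-modules and \<open>\<eta>\<close>
  itself is bijective.
\<close>

section \<open>Tensor products of abelian groups\<close>

text \<open>The right action \<open>r\<close> has no formula: it is constrained only by the coring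
  axioms and by right linearity of \<open>\<rho>\<close>, so the handle on it is
  \<open>g a = \<rho> a\<close>. The obstacle is to compute \<open>(1 \<otimes> c1) i(c2)\<close> in
  \<open>X\<close> (Sweedler notation). Colinearity of \<open>j\<close> does this indirectly:
  convolving with \<open>j\<close> on the left yields
  \<open>\<rho> (j(c1)) i(c2) = g j(c1) i(c2)\<close>, which collapses to a scalar multiple of
  \<open>g\<close>, and cancelling \<open>j\<close> leaves \<open>i(c) g\<close>. With
  \<open>h (a \<otimes> c) = a i(c)\<close> this reads \<open>x1 h(x2) = h(x) g\<close>, and
  coassociativity of the coaction turns it into coinvariance of \<open>p(m) = m0 h(m1)\<close>. The
  opposite identity \<open>i(c1) j(c2) = \<epsilon>(c) 1\<close> is what recovers \<open>m\<close>
  from its pieces. The generator property is used in explicit form: it yields a formula for the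
  inverse of \<open>\<eta>\<close>. Tensors are cosets, so a Sweedler expression is an iterated
  \<open>tensor_lift\<close>, each rewriting comes with a balancedness proof, and coassociativity
  acts as independence of bracketing (\<open>tensor_lift_assoc\<close>). Scalars from
  \<open>k\<close> cross tensor signs over \<open>A\<close> and over \<open>B\<close> because
  \<open>s 1\<close> acts centrally on \<open>X\<close> and therefore lies in
  \<open>B\<close>.\<close>

abbreviation additive_maps :: "('m, 'x) ring_scheme \<Rightarrow> ('n, 'y) ring_scheme \<Rightarrow> ('m \<Rightarrow> 'n) set" where
  "additive_maps M N \<equiv> hom (add_monoid M) (add_monoid N)"

lemma additive_mapI:
  assumes "\<And>x. x \<in> carrier M \<Longrightarrow> f x \<in> carrier N"
    and "\<And>x y. \<lbrakk>x \<in> carrier M; y \<in> carrier M\<rbrakk> \<Longrightarrow> f (x \<oplus>\<^bsub>M\<^esub> y) = f x \<oplus>\<^bsub>N\<^esub> f y"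
  shows "f \<in> additive_maps M N"
  using assms by (auto simp: hom_def)

lemma additive_map_closed: "\<lbrakk>f \<in> additive_maps M N; x \<in> carrier M\<rbrakk> \<Longrightarrow> f x \<in> carrier N"
  by (auto simp: hom_def)

lemma additive_map_add:
  "\<lbrakk>f \<in> additive_maps M N; x \<in> carrier M; y \<in> carrier M\<rbrakk> \<Longrightarrow> f (x \<oplus>\<^bsub>M\<^esub> y) = f x \<oplus>\<^bsub>N\<^esub> f y"
  by (auto simp: hom_def)

lemma additive_map_zero:
  assumes "abelian_group M" "abelian_group N" "f \<in> additive_maps M N"
  shows "f \<zero>\<^bsub>M\<^esub> = \<zero>\<^bsub>N\<^esub>"
  using hom_one[of f "add_monoid M" "add_monoid N"] assms
  by (simp add: abelian_group.a_group)

lemma additive_map_comp: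
  "\<lbrakk>f \<in> additive_maps L M; g \<in> additive_maps M N\<rbrakk> \<Longrightarrow> (\<lambda>x. g (f x)) \<in> additive_maps L N"
  by (rule additive_mapI) (simp_all add: additive_map_closed additive_map_add)

lemma additive_map_id: "id \<in> additive_maps M M"
  by (auto simp: hom_def)

section \<open>Balanced biadditive maps and the universal property of the tensor product\<close>

definition balanced_map ::
  "'r set \<Rightarrow> ('m, 'x) ring_scheme \<Rightarrow> ('m \<Rightarrow> 'r \<Rightarrow> 'm) \<Rightarrow> ('n, 'y) ring_scheme \<Rightarrow> ('r \<Rightarrow> 'n \<Rightarrow> 'n)
    \<Rightarrow> ('g, 'z) ring_scheme \<Rightarrow> ('m \<Rightarrow> 'n \<Rightarrow> 'g) \<Rightarrow> bool" where
  "balanced_map S M ra N la G f \<longleftrightarrow>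
     (\<forall>x \<in> carrier M. f x \<in> additive_maps N G) \<and>
     (\<forall>y \<in> carrier N. (\<lambda>x. f x y) \<in> additive_maps M G) \<and>
     (\<forall>x \<in> carrier M. \<forall>s \<in> S. \<forall>y \<in> carrier N. f (ra x s) y = f x (la s y))"

lemma balanced_mapI:
  assumes "\<And>x y. \<lbrakk>x \<in> carrier M; y \<in> carrier N\<rbrakk> \<Longrightarrow> f x y \<in> carrier G"
    and "\<And>x x' y. \<lbrakk>x \<in> carrier M; x' \<in> carrier M; y \<in> carrier N\<rbrakk> \<Longrightarrow> f (x \<oplus>\<^bsub>M\<^esub> x') y = f x y \<oplus>\<^bsub>G\<^esub> f x' y"
    and "\<And>x y y'. \<lbrakk>x \<in> carrier M; y \<in> carrier N; y' \<in> carrier N\<rbrakk> \<Longrightarrow> f x (y \<oplus>\<^bsub>N\<^esub> y') = f x y \<oplus>\<^bsub>G\<^esub> f x y'"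
    and "\<And>x s y. \<lbrakk>x \<in> carrier M; s \<in> S; y \<in> carrier N\<rbrakk> \<Longrightarrow> f (ra x s) y = f x (la s y)"
  shows "balanced_map S M ra N la G f"
  using assms by (simp add: balanced_map_def hom_def)

lemma balanced_mapD:
  assumes "balanced_map S M ra N la G f"
  shows "\<lbrakk>x \<in> carrier M; y \<in> carrier N\<rbrakk> \<Longrightarrow> f x y \<in> carrier G"
    and "\<lbrakk>x \<in> carrier M; x' \<in> carrier M; y \<in> carrier N\<rbrakk> \<Longrightarrow> f (x \<oplus>\<^bsub>M\<^esub> x') y = f x y \<oplus>\<^bsub>G\<^esub> f x' y"
    and "\<lbrakk>x \<in> carrier M; y \<in> carrier N; y' \<in> carrier N\<rbrakk> \<Longrightarrow> f x (y \<oplus>\<^bsub>N\<^esub> y') = f x y \<oplus>\<^bsub>G\<^esub> f x y'"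
    and "\<lbrakk>x \<in> carrier M; s \<in> S; y \<in> carrier N\<rbrakk> \<Longrightarrow> f (ra x s) y = f x (la s y)"
  using assms by (auto simp add: balanced_map_def hom_def)

text \<open>\<open>T\<close> is fixed only up to the additive part of its record, so one theory
  covers \<open>tensor\<close>, \<open>rmod_tensor\<close>, \<open>bimod_tensor\<close>,
  \<open>kmod_tensor\<close>, and later the coring \<open>X\<close> and the comodules
  \<open>ind N\<close> themselves. The zero has to agree because \<open>pure_tensor\<close> reads
  the subgroup of relations off it. Of the two actions only closure is required.\<close>

locale tensor_product = M?: abelian_group M + N?: abelian_group N
  for S :: "'r set" and M :: "('m, 'x) ring_scheme" and ra :: "'m \<Rightarrow> 'r \<Rightarrow> 'm"
    and N :: "('n, 'y) ring_scheme" and la :: "'r \<Rightarrow> 'n \<Rightarrow> 'n"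
    and T :: "(('m, 'n) tensors, 't) ring_scheme" (structure) +
  assumes ra_closed: "\<lbrakk>x \<in> carrier M; s \<in> S\<rbrakk> \<Longrightarrow> ra x s \<in> carrier M"
    and la_closed: "\<lbrakk>y \<in> carrier N; s \<in> S\<rbrakk> \<Longrightarrow> la s y \<in> carrier N"
    and carrier_eq: "carrier T = carrier (tensor S M ra N la)"
    and zero_eq: "\<zero> = \<zero>\<^bsub>tensor S M ra N la\<^esub>"
    and add_eq: "add T = add (tensor S M ra N la)"
begin

abbreviation (input) "F \<equiv> free_Abelian_group (carrier M \<times> carrier N)"
abbreviation (input) "relators \<equiv> tensor_relators S M ra N la"
abbreviation (input) "relations \<equiv> generate F relators"

lemma relators_closed: "relators \<subseteq> carrier F"
proof
  fix p assume "p \<in> relators"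
  then consider
      (left) x x' y where "p = frag_of (x \<oplus>\<^bsub>M\<^esub> x', y) - frag_of (x, y) - frag_of (x', y)"
        "x \<in> carrier M" "x' \<in> carrier M" "y \<in> carrier N"
    | (right) x y y' where "p = frag_of (x, y \<oplus>\<^bsub>N\<^esub> y') - frag_of (x, y) - frag_of (x, y')"
        "x \<in> carrier M" "y \<in> carrier N" "y' \<in> carrier N"
    | (bal) x s y where "p = frag_of (ra x s, y) - frag_of (x, la s y)"
        "x \<in> carrier M" "s \<in> S" "y \<in> carrier N"
    unfolding tensor_relators_def by blast
  then show "p \<in> carrier F"
  proof cases
    case left
    have "Poly_Mapping.keys p \<subseteq> {(x \<oplus>\<^bsub>M\<^esub> x', y), (x, y), (x', y)}"
      unfolding left by (intro order.trans[OF keys_diff] Un_least) auto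
    then show ?thesis using left by auto
  next
    case right
    have "Poly_Mapping.keys p \<subseteq> {(x, y \<oplus>\<^bsub>N\<^esub> y'), (x, y), (x, y')}"
      unfolding right by (intro order.trans[OF keys_diff] Un_least) auto
    then show ?thesis using right by auto
  next
    case bal
    have "Poly_Mapping.keys p \<subseteq> {(ra x s, y), (x, la s y)}"
      unfolding bal by (intro order.trans[OF keys_diff] Un_least) auto
    then show ?thesis using bal ra_closed la_closed by auto
  qed
qed

lemma relations_normal: "relations \<lhd> F"
proof -
  interpret F: comm_group F by (rule abelian_free_Abelian_group)
  have "subgroup relations F"
    by (rule F.generate_is_subgroup[OF relators_closed])
  then show ?thesis
    by (simp add: F.subgroup_imp_normal)
qed

lemma tensor_add_monoid:
  "carrier T = carrier (F Mod relations)"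
  "add T = mult (F Mod relations)" "\<zero> = \<one>\<^bsub>F Mod relations\<^esub>"
  by (simp_all add: carrier_eq add_eq zero_eq tensor_def Let_def)

lemma zero_relations: "\<zero> = relations"
  by (simp add: tensor_add_monoid FactGroup_def)

lemma abelian_group_T: "abelian_group T"
proof -
  have Q: "comm_group (F Mod relations)"
    by (rule comm_group.abelian_FactGroup[OF abelian_free_Abelian_group
          normal_imp_subgroup[OF relations_normal]])
  interpret Q: comm_group "F Mod relations" by (rule Q)
  show ?thesis
    by (rule abelian_groupI; unfold tensor_add_monoid)
      (simp_all add: Q.m_ac Q.l_inv_ex del: mult_FactGroup one_FactGroup)
qed

sublocale T: abelian_group T
  by (rule abelian_group_T)

lemma carrierE:
  assumes "t \<in> carrier T"
  obtains p where "p \<in> carrier F" "t = relations #>\<^bsub>F\<^esub> p"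
  using assms unfolding tensor_add_monoid by (auto simp: FactGroup_def RCOSETS_def)

lemma coset_closed: "p \<in> carrier F \<Longrightarrow> relations #>\<^bsub>F\<^esub> p \<in> carrier T"
  unfolding tensor_add_monoid by (auto simp: FactGroup_def RCOSETS_def)

lemma coset_add:
  assumes "p \<in> carrier F" "q \<in> carrier F"
  shows "(relations #>\<^bsub>F\<^esub> p) \<oplus> (relations #>\<^bsub>F\<^esub> q) = relations #>\<^bsub>F\<^esub> (p + q)"
  using normal.rcos_sum[OF relations_normal assms]
  by (simp add: tensor_add_monoid)

lemma coset_eqI:
  assumes "p \<in> carrier F" "q \<in> carrier F" "p - q \<in> relations"
  shows "relations #>\<^bsub>F\<^esub> p = relations #>\<^bsub>F\<^esub> q"
proof -
  have sub: "subgroup relations F" using relations_normal by (rule normal_imp_subgroup)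
  have "p \<in> relations #>\<^bsub>F\<^esub> q"
    using assms(3) by (force simp: r_coset_def)
  then show ?thesis
    using group.repr_independence[OF group_free_Abelian_group _ assms(2) sub] by auto
qed

lemma pure_tensor_coset: "x \<boxtimes> y = relations #>\<^bsub>F\<^esub> frag_of (x, y)"
  by (auto simp: pure_tensor_def zero_relations r_coset_def)

lemma pure_closed: "\<lbrakk>x \<in> carrier M; y \<in> carrier N\<rbrakk> \<Longrightarrow> x \<boxtimes> y \<in> carrier T"
  unfolding pure_tensor_coset by (rule coset_closed) auto

lemma frag_add_closed: "\<lbrakk>p \<in> carrier F; q \<in> carrier F\<rbrakk> \<Longrightarrow> p + q \<in> carrier F"
  using keys_add[of p q] by auto

lemma pure_add_left:
  assumes "x \<in> carrier M" "x' \<in> carrier M" "y \<in> carrier N"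
  shows "(x \<oplus>\<^bsub>M\<^esub> x') \<boxtimes> y = x \<boxtimes> y \<oplus> x' \<boxtimes> y"
proof -
  have "frag_of (x \<oplus>\<^bsub>M\<^esub> x', y) - (frag_of (x, y) + frag_of (x', y)) \<in> relations"
    by (rule generate.incl) (use assms in \<open>auto simp: tensor_relators_def diff_diff_eq\<close>)
  moreover have "frag_of (x, y) \<in> carrier F" "frag_of (x', y) \<in> carrier F"
    using assms by auto
  ultimately show ?thesis
    unfolding pure_tensor_coset using assms
    by (simp add: coset_add frag_add_closed coset_eqI del: carrier_free_Abelian_group_iff)
qed

lemma pure_add_right:
  assumes "x \<in> carrier M" "y \<in> carrier N" "y' \<in> carrier N"
  shows "x \<boxtimes> (y \<oplus>\<^bsub>N\<^esub> y') = x \<boxtimes> y \<oplus> x \<boxtimes> y'"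
proof -
  have "frag_of (x, y \<oplus>\<^bsub>N\<^esub> y') - (frag_of (x, y) + frag_of (x, y')) \<in> relations"
    by (rule generate.incl) (use assms in \<open>auto simp: tensor_relators_def diff_diff_eq\<close>)
  moreover have "frag_of (x, y) \<in> carrier F" "frag_of (x, y') \<in> carrier F"
    using assms by auto
  ultimately show ?thesis
    unfolding pure_tensor_coset using assms
    by (simp add: coset_add frag_add_closed coset_eqI del: carrier_free_Abelian_group_iff)
qed

lemma pure_balanced:
  assumes "x \<in> carrier M" "s \<in> S" "y \<in> carrier N"
  shows "ra x s \<boxtimes> y = x \<boxtimes> la s y"
proof -
  have "frag_of (ra x s, y) - frag_of (x, la s y) \<in> relations"
    by (rule generate.incl) (use assms in \<open>auto simp: tensor_relators_def\<close>)
  then show ?thesis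
    unfolding pure_tensor_coset using assms ra_closed la_closed
    by (intro coset_eqI) auto
qed

lemma pure_zero_left: "y \<in> carrier N \<Longrightarrow> \<zero>\<^bsub>M\<^esub> \<boxtimes> y = \<zero>"
  by (metis M.add.l_cancel_one M.zero_closed T.add.r_cancel_one pure_add_left pure_closed M.add.r_one)

lemma pure_balanced_map: "balanced_map S M ra N la T (\<lambda>x y. x \<boxtimes> y)"
  by (rule balanced_mapI) (simp_all add: pure_closed pure_add_left pure_add_right pure_balanced)

text \<open>A negative generator is again a pure tensor, which is why \<open>tensor_induct\<close>
  has no case for negatives.\<close>

lemma coset_uminus_pure:
  assumes "x \<in> carrier M" "y \<in> carrier N"
  shows "relations #>\<^bsub>F\<^esub> (- frag_of (x, y)) = (\<ominus>\<^bsub>M\<^esub> x) \<boxtimes> y"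
proof -
  have cl: "- frag_of (x, y) \<in> carrier F" "frag_of (x, y) \<in> carrier F"
    using assms by auto
  have "(relations #>\<^bsub>F\<^esub> (- frag_of (x, y))) \<oplus> x \<boxtimes> y = relations #>\<^bsub>F\<^esub> 0"
    unfolding pure_tensor_coset using cl by (simp add: coset_add del: carrier_free_Abelian_group_iff)
  also have "\<dots> = \<zero>"
    by (auto simp: zero_relations r_coset_def)
  also have "\<dots> = (\<ominus>\<^bsub>M\<^esub> x) \<boxtimes> y \<oplus> x \<boxtimes> y"
    using assms by (simp add: M.l_neg pure_zero_left flip: pure_add_left)
  finally show ?thesis
    by (subst (asm) T.add.right_cancel) (use assms cl in \<open>simp_all add: coset_closed pure_closed del: carrier_free_Abelian_group_iff\<close>)
qed

lemma tensor_induct [consumes 1, case_names pure add]: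
  assumes "t \<in> carrier T"
    and pure: "\<And>x y. \<lbrakk>x \<in> carrier M; y \<in> carrier N\<rbrakk> \<Longrightarrow> P (x \<boxtimes> y)"
    and add: "\<And>t u. \<lbrakk>t \<in> carrier T; u \<in> carrier T; P t; P u\<rbrakk> \<Longrightarrow> P (t \<oplus> u)"
  shows "P t"
proof -
  obtain p where p: "p \<in> carrier F" "t = relations #>\<^bsub>F\<^esub> p"
    using assms(1) by (rule carrierE)
  from p(1) have "Poly_Mapping.keys p \<subseteq> carrier M \<times> carrier N"
    by simp
  \<comment> \<open>Induction on the free abelian group builds elements by differences, whereas
    \<open>P\<close> is only closed under sums; carrying \<open>- p\<close> along turns each
    difference into a sum.\<close>
  then have "p \<in> carrier F \<and> - p \<in> carrier F
      \<and> P (relations #>\<^bsub>F\<^esub> p) \<and> P (relations #>\<^bsub>F\<^esub> (- p))"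
  proof (induction p rule: free_Abelian_group_induct[consumes 1, case_names zero diff gen])
    case zero
    have "P (\<zero>\<^bsub>M\<^esub> \<boxtimes> \<zero>\<^bsub>N\<^esub>)"
      by (rule pure) auto
    moreover have "relations #>\<^bsub>F\<^esub> 0 = \<zero>"
      by (simp add: zero_relations) (simp add: r_coset_def)
    ultimately show ?case
      by (simp add: pure_zero_left)
  next
    case (diff x y)
    have "P (relations #>\<^bsub>F\<^esub> (x + - y))" "P (relations #>\<^bsub>F\<^esub> (- x + y))"
      by (subst coset_add[symmetric]; use diff in \<open>auto intro!: add coset_closed simp del: carrier_free_Abelian_group_iff\<close>)+
    moreover have "x + - y \<in> carrier F" "- x + y \<in> carrier F"
      using diff by (blast intro: frag_add_closed)+
    ultimately show ?case by simp
  next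
    case (gen a)
    then obtain x y where a: "a = (x, y)" "x \<in> carrier M" "y \<in> carrier N" by blast
    then show ?case
      using pure[of x y] pure[of "\<ominus>\<^bsub>M\<^esub> x" y] by (simp add: coset_uminus_pure flip: pure_tensor_coset)
  qed
  then show ?thesis using p by simp
qed


lemma additive_map_eqI:
  assumes "f \<in> additive_maps T G" "g \<in> additive_maps T G" "t \<in> carrier T"
    and "\<And>x y. \<lbrakk>x \<in> carrier M; y \<in> carrier N\<rbrakk> \<Longrightarrow> f (x \<boxtimes> y) = g (x \<boxtimes> y)"
  shows "f t = g t"
  using assms(3)
  by (induction t rule: tensor_induct)
    (simp_all add: assms(4) additive_map_add[OF assms(1)] additive_map_add[OF assms(2)])

text \<open>The sum in \<open>tensor_lift\<close> over the chosen representative is the value there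
  of the homomorphism \<open>h\<close> extending \<open>f\<close>. As \<open>f\<close> is biadditive
  and balanced, \<open>h\<close> kills the relators, and the choice of representative drops
  out.\<close>

lemma tensor_lift_coset:
  assumes G: "abelian_group G" and f: "balanced_map S M ra N la G f"
    and h: "h \<in> hom F (add_monoid G)"
    and hf: "\<And>x y. \<lbrakk>x \<in> carrier M; y \<in> carrier N\<rbrakk> \<Longrightarrow> h (frag_of (x, y)) = f x y"
    and p: "p \<in> carrier F"
  shows "tensor_lift G f (relations #>\<^bsub>F\<^esub> p) = h p"
proof -
  interpret G: abelian_group G by (rule G)
  interpret h: group_hom F "add_monoid G" h
    using h by (simp add: group_hom_def group_hom_axioms_def G.a_group)
  have h_add: "h (a + b) = h a \<oplus>\<^bsub>G\<^esub> h b" if "a \<in> carrier F" "b \<in> carrier F" for a b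
    using h.hom_mult[OF that] by simp
  have h_closed: "h a \<in> carrier G" if "a \<in> carrier F" for a
    using h.hom_closed[OF that] by simp
  have h_diff: "h (a - b) = h a \<ominus>\<^bsub>G\<^esub> h b" if "a \<in> carrier F" "b \<in> carrier F" for a b
    using h_add[of a "-b"] h.hom_inv[OF that(2)] that
    by (simp add: G.minus_eq a_inv_def)
  \<comment> \<open>Expanding \<open>q\<close> in generators turns \<open>h q\<close> into the sum
    that \<open>tensor_lift\<close> forms.\<close>
  have h_sum: "h q = finsum G (\<lambda>(x, y). [Poly_Mapping.lookup q (x, y)] \<cdot>\<^bsub>G\<^esub> f x y) (Poly_Mapping.keys q)"
    if "q \<in> carrier F" for q
  proof -
    have cmul: "frag_cmul n (frag_of z) \<in> carrier F
        \<and> h (frag_cmul n (frag_of z)) = [n] \<cdot>\<^bsub>G\<^esub> (case z of (x, y) \<Rightarrow> f x y)"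
      if "z \<in> carrier M \<times> carrier N" for z n
    proof -
      have z: "frag_of z \<in> carrier F"
        using that by (auto simp: keys_frag_of)
      have "frag_cmul n (frag_of z) = frag_of z [^]\<^bsub>F\<^esub> n"
        using z by simp
      moreover have "h (frag_of z [^]\<^bsub>F\<^esub> n) = [n] \<cdot>\<^bsub>G\<^esub> h (frag_of z)"
        using h.hom_int_pow[OF z, of n] by (simp add: add_pow_def)
      moreover have "frag_of z [^]\<^bsub>F\<^esub> n \<in> carrier F"
        using z by (rule group.int_pow_closed[OF group_free_Abelian_group])
      ultimately show ?thesis
        using that hf by (auto split: prod.split)
    qed
    have *: "(\<Sum>z\<in>K. frag_cmul (Poly_Mapping.lookup q z) (frag_of z)) \<in> carrier F
        \<and> h (\<Sum>z\<in>K. frag_cmul (Poly_Mapping.lookup q z) (frag_of z))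
          = finsum G (\<lambda>(x, y). [Poly_Mapping.lookup q (x, y)] \<cdot>\<^bsub>G\<^esub> f x y) K"
      if "finite K" "K \<subseteq> carrier M \<times> carrier N" for K
      using that
    proof (induction K)
      case empty
      show ?case using h.hom_one by simp
    next
      case (insert z K)
      have "finsum G (\<lambda>(x, y). [Poly_Mapping.lookup q (x, y)] \<cdot>\<^bsub>G\<^esub> f x y) (insert z K)
          = [Poly_Mapping.lookup q z] \<cdot>\<^bsub>G\<^esub> (case z of (x, y) \<Rightarrow> f x y)
            \<oplus>\<^bsub>G\<^esub> finsum G (\<lambda>(x, y). [Poly_Mapping.lookup q (x, y)] \<cdot>\<^bsub>G\<^esub> f x y) K"
        using insert.hyps insert.prems balanced_mapD(1)[OF f]
        by (subst G.finsum_insert) (auto split: prod.splits intro!: G.add.int_pow_closed)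
      then show ?case
        using insert cmul[of z "Poly_Mapping.lookup q z"]
        by (simp add: h_add frag_add_closed del: carrier_free_Abelian_group_iff)
    qed
    have "q = (\<Sum>z\<in>Poly_Mapping.keys q. frag_cmul (Poly_Mapping.lookup q z) (frag_of z))"
      using frag_expansion[of q] by (simp add: frag_extend_def)
    then show ?thesis
      using *[of "Poly_Mapping.keys q"] that by simp
  qed
  have ker: "h q = \<zero>\<^bsub>G\<^esub>" if "q \<in> relations" for q
  proof -
    have "h q' = \<zero>\<^bsub>G\<^esub>" if q': "q' \<in> relators" for q'
    proof -
      from q' consider
          (left) x x' y where "q' = frag_of (x \<oplus>\<^bsub>M\<^esub> x', y) - frag_of (x, y) - frag_of (x', y)"
            "x \<in> carrier M" "x' \<in> carrier M" "y \<in> carrier N"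
        | (right) x y y' where "q' = frag_of (x, y \<oplus>\<^bsub>N\<^esub> y') - frag_of (x, y) - frag_of (x, y')"
            "x \<in> carrier M" "y \<in> carrier N" "y' \<in> carrier N"
        | (bal) x s y where "q' = frag_of (ra x s, y) - frag_of (x, la s y)"
            "x \<in> carrier M" "s \<in> S" "y \<in> carrier N"
        unfolding tensor_relators_def by blast
      then show ?thesis
      proof cases
        case left
        then show ?thesis
          using balanced_mapD(1)[OF f]
          by (simp add: diff_diff_eq h_diff h_add hf balanced_mapD(2)[OF f] frag_add_closed
              G.minus_eq G.r_neg del: carrier_free_Abelian_group_iff)
      next
        case right
        then show ?thesis
          using balanced_mapD(1)[OF f]
          by (simp add: diff_diff_eq h_diff h_add hf balanced_mapD(3)[OF f] frag_add_closed
              G.minus_eq G.r_neg del: carrier_free_Abelian_group_iff)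
      next
        case bal
        then show ?thesis
          using balanced_mapD(1)[OF f]
          by (simp add: h_diff hf ra_closed la_closed balanced_mapD(4)[OF f] G.minus_eq G.r_neg)
      qed
    qed
    then have "relators \<subseteq> kernel F (add_monoid G) h"
      using relators_closed unfolding kernel_def by (auto simp del: carrier_free_Abelian_group_iff)
    then have "relations \<subseteq> kernel F (add_monoid G) h"
      using group.generate_subgroup_incl[OF group_free_Abelian_group] h.subgroup_kernel by blast
    then show ?thesis
      using that by (auto simp: kernel_def)
  qed
  define q where "q = (SOME q. q \<in> relations #>\<^bsub>F\<^esub> p)"
  have "\<exists>q. q \<in> relations #>\<^bsub>F\<^esub> p"
    using generate.one[of F relators] by (auto simp: r_coset_def)
  then have "q \<in> relations #>\<^bsub>F\<^esub> p"
    unfolding q_def by (rule someI_ex)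
  \<comment> \<open>The representative picked by the choice operator differs from \<open>p\<close>
    by a relation \<open>c\<close>, on which \<open>h\<close> vanishes.\<close>
  then obtain c where c: "c \<in> relations" "q = c + p"
    by (auto simp: r_coset_def)
  have cF: "c \<in> carrier F"
    using c(1) normal_imp_subgroup[OF relations_normal] by (meson subgroup.mem_carrier)
  have "tensor_lift G f (relations #>\<^bsub>F\<^esub> p) = h q"
    unfolding tensor_lift_def Let_def
    by (subst h_sum) (use cF p in \<open>simp_all add: c(2) frag_add_closed flip: q_def del: carrier_free_Abelian_group_iff\<close>)
  also have "\<dots> = h p"
    using cF p by (simp add: c(2) h_add ker[OF c(1)] h_closed del: carrier_free_Abelian_group_iff)
  finally show ?thesis .
qed

lemma
  assumes G: "abelian_group G" and f: "balanced_map S M ra N la G f"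
  shows tensor_lift_additive: "tensor_lift G f \<in> additive_maps T G"
    and tensor_lift_pure: "\<lbrakk>x \<in> carrier M; y \<in> carrier N\<rbrakk> \<Longrightarrow> tensor_lift G f (x \<boxtimes> y) = f x y"
proof -
  interpret G: abelian_group G by (rule G)
  have "(\<lambda>(x, y). f x y) ` (carrier M \<times> carrier N) \<subseteq> carrier (add_monoid G)"
    using balanced_mapD(1)[OF f] by auto
  then obtain h where h: "h \<in> hom F (add_monoid G)"
    and hf': "\<And>z. z \<in> carrier M \<times> carrier N \<Longrightarrow> h (frag_of z) = (\<lambda>(x, y). f x y) z"
    using comm_group.free_Abelian_group_universal[OF G.a_comm_group] by metis
  have hf: "h (frag_of (x, y)) = f x y" if "x \<in> carrier M" "y \<in> carrier N" for x y
    using hf'[of "(x, y)"] that by simp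
  note eq = tensor_lift_coset[OF G f h hf]
  show "tensor_lift G f \<in> additive_maps T G"
  proof (rule additive_mapI)
    fix t u assume "t \<in> carrier T" "u \<in> carrier T"
    then obtain p q where "p \<in> carrier F" "t = relations #>\<^bsub>F\<^esub> p" "q \<in> carrier F" "u = relations #>\<^bsub>F\<^esub> q"
      by (metis carrierE)
    then show "tensor_lift G f (t \<oplus> u) = tensor_lift G f t \<oplus>\<^bsub>G\<^esub> tensor_lift G f u"
      using h by (simp add: coset_add eq frag_add_closed hom_def del: carrier_free_Abelian_group_iff)
  next
    fix t assume "t \<in> carrier T"
    then obtain p where "p \<in> carrier F" "t = relations #>\<^bsub>F\<^esub> p"
      by (rule carrierE)
    then show "tensor_lift G f t \<in> carrier G"
      using hom_in_carrier[OF h] by (simp add: eq del: carrier_free_Abelian_group_iff)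
  qed
  show "tensor_lift G f (x \<boxtimes> y) = f x y" if "x \<in> carrier M" "y \<in> carrier N"
    unfolding pure_tensor_coset using that by (subst eq) (auto simp: hf)
qed

lemma balanced_map_cong:
  assumes "balanced_map S M ra N la G f"
    and "\<And>x y. \<lbrakk>x \<in> carrier M; y \<in> carrier N\<rbrakk> \<Longrightarrow> f x y = g x y"
  shows "balanced_map S M ra N la G g"
  using balanced_mapD[OF assms(1)]
  by (intro balanced_mapI) (simp_all add: ra_closed la_closed flip: assms(2))

lemma tensor_lift_closed:
  "\<lbrakk>abelian_group G; balanced_map S M ra N la G f; t \<in> carrier T\<rbrakk> \<Longrightarrow> tensor_lift G f t \<in> carrier G"
  by (rule additive_map_closed[OF tensor_lift_additive])

lemma tensor_lift_add:
  "\<lbrakk>abelian_group G; balanced_map S M ra N la G f; t \<in> carrier T; u \<in> carrier T\<rbrakk>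
    \<Longrightarrow> tensor_lift G f (t \<oplus> u) = tensor_lift G f t \<oplus>\<^bsub>G\<^esub> tensor_lift G f u"
  by (rule additive_map_add[OF tensor_lift_additive])

lemma tensor_lift_unique:
  assumes "abelian_group G" "balanced_map S M ra N la G f" "\<phi> \<in> additive_maps T G" "t \<in> carrier T"
    and "\<And>x y. \<lbrakk>x \<in> carrier M; y \<in> carrier N\<rbrakk> \<Longrightarrow> \<phi> (x \<boxtimes> y) = f x y"
  shows "\<phi> t = tensor_lift G f t"
  by (rule additive_map_eqI[OF assms(3) tensor_lift_additive[OF assms(1,2)] assms(4)])
    (simp add: assms tensor_lift_pure)

lemma tensor_lift_cong:
  assumes "abelian_group G" "balanced_map S M ra N la G f" "t \<in> carrier T"
    and "\<And>x y. \<lbrakk>x \<in> carrier M; y \<in> carrier N\<rbrakk> \<Longrightarrow> f x y = g x y"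
  shows "tensor_lift G f t = tensor_lift G g t"
  using balanced_map_cong[OF assms(2,4)] assms
  by (intro tensor_lift_unique tensor_lift_additive) (simp_all add: tensor_lift_pure)

lemma additive_map_tensor_lift:
  assumes G: "abelian_group G" "abelian_group H" and f: "balanced_map S M ra N la G f"
    and \<phi>: "\<phi> \<in> additive_maps G H" and t: "t \<in> carrier T"
  shows "\<phi> (tensor_lift G f t) = tensor_lift H (\<lambda>x y. \<phi> (f x y)) t"
proof (rule tensor_lift_unique[OF G(2) _ _ t])
  show "balanced_map S M ra N la H (\<lambda>x y. \<phi> (f x y))"
    using balanced_mapD[OF f]
    by (intro balanced_mapI) (simp_all add: additive_map_closed[OF \<phi>] additive_map_add[OF \<phi>])
  show "(\<lambda>t. \<phi> (tensor_lift G f t)) \<in> additive_maps T H"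
    by (rule additive_map_comp[OF tensor_lift_additive[OF G(1) f] \<phi>])
qed (simp add: tensor_lift_pure[OF G(1) f])

lemma tensor_lift_fun_add:
  assumes G: "abelian_group G" and f: "balanced_map S M ra N la G f" and g: "balanced_map S M ra N la G g"
    and h: "balanced_map S M ra N la G h"
    and "\<And>x y. \<lbrakk>x \<in> carrier M; y \<in> carrier N\<rbrakk> \<Longrightarrow> h x y = f x y \<oplus>\<^bsub>G\<^esub> g x y"
    and t: "t \<in> carrier T"
  shows "tensor_lift G h t = tensor_lift G f t \<oplus>\<^bsub>G\<^esub> tensor_lift G g t"
proof -
  interpret G: abelian_group G by (rule G)
  show ?thesis
    using t
    by (induction t rule: tensor_induct)
      (simp_all add: tensor_lift_pure[OF G] tensor_lift_add[OF G] tensor_lift_closed[OF G] f g h assms(5) G.a_ac)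
qed

text \<open>For maps of three variables in which a lift over \<open>T\<close> depends on a parameter
  \<open>z\<close>. Both sides of the balancing condition are additive in the element of
  \<open>T\<close>, so the premise \<open>bal\<close> asks for it on pure tensors only.\<close>

lemma balanced_lift_right:
  assumes G: "abelian_group G" and P: "abelian_group P"
    and f: "\<And>z. z \<in> carrier P \<Longrightarrow> balanced_map S M ra N la G (f z)"
    and f_add: "\<And>z z' x y. \<lbrakk>z \<in> carrier P; z' \<in> carrier P; x \<in> carrier M; y \<in> carrier N\<rbrakk>
      \<Longrightarrow> f (z \<oplus>\<^bsub>P\<^esub> z') x y = f z x y \<oplus>\<^bsub>G\<^esub> f z' x y"
    and raP: "\<And>z s. \<lbrakk>z \<in> carrier P; s \<in> S'\<rbrakk> \<Longrightarrow> raP z s \<in> carrier P"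
    and laT: "\<And>s. s \<in> S' \<Longrightarrow> laT s \<in> additive_maps T T"
    and bal: "\<And>z s x y. \<lbrakk>z \<in> carrier P; s \<in> S'; x \<in> carrier M; y \<in> carrier N\<rbrakk>
      \<Longrightarrow> f (raP z s) x y = tensor_lift G (f z) (laT s (x \<boxtimes> y))"
  shows "balanced_map S' P raP T laT G (\<lambda>z t. tensor_lift G (f z) t)"
proof (rule balanced_mapI)
  interpret P: abelian_group P by (rule P)
  fix z z' t assume "z \<in> carrier P" "z' \<in> carrier P" "t \<in> carrier T"
  then show "tensor_lift G (f (z \<oplus>\<^bsub>P\<^esub> z')) t = tensor_lift G (f z) t \<oplus>\<^bsub>G\<^esub> tensor_lift G (f z') t"
    by (intro tensor_lift_fun_add[OF G]) (simp_all add: f f_add)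
next
  fix z s t assume *: "z \<in> carrier P" "s \<in> S'" "t \<in> carrier T"
  note lift = tensor_lift_additive[OF G f[OF raP[OF *(1,2)]]]
    additive_map_comp[OF laT[OF *(2)] tensor_lift_additive[OF G f[OF *(1)]]]
  show "tensor_lift G (f (raP z s)) t = tensor_lift G (f z) (laT s t)"
    by (rule additive_map_eqI[OF lift *(3)])
      (simp add: tensor_lift_pure[OF G f[OF raP[OF *(1,2)]]] bal *(1,2))
qed (simp_all add: f tensor_lift_closed[OF G] tensor_lift_add[OF G])

text \<open>Obtained from \<open>balanced_lift_right\<close> by exchanging the two arguments, left
  and right actions trading places.\<close>

lemma balanced_lift_left:
  assumes G: "abelian_group G" and P: "abelian_group P"
    and f: "\<And>z. z \<in> carrier P \<Longrightarrow> balanced_map S M ra N la G (f z)"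
    and f_add: "\<And>z z' x y. \<lbrakk>z \<in> carrier P; z' \<in> carrier P; x \<in> carrier M; y \<in> carrier N\<rbrakk>
      \<Longrightarrow> f (z \<oplus>\<^bsub>P\<^esub> z') x y = f z x y \<oplus>\<^bsub>G\<^esub> f z' x y"
    and laP: "\<And>z s. \<lbrakk>z \<in> carrier P; s \<in> S'\<rbrakk> \<Longrightarrow> laP s z \<in> carrier P"
    and raT: "\<And>s. s \<in> S' \<Longrightarrow> (\<lambda>t. raT t s) \<in> additive_maps T T"
    and bal: "\<And>z s x y. \<lbrakk>z \<in> carrier P; s \<in> S'; x \<in> carrier M; y \<in> carrier N\<rbrakk>
      \<Longrightarrow> f (laP s z) x y = tensor_lift G (f z) (raT (x \<boxtimes> y) s)"
  shows "balanced_map S' T raT P laP G (\<lambda>t z. tensor_lift G (f z) t)"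
proof -
  have "balanced_map S' P (\<lambda>z s. laP s z) T (\<lambda>s t. raT t s) G (\<lambda>z t. tensor_lift G (f z) t)"
    by (rule balanced_lift_right[where raP = "\<lambda>z s. laP s z" and laT = "\<lambda>s t. raT t s", OF G P f f_add laP raT bal])
  then show ?thesis
    by (simp add: balanced_map_def)
qed

lemma
  assumes T': "tensor_product S M' ra' N' la' T'"
    and f: "f \<in> additive_maps M M'" "\<And>x s. \<lbrakk>x \<in> carrier M; s \<in> S\<rbrakk> \<Longrightarrow> f (ra x s) = ra' (f x) s"
    and g: "g \<in> additive_maps N N'" "\<And>y s. \<lbrakk>y \<in> carrier N; s \<in> S\<rbrakk> \<Longrightarrow> g (la s y) = la' s (g y)"
  shows tensor_map_additive: "tensor_map T' f g \<in> additive_maps T T'"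
    and tensor_map_pure: "\<lbrakk>x \<in> carrier M; y \<in> carrier N\<rbrakk> \<Longrightarrow> tensor_map T' f g (x \<boxtimes> y) = f x \<boxtimes>\<^bsub>T'\<^esub> g y"
proof -
  interpret T': tensor_product S M' ra' N' la' T' by (rule T')
  have "balanced_map S M ra N la T' (\<lambda>x y. f x \<boxtimes>\<^bsub>T'\<^esub> g y)"
    by (rule balanced_mapI)
      (simp_all add: f(2) g(2) additive_map_closed[OF f(1)] additive_map_closed[OF g(1)]
        additive_map_add[OF f(1)] additive_map_add[OF g(1)]
        T'.pure_closed T'.pure_add_left T'.pure_add_right T'.pure_balanced)
  then show "tensor_map T' f g \<in> additive_maps T T'"
    and "\<lbrakk>x \<in> carrier M; y \<in> carrier N\<rbrakk> \<Longrightarrow> tensor_map T' f g (x \<boxtimes> y) = f x \<boxtimes>\<^bsub>T'\<^esub> g y"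
    unfolding tensor_map_def
    by (simp_all add: tensor_lift_additive tensor_lift_pure T'.abelian_group_T)
qed

end

section \<open>Associativity and lifts in three variables\<close>

lemma
  assumes MN: "tensor_product S M ra N la MN" and L: "tensor_product S' MN raMN P laP L"
    and NP: "tensor_product S' N raN P laP NP" and R: "tensor_product S M ra NP laNP R"
    and raMN: "\<And>s. s \<in> S' \<Longrightarrow> (\<lambda>t. raMN t s) \<in> additive_maps MN MN"
      "\<And>x y s. \<lbrakk>x \<in> carrier M; y \<in> carrier N; s \<in> S'\<rbrakk> \<Longrightarrow> raMN (x \<boxtimes>\<^bsub>MN\<^esub> y) s = x \<boxtimes>\<^bsub>MN\<^esub> raN y s"
    and laNP: "\<And>y z s. \<lbrakk>y \<in> carrier N; z \<in> carrier P; s \<in> S\<rbrakk> \<Longrightarrow> laNP s (y \<boxtimes>\<^bsub>NP\<^esub> z) = la s y \<boxtimes>\<^bsub>NP\<^esub> z"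
  shows tensor_assoc_additive: "tensor_assoc R NP \<in> additive_maps L R"
    and tensor_assoc_pure: "\<lbrakk>x \<in> carrier M; y \<in> carrier N; z \<in> carrier P\<rbrakk>
      \<Longrightarrow> tensor_assoc R NP ((x \<boxtimes>\<^bsub>MN\<^esub> y) \<boxtimes>\<^bsub>L\<^esub> z) = x \<boxtimes>\<^bsub>R\<^esub> (y \<boxtimes>\<^bsub>NP\<^esub> z)"
proof -
  interpret MN: tensor_product S M ra N la MN by (rule MN)
  interpret L: tensor_product S' MN raMN P laP L by (rule L)
  interpret NP: tensor_product S' N raN P laP NP by (rule NP)
  interpret R: tensor_product S M ra NP laNP R by (rule R)
  have F: "balanced_map S M ra N la R (\<lambda>x y. x \<boxtimes>\<^bsub>R\<^esub> (y \<boxtimes>\<^bsub>NP\<^esub> z))" if "z \<in> carrier P" for z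
    using that
    by (intro balanced_mapI)
      (simp_all add: R.pure_closed NP.pure_closed R.pure_add_left NP.pure_add_left R.pure_add_right
        R.pure_balanced laNP)
  have bal: "balanced_map S' MN raMN P laP R (\<lambda>u z. tensor_lift R (\<lambda>x y. x \<boxtimes>\<^bsub>R\<^esub> (y \<boxtimes>\<^bsub>NP\<^esub> z)) u)"
    by (rule MN.balanced_lift_left)
      (simp_all add: R.abelian_group_T tensor_product.axioms(2)[OF NP] F raMN NP.la_closed NP.ra_closed
        MN.tensor_lift_pure NP.pure_add_right NP.pure_closed R.pure_add_right NP.pure_balanced)
  show "tensor_assoc R NP \<in> additive_maps L R"
    unfolding tensor_assoc_def by (rule L.tensor_lift_additive[OF R.abelian_group_T bal])
  show "\<lbrakk>x \<in> carrier M; y \<in> carrier N; z \<in> carrier P\<rbrakk>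
      \<Longrightarrow> tensor_assoc R NP ((x \<boxtimes>\<^bsub>MN\<^esub> y) \<boxtimes>\<^bsub>L\<^esub> z) = x \<boxtimes>\<^bsub>R\<^esub> (y \<boxtimes>\<^bsub>NP\<^esub> z)"
    unfolding tensor_assoc_def
    by (simp add: L.tensor_lift_pure[OF R.abelian_group_T bal] MN.pure_closed
        MN.tensor_lift_pure[OF R.abelian_group_T F])
qed

lemma rmod_tensor_product:
  assumes "abelian_group M" "abelian_group N"
    and "\<And>x s. \<lbrakk>x \<in> carrier M; s \<in> S\<rbrakk> \<Longrightarrow> x \<triangleleft>\<^bsub>M\<^esub> s \<in> carrier M"
    and "\<And>y s. \<lbrakk>y \<in> carrier N; s \<in> S\<rbrakk> \<Longrightarrow> s \<triangleright>\<^bsub>N\<^esub> y \<in> carrier N"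
  shows "tensor_product S M (ract M) N (lact N) (rmod_tensor S M N)"
  using assms
  by (simp add: tensor_product_def tensor_product_axioms_def rmod_tensor_def Let_def)

lemma bimod_tensor_product:
  assumes "abelian_group M" "abelian_group N"
    and "\<And>x s. \<lbrakk>x \<in> carrier M; s \<in> S\<rbrakk> \<Longrightarrow> x \<triangleleft>\<^bsub>M\<^esub> s \<in> carrier M"
    and "\<And>y s. \<lbrakk>y \<in> carrier N; s \<in> S\<rbrakk> \<Longrightarrow> s \<triangleright>\<^bsub>N\<^esub> y \<in> carrier N"
  shows "tensor_product S M (ract M) N (lact N) (bimod_tensor S M N)"
  using assms
  by (simp add: tensor_product_def tensor_product_axioms_def bimod_tensor_def rmod_tensor_def Let_def)

lemma kmod_tensor_product:
  assumes "module k M" "module k N"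
  shows "tensor_product (carrier k) M (\<lambda>x c. c \<odot>\<^bsub>M\<^esub> x) N (\<lambda>c y. c \<odot>\<^bsub>N\<^esub> y) (kmod_tensor k M N)"
  using assms
  by (simp add: tensor_product_def tensor_product_axioms_def kmod_tensor_def Let_def
      module.smult_closed module.axioms(2))

text \<open>The integrands of Sweedler expressions with three legs. The scalars at the two tensor
  signs may differ, and the middle factor carries a left action for the first sign and a right
  action for the second.\<close>

definition balanced_map3 ::
  "'r set \<Rightarrow> ('m, 'x) ring_scheme \<Rightarrow> ('m \<Rightarrow> 'r \<Rightarrow> 'm) \<Rightarrow> ('r \<Rightarrow> 'n \<Rightarrow> 'n) \<Rightarrow> ('n, 'y) ring_scheme
    \<Rightarrow> 'q set \<Rightarrow> ('n \<Rightarrow> 'q \<Rightarrow> 'n) \<Rightarrow> ('p, 'v) ring_scheme \<Rightarrow> ('q \<Rightarrow> 'p \<Rightarrow> 'p)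
    \<Rightarrow> ('g, 'z) ring_scheme \<Rightarrow> ('m \<Rightarrow> 'n \<Rightarrow> 'p \<Rightarrow> 'g) \<Rightarrow> bool" where
  "balanced_map3 S M ra la N S' ra' P la' G f \<longleftrightarrow>
     (\<forall>z \<in> carrier P. balanced_map S M ra N la G (\<lambda>x y. f x y z)) \<and>
     (\<forall>x \<in> carrier M. balanced_map S' N ra' P la' G (f x))"

lemma balanced_map3I:
  assumes "\<And>x y z. \<lbrakk>x \<in> carrier M; y \<in> carrier N; z \<in> carrier P\<rbrakk> \<Longrightarrow> f x y z \<in> carrier G"
    and "\<And>x x' y z. \<lbrakk>x \<in> carrier M; x' \<in> carrier M; y \<in> carrier N; z \<in> carrier P\<rbrakk>
      \<Longrightarrow> f (x \<oplus>\<^bsub>M\<^esub> x') y z = f x y z \<oplus>\<^bsub>G\<^esub> f x' y z"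
    and "\<And>x y y' z. \<lbrakk>x \<in> carrier M; y \<in> carrier N; y' \<in> carrier N; z \<in> carrier P\<rbrakk>
      \<Longrightarrow> f x (y \<oplus>\<^bsub>N\<^esub> y') z = f x y z \<oplus>\<^bsub>G\<^esub> f x y' z"
    and "\<And>x y z z'. \<lbrakk>x \<in> carrier M; y \<in> carrier N; z \<in> carrier P; z' \<in> carrier P\<rbrakk>
      \<Longrightarrow> f x y (z \<oplus>\<^bsub>P\<^esub> z') = f x y z \<oplus>\<^bsub>G\<^esub> f x y z'"
    and "\<And>x s y z. \<lbrakk>x \<in> carrier M; s \<in> S; y \<in> carrier N; z \<in> carrier P\<rbrakk> \<Longrightarrow> f (ra x s) y z = f x (la s y) z"
    and "\<And>x y s z. \<lbrakk>x \<in> carrier M; y \<in> carrier N; s \<in> S'; z \<in> carrier P\<rbrakk> \<Longrightarrow> f x (ra' y s) z = f x y (la' s z)"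
  shows "balanced_map3 S M ra la N S' ra' P la' G f"
  unfolding balanced_map3_def using assms by (auto intro!: balanced_mapI)

text \<open>The value of \<open>f\<close> on a triple tensor does not depend on the bracketing,
  since on \<open>(x \<otimes> y) \<otimes> z\<close> both sides are \<open>f x y z\<close>.
  Coassociativity of coactions and of \<open>\<Delta>\<close> enters the later computations in this
  form.\<close>

lemma
  assumes MN: "tensor_product S M ra N la MN" and L: "tensor_product S' MN raMN P laP L"
    and NP: "tensor_product S' N raN P laP NP" and R: "tensor_product S M ra NP laNP R"
    and raMN: "\<And>s. s \<in> S' \<Longrightarrow> (\<lambda>t. raMN t s) \<in> additive_maps MN MN"
      "\<And>x y s. \<lbrakk>x \<in> carrier M; y \<in> carrier N; s \<in> S'\<rbrakk> \<Longrightarrow> raMN (x \<boxtimes>\<^bsub>MN\<^esub> y) s = x \<boxtimes>\<^bsub>MN\<^esub> raN y s"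
    and laNP: "\<And>s. s \<in> S \<Longrightarrow> laNP s \<in> additive_maps NP NP"
      "\<And>y z s. \<lbrakk>y \<in> carrier N; z \<in> carrier P; s \<in> S\<rbrakk> \<Longrightarrow> laNP s (y \<boxtimes>\<^bsub>NP\<^esub> z) = la s y \<boxtimes>\<^bsub>NP\<^esub> z"
    and G: "abelian_group G" and f: "balanced_map3 S M ra la N S' raN P laP G f"
  shows balanced_map3_left: "balanced_map S' MN raMN P laP G (\<lambda>u z. tensor_lift G (\<lambda>x y. f x y z) u)"
    and balanced_map3_right: "balanced_map S M ra NP laNP G (\<lambda>x w. tensor_lift G (f x) w)"
    and tensor_lift_assoc: "t \<in> carrier L \<Longrightarrow>
      tensor_lift G (\<lambda>x w. tensor_lift G (f x) w) (tensor_assoc R NP t)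
      = tensor_lift G (\<lambda>u z. tensor_lift G (\<lambda>x y. f x y z) u) t"
proof -
  interpret MN: tensor_product S M ra N la MN by (rule MN)
  interpret L: tensor_product S' MN raMN P laP L by (rule L)
  interpret NP: tensor_product S' N raN P laP NP by (rule NP)
  interpret R: tensor_product S M ra NP laNP R by (rule R)
  have f1: "balanced_map S M ra N la G (\<lambda>x y. f x y z)" if "z \<in> carrier P" for z
    using f that by (simp add: balanced_map3_def)
  have f2: "balanced_map S' N raN P laP G (f x)" if "x \<in> carrier M" for x
    using f that by (simp add: balanced_map3_def)
  show 1: "balanced_map S' MN raMN P laP G (\<lambda>u z. tensor_lift G (\<lambda>x y. f x y z) u)"
    by (rule MN.balanced_lift_left)
      (use balanced_mapD[OF f2] in \<open>simp_all add: G tensor_product.axioms(2)[OF NP] f1 raMN NP.la_closed NP.ra_closed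
        MN.tensor_lift_pure\<close>)
  show 2: "balanced_map S M ra NP laNP G (\<lambda>x w. tensor_lift G (f x) w)"
    by (rule NP.balanced_lift_right)
      (use balanced_mapD[OF f1] in \<open>simp_all add: G tensor_product.axioms(1)[OF MN] f2 laNP MN.la_closed MN.ra_closed
        NP.tensor_lift_pure\<close>)
  note as = tensor_assoc_additive[OF MN L NP R raMN laNP(2)] tensor_assoc_pure[OF MN L NP R raMN laNP(2)]
  \<comment> \<open>A pure tensor of \<open>L\<close> has an arbitrary, not necessarily pure,
    element of \<open>MN\<close> as first factor, hence a second induction over that factor.\<close>
  have inner: "tensor_lift G (\<lambda>x w. tensor_lift G (f x) w) (tensor_assoc R NP (u \<boxtimes>\<^bsub>L\<^esub> z))
      = tensor_lift G (\<lambda>x y. f x y z) u" if "u \<in> carrier MN" "z \<in> carrier P" for u z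
    using that(1)
  proof (induction u rule: MN.tensor_induct)
    case (pure x y)
    then show ?case
      using that(2)
      by (simp add: as(2) R.tensor_lift_pure[OF G 2] NP.pure_closed
          NP.tensor_lift_pure[OF G f2] MN.tensor_lift_pure[OF G f1])
  next
    case (add t u)
    then show ?case
      using that(2)
      by (simp add: L.pure_add_left additive_map_add[OF as(1)] L.pure_closed additive_map_closed[OF as(1)]
          R.tensor_lift_add[OF G 2] MN.tensor_lift_add[OF G f1])
  qed
  show "tensor_lift G (\<lambda>x w. tensor_lift G (f x) w) (tensor_assoc R NP t)
      = tensor_lift G (\<lambda>u z. tensor_lift G (\<lambda>x y. f x y z) u) t" if "t \<in> carrier L"
    by (rule L.tensor_lift_unique[OF G 1 additive_map_comp[OF as(1) R.tensor_lift_additive[OF G 2]] that])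
      (simp_all add: inner)
qed

context tensor_product
begin

lemma balanced_map_comp:
  assumes T': "tensor_product S M' ra' N' la' T'"
    and f: "f \<in> additive_maps M M'" "\<And>x s. \<lbrakk>x \<in> carrier M; s \<in> S\<rbrakk> \<Longrightarrow> f (ra x s) = ra' (f x) s"
    and g: "g \<in> additive_maps N N'" "\<And>y s. \<lbrakk>y \<in> carrier N; s \<in> S\<rbrakk> \<Longrightarrow> g (la s y) = la' s (g y)"
    and h: "balanced_map S M' ra' N' la' G h"
  shows "balanced_map S M ra N la G (\<lambda>x y. h (f x) (g y))"
  using balanced_mapD[OF h]
  by (intro balanced_mapI)
    (simp_all add: f(2) g(2) additive_map_closed[OF f(1)] additive_map_closed[OF g(1)]
      additive_map_add[OF f(1)] additive_map_add[OF g(1)])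

lemma tensor_lift_tensor_map:
  assumes T': "tensor_product S M' ra' N' la' T'"
    and f: "f \<in> additive_maps M M'" "\<And>x s. \<lbrakk>x \<in> carrier M; s \<in> S\<rbrakk> \<Longrightarrow> f (ra x s) = ra' (f x) s"
    and g: "g \<in> additive_maps N N'" "\<And>y s. \<lbrakk>y \<in> carrier N; s \<in> S\<rbrakk> \<Longrightarrow> g (la s y) = la' s (g y)"
    and G: "abelian_group G" and h: "balanced_map S M' ra' N' la' G h" and t: "t \<in> carrier T"
  shows "tensor_lift G h (tensor_map T' f g t) = tensor_lift G (\<lambda>x y. h (f x) (g y)) t"
proof (rule tensor_lift_unique[OF G _ _ t])
  interpret T': tensor_product S M' ra' N' la' T' by (rule T')
  note closed = additive_map_closed[OF f(1)] additive_map_closed[OF g(1)]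
  show "balanced_map S M ra N la G (\<lambda>x y. h (f x) (g y))"
    by (rule balanced_map_comp[OF T' f g h])
  show "(\<lambda>t. tensor_lift G h (tensor_map T' f g t)) \<in> additive_maps T G"
    by (rule additive_map_comp[OF tensor_map_additive[OF T' f g] T'.tensor_lift_additive[OF G h]])
  show "\<And>x y. \<lbrakk>x \<in> carrier M; y \<in> carrier N\<rbrakk>
      \<Longrightarrow> tensor_lift G h (tensor_map T' f g (x \<boxtimes>\<^bsub>T\<^esub> y)) = h (f x) (g y)"
    by (simp add: tensor_map_pure[OF T' f g] T'.tensor_lift_pure[OF G h] closed)
qed

end

section \<open>Module structures on tensor products\<close>

context right_module
begin

lemma additive_ract: "a \<in> carrier R \<Longrightarrow> (\<lambda>x. x \<triangleleft>\<^bsub>M\<^esub> a) \<in> additive_maps M M"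
  by (rule additive_mapI) (simp_all add: ract_closed ract_add_left)

end

context bimodule
begin

lemma additive_lact: "a \<in> carrier R \<Longrightarrow> (\<lambda>x. a \<triangleright>\<^bsub>M\<^esub> x) \<in> additive_maps M M"
  by (rule additive_mapI) (simp_all add: lact_closed lact_add_right)

end

lemma bimodule_regular: "ring A \<Longrightarrow> bimodule A (regular_bimod A)"
proof -
  assume "ring A"
  then interpret ring A .
  have "abelian_group (regular_bimod A)"
    by (rule abelian_groupI) (auto simp: regular_bimod_def a_ac intro: add.l_inv_ex)
  then show ?thesis
    by (simp add: bimodule_def right_module_def bimodule_axioms_def right_module_axioms_def
        ring_axioms regular_bimod_def l_distr r_distr m_assoc)
qed

lemma
  assumes T: "tensor_product S M (ract M) N (lact N) (rmod_tensor S M N)"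
    and N: "bimodule R N" and S: "S \<subseteq> carrier R" and a: "a \<in> carrier R"
  shows rmod_tensor_ract_additive: "(\<lambda>t. t \<triangleleft>\<^bsub>rmod_tensor S M N\<^esub> a) \<in> additive_maps (rmod_tensor S M N) (rmod_tensor S M N)"
    and rmod_tensor_ract_pure: "\<lbrakk>x \<in> carrier M; y \<in> carrier N\<rbrakk>
      \<Longrightarrow> (x \<boxtimes>\<^bsub>rmod_tensor S M N\<^esub> y) \<triangleleft>\<^bsub>rmod_tensor S M N\<^esub> a = x \<boxtimes>\<^bsub>rmod_tensor S M N\<^esub> (y \<triangleleft>\<^bsub>N\<^esub> a)"
proof -
  interpret T: tensor_product S M "ract M" N "lact N" "rmod_tensor S M N" by (rule T)
  interpret N: bimodule R N by (rule N)
  \<comment> \<open>The action is defined by a \<open>tensor_map\<close> into the bare group, not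
    into the module record. The two share zero and addition, hence also pure tensors, and the result
    is carried over at the end.\<close>
  define U where "U = tensor S M (ract M) N (lact N)"
  have U: "tensor_product S M (ract M) N (lact N) U"
    unfolding U_def
    by unfold_locales (rule T.ra_closed T.la_closed refl; assumption)+
  have act: "(\<lambda>t. t \<triangleleft>\<^bsub>rmod_tensor S M N\<^esub> a) = tensor_map U id (\<lambda>y. y \<triangleleft>\<^bsub>N\<^esub> a)"
    by (simp add: rmod_tensor_def U_def Let_def)
  have pure: "x \<boxtimes>\<^bsub>rmod_tensor S M N\<^esub> y = x \<boxtimes>\<^bsub>U\<^esub> y" for x y
    by (simp add: rmod_tensor_def U_def Let_def pure_tensor_def)
  have lin: "(s \<triangleright>\<^bsub>N\<^esub> y) \<triangleleft>\<^bsub>N\<^esub> a = s \<triangleright>\<^bsub>N\<^esub> (y \<triangleleft>\<^bsub>N\<^esub> a)" if "y \<in> carrier N" "s \<in> S" for y s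
    using that S a N.lact_ract by blast
  have "tensor_map U id (\<lambda>y. y \<triangleleft>\<^bsub>N\<^esub> a) \<in> additive_maps (rmod_tensor S M N) U"
    by (rule T.tensor_map_additive[OF U additive_map_id _ N.additive_ract[OF a] lin]) auto
  then show "(\<lambda>t. t \<triangleleft>\<^bsub>rmod_tensor S M N\<^esub> a) \<in> additive_maps (rmod_tensor S M N) (rmod_tensor S M N)"
    unfolding act by (simp add: hom_def rmod_tensor_def U_def Let_def)
  show "\<lbrakk>x \<in> carrier M; y \<in> carrier N\<rbrakk>
      \<Longrightarrow> (x \<boxtimes>\<^bsub>rmod_tensor S M N\<^esub> y) \<triangleleft>\<^bsub>rmod_tensor S M N\<^esub> a = x \<boxtimes>\<^bsub>rmod_tensor S M N\<^esub> (y \<triangleleft>\<^bsub>N\<^esub> a)"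
    using T.tensor_map_pure[OF U additive_map_id _ N.additive_ract[OF a] lin, of x y]
    by (simp add: fun_cong[OF act] pure)
qed

lemma rmod_tensor_right_module:
  assumes T: "tensor_product S M (ract M) N (lact N) (rmod_tensor S M N)"
    and N: "bimodule R N" and S: "S \<subseteq> carrier R"
  shows "right_module R (rmod_tensor S M N)"
proof -
  interpret T: tensor_product S M "ract M" N "lact N" "rmod_tensor S M N" by (rule T)
  interpret N: bimodule R N by (rule N)
  note additive = rmod_tensor_ract_additive[OF T N S]
  note pure = rmod_tensor_ract_pure[OF T N S]
  note simps = pure additive_map_add[OF additive] additive_map_closed[OF additive] T.pure_closed N.ract_closed
  have cl: "t \<triangleleft>\<^bsub>rmod_tensor S M N\<^esub> a \<in> carrier (rmod_tensor S M N)"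
    if "t \<in> carrier (rmod_tensor S M N)" "a \<in> carrier R" for t a
    using that by (simp add: additive_map_closed[OF additive])
  show ?thesis
  proof (intro right_module.intro right_module_axioms.intro)
    fix t a b assume "t \<in> carrier (rmod_tensor S M N)" "a \<in> carrier R" "b \<in> carrier R"
    then show "t \<triangleleft>\<^bsub>rmod_tensor S M N\<^esub> (a \<oplus>\<^bsub>R\<^esub> b)
        = t \<triangleleft>\<^bsub>rmod_tensor S M N\<^esub> a \<oplus>\<^bsub>rmod_tensor S M N\<^esub> t \<triangleleft>\<^bsub>rmod_tensor S M N\<^esub> b"
      by (induction t rule: T.tensor_induct)
        (simp_all add: simps N.ract_add_right T.pure_add_right T.T.a_ac)
  next
    fix t a b assume "t \<in> carrier (rmod_tensor S M N)" "a \<in> carrier R" "b \<in> carrier R"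
    then show "t \<triangleleft>\<^bsub>rmod_tensor S M N\<^esub> (a \<otimes>\<^bsub>R\<^esub> b) = (t \<triangleleft>\<^bsub>rmod_tensor S M N\<^esub> a) \<triangleleft>\<^bsub>rmod_tensor S M N\<^esub> b"
      by (induction t rule: T.tensor_induct) (simp_all add: simps N.ract_mult)
  next
    fix t assume "t \<in> carrier (rmod_tensor S M N)"
    then show "t \<triangleleft>\<^bsub>rmod_tensor S M N\<^esub> \<one>\<^bsub>R\<^esub> = t"
      by (induction t rule: T.tensor_induct) (simp_all add: simps N.ract_one)
  qed (simp_all add: simps N.R.ring_axioms T.abelian_group_T)
qed

lemma bimod_tensor_record:
  "carrier (bimod_tensor S M N) = carrier (rmod_tensor S M N)"
  "\<zero>\<^bsub>bimod_tensor S M N\<^esub> = \<zero>\<^bsub>rmod_tensor S M N\<^esub>"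
  "add (bimod_tensor S M N) = add (rmod_tensor S M N)"
  "ract (bimod_tensor S M N) = ract (rmod_tensor S M N)"
  by (simp_all add: bimod_tensor_def Let_def)

lemma
  assumes T: "tensor_product S M (ract M) N (lact N) (bimod_tensor S M N)"
    and M: "bimodule R M" and S: "S \<subseteq> carrier R" and a: "a \<in> carrier R"
  shows bimod_tensor_lact_additive:
      "(\<lambda>t. a \<triangleright>\<^bsub>bimod_tensor S M N\<^esub> t) \<in> additive_maps (bimod_tensor S M N) (bimod_tensor S M N)"
    and bimod_tensor_lact_pure: "\<lbrakk>x \<in> carrier M; y \<in> carrier N\<rbrakk>
      \<Longrightarrow> a \<triangleright>\<^bsub>bimod_tensor S M N\<^esub> (x \<boxtimes>\<^bsub>bimod_tensor S M N\<^esub> y) = (a \<triangleright>\<^bsub>M\<^esub> x) \<boxtimes>\<^bsub>bimod_tensor S M N\<^esub> y"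
proof -
  interpret T: tensor_product S M "ract M" N "lact N" "bimod_tensor S M N" by (rule T)
  interpret M: bimodule R M by (rule M)
  define U where "U = rmod_tensor S M N"
  have U: "tensor_product S M (ract M) N (lact N) U"
    unfolding U_def
    using rmod_tensor_product[OF tensor_product.axioms(1,2)[OF T] T.ra_closed T.la_closed] by simp
  have act: "(\<lambda>t. a \<triangleright>\<^bsub>bimod_tensor S M N\<^esub> t) = tensor_map U (\<lambda>x. a \<triangleright>\<^bsub>M\<^esub> x) id"
    by (simp add: bimod_tensor_def U_def Let_def)
  have pure: "x \<boxtimes>\<^bsub>bimod_tensor S M N\<^esub> y = x \<boxtimes>\<^bsub>U\<^esub> y" for x y
    by (simp add: bimod_tensor_def U_def Let_def pure_tensor_def)
  have lin: "a \<triangleright>\<^bsub>M\<^esub> (x \<triangleleft>\<^bsub>M\<^esub> s) = (a \<triangleright>\<^bsub>M\<^esub> x) \<triangleleft>\<^bsub>M\<^esub> s" if "x \<in> carrier M" "s \<in> S" for x s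
    using that S a M.lact_ract by force
  have "tensor_map U (\<lambda>x. a \<triangleright>\<^bsub>M\<^esub> x) id \<in> additive_maps (bimod_tensor S M N) U"
    by (rule T.tensor_map_additive[OF U M.additive_lact[OF a] lin additive_map_id]) auto
  then show "(\<lambda>t. a \<triangleright>\<^bsub>bimod_tensor S M N\<^esub> t) \<in> additive_maps (bimod_tensor S M N) (bimod_tensor S M N)"
    unfolding act by (simp add: hom_def bimod_tensor_record U_def)
  show "\<lbrakk>x \<in> carrier M; y \<in> carrier N\<rbrakk>
      \<Longrightarrow> a \<triangleright>\<^bsub>bimod_tensor S M N\<^esub> (x \<boxtimes>\<^bsub>bimod_tensor S M N\<^esub> y) = (a \<triangleright>\<^bsub>M\<^esub> x) \<boxtimes>\<^bsub>bimod_tensor S M N\<^esub> y"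
    using T.tensor_map_pure[OF U M.additive_lact[OF a] lin additive_map_id, of x y]
    by (simp add: fun_cong[OF act] pure)
qed

lemma
  assumes M: "module k M" and N: "module k N"
  shows kmod_tensor_smult_additive: "a \<in> carrier k \<Longrightarrow>
      (\<lambda>t. a \<odot>\<^bsub>kmod_tensor k M N\<^esub> t) \<in> additive_maps (kmod_tensor k M N) (kmod_tensor k M N)"
    and kmod_tensor_smult_pure: "\<lbrakk>a \<in> carrier k; x \<in> carrier M; y \<in> carrier N\<rbrakk>
      \<Longrightarrow> a \<odot>\<^bsub>kmod_tensor k M N\<^esub> (x \<boxtimes>\<^bsub>kmod_tensor k M N\<^esub> y) = (a \<odot>\<^bsub>M\<^esub> x) \<boxtimes>\<^bsub>kmod_tensor k M N\<^esub> y"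
    and kmod_tensor_module: "module k (kmod_tensor k M N)"
proof -
  define T where "T = kmod_tensor k M N"
  define U where "U = tensor (carrier k) M (\<lambda>x c. c \<odot>\<^bsub>M\<^esub> x) N (\<lambda>c y. c \<odot>\<^bsub>N\<^esub> y)"
  interpret M: module k M by (rule M)
  interpret N: module k N by (rule N)
  interpret T: tensor_product "carrier k" M "\<lambda>x c. c \<odot>\<^bsub>M\<^esub> x" N "\<lambda>c y. c \<odot>\<^bsub>N\<^esub> y" T
    unfolding T_def by (rule kmod_tensor_product[OF M N])
  have U: "tensor_product (carrier k) M (\<lambda>x c. c \<odot>\<^bsub>M\<^esub> x) N (\<lambda>c y. c \<odot>\<^bsub>N\<^esub> y) U"
    unfolding U_def by unfold_locales (simp_all add: N.smult_closed M.smult_closed)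
  have act: "(\<lambda>t. a \<odot>\<^bsub>T\<^esub> t) = tensor_map U (\<lambda>x. a \<odot>\<^bsub>M\<^esub> x) id" for a
    by (simp add: T_def kmod_tensor_def U_def Let_def)
  have pure: "x \<boxtimes>\<^bsub>T\<^esub> y = x \<boxtimes>\<^bsub>U\<^esub> y" for x y
    by (simp add: T_def kmod_tensor_def U_def Let_def pure_tensor_def)
  have add: "(\<lambda>x. a \<odot>\<^bsub>M\<^esub> x) \<in> additive_maps M M" if "a \<in> carrier k" for a
    using that by (intro additive_mapI) (simp_all add: M.smult_r_distr)
  \<comment> \<open>Commutativity of \<open>k\<close> makes scaling the first factor compatible with
    the balancing relation.\<close>
  have lin: "a \<odot>\<^bsub>M\<^esub> (s \<odot>\<^bsub>M\<^esub> x) = s \<odot>\<^bsub>M\<^esub> (a \<odot>\<^bsub>M\<^esub> x)" if "a \<in> carrier k" "x \<in> carrier M" "s \<in> carrier k" for a x s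
    using that by (simp add: M.R.m_comm flip: M.smult_assoc1)
  have "tensor_map U (\<lambda>x. a \<odot>\<^bsub>M\<^esub> x) id \<in> additive_maps T U" if "a \<in> carrier k" for a
    by (rule T.tensor_map_additive[OF U add[OF that] lin additive_map_id]) (auto simp: that)
  then have additive: "(\<lambda>t. a \<odot>\<^bsub>T\<^esub> t) \<in> additive_maps T T" if "a \<in> carrier k" for a
    unfolding act using that by (simp add: hom_def U_def T_def kmod_tensor_def Let_def)
  have sm: "a \<odot>\<^bsub>T\<^esub> (x \<boxtimes>\<^bsub>T\<^esub> y) = (a \<odot>\<^bsub>M\<^esub> x) \<boxtimes>\<^bsub>T\<^esub> y"
    if "a \<in> carrier k" "x \<in> carrier M" "y \<in> carrier N" for a x y
    using T.tensor_map_pure[OF U add[OF that(1)] lin additive_map_id, of x y] that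
    by (simp add: fun_cong[OF act] pure)
  show "a \<in> carrier k \<Longrightarrow>
      (\<lambda>t. a \<odot>\<^bsub>kmod_tensor k M N\<^esub> t) \<in> additive_maps (kmod_tensor k M N) (kmod_tensor k M N)"
    "\<lbrakk>a \<in> carrier k; x \<in> carrier M; y \<in> carrier N\<rbrakk>
      \<Longrightarrow> a \<odot>\<^bsub>kmod_tensor k M N\<^esub> (x \<boxtimes>\<^bsub>kmod_tensor k M N\<^esub> y) = (a \<odot>\<^bsub>M\<^esub> x) \<boxtimes>\<^bsub>kmod_tensor k M N\<^esub> y"
    using additive sm by (auto simp: T_def)
  note simps = sm additive_map_add[OF additive] additive_map_closed[OF additive] T.pure_closed
  have "module k T"
  proof (rule moduleI)
    fix a b t assume *: "a \<in> carrier k" "b \<in> carrier k" "t \<in> carrier T"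
    show "(a \<oplus>\<^bsub>k\<^esub> b) \<odot>\<^bsub>T\<^esub> t = a \<odot>\<^bsub>T\<^esub> t \<oplus>\<^bsub>T\<^esub> b \<odot>\<^bsub>T\<^esub> t"
      using *(3,1,2) by (induction t rule: T.tensor_induct)
        (simp_all add: simps M.smult_l_distr T.pure_add_left T.T.a_ac)
  next
    fix a b t assume *: "a \<in> carrier k" "b \<in> carrier k" "t \<in> carrier T"
    show "(a \<otimes>\<^bsub>k\<^esub> b) \<odot>\<^bsub>T\<^esub> t = a \<odot>\<^bsub>T\<^esub> (b \<odot>\<^bsub>T\<^esub> t)"
      using *(3,1,2) by (induction t rule: T.tensor_induct) (simp_all add: simps M.smult_assoc1)
  next
    fix t assume "t \<in> carrier T"
    then show "\<one>\<^bsub>k\<^esub> \<odot>\<^bsub>T\<^esub> t = t"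
      by (induction t rule: T.tensor_induct) (simp_all add: simps)
  qed (simp_all add: simps M.is_cring T.abelian_group_T)
  then show "module k (kmod_tensor k M N)"
    by (simp add: T_def)
qed

section \<open>Corings and their comodules\<close>

lemma rmod_homI:
  assumes "f \<in> additive_maps M N"
    and "\<And>x a. \<lbrakk>x \<in> carrier M; a \<in> carrier R\<rbrakk> \<Longrightarrow> f (x \<triangleleft>\<^bsub>M\<^esub> a) = f x \<triangleleft>\<^bsub>N\<^esub> a"
  shows "f \<in> rmod_hom R M N"
  using assms by (simp add: rmod_hom_def)

lemma rmod_homD:
  assumes "f \<in> rmod_hom R M N"
  shows "f \<in> additive_maps M N"
    and "x \<in> carrier M \<Longrightarrow> f x \<in> carrier N"
    and "\<lbrakk>x \<in> carrier M; y \<in> carrier M\<rbrakk> \<Longrightarrow> f (x \<oplus>\<^bsub>M\<^esub> y) = f x \<oplus>\<^bsub>N\<^esub> f y"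
    and "\<lbrakk>x \<in> carrier M; a \<in> carrier R\<rbrakk> \<Longrightarrow> f (x \<triangleleft>\<^bsub>M\<^esub> a) = f x \<triangleleft>\<^bsub>N\<^esub> a"
  using assms by (auto simp: rmod_hom_def hom_def)

lemma rmod_hom_comp:
  "\<lbrakk>f \<in> rmod_hom R L M; g \<in> rmod_hom R M N\<rbrakk> \<Longrightarrow> (\<lambda>x. g (f x)) \<in> rmod_hom R L N"
  by (intro rmod_homI additive_mapI) (simp_all add: rmod_homD)

lemma rmod_hom_cong:
  assumes "right_module R M" "f \<in> rmod_hom R M N" "\<And>x. x \<in> carrier M \<Longrightarrow> f x = g x"
  shows "g \<in> rmod_hom R M N"
proof -
  interpret right_module R M by (rule assms(1))
  show ?thesis
    using rmod_homD[OF assms(2)]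
    by (intro rmod_homI additive_mapI) (simp_all add: ract_closed flip: assms(3))
qed

lemma (in right_module) rmod_hom_inv_into:
  assumes f: "f \<in> rmod_hom R M N" and bij: "bij_betw f (carrier M) (carrier N)"
  shows "inv_into (carrier M) f \<in> rmod_hom R N M"
proof -
  let ?g = "inv_into (carrier M) f"
  have g: "?g y \<in> carrier M" "f (?g y) = y" if "y \<in> carrier N" for y
    using bij that by (auto simp: bij_betw_def inv_into_into f_inv_into_f)
  have eqI: "?g y = x" if "f x = y" "x \<in> carrier M" for x y
    using bij that by (auto simp: bij_betw_def inv_into_f_f)
  show ?thesis
    by (intro rmod_homI additive_mapI eqI) (simp_all add: g rmod_homD[OF f] ract_closed)
qed

lemma rmod_cat_sel:
  "Ob (rmod_cat R) = {M. right_module R M}"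
  "Mor (rmod_cat R) M N = extensional (carrier M) \<inter> rmod_hom R M N"
  "Idn (rmod_cat R) M = (\<lambda>x \<in> carrier M. x)"
  "Cmp (rmod_cat R) L M N g f = compose (carrier L) g f"
  by (simp_all add: rmod_cat_def)

lemma comod_cat_sel:
  "Ob (comod_cat A X) = {M. coring_comodule A X M}"
  "Mor (comod_cat A X) M N = extensional (carrier M) \<inter> comodule_hom A X M N"
  "Idn (comod_cat A X) M = (\<lambda>x \<in> carrier M. x)"
  "Cmp (comod_cat A X) L M N g f = compose (carrier L) g f"
  by (simp_all add: comod_cat_def)

lemma rmod_hom_restrict_id: "right_module R M \<Longrightarrow> (\<lambda>x \<in> carrier M. x) \<in> rmod_hom R M M"
  by (rule rmod_hom_cong[of _ _ "\<lambda>x. x"]) (auto intro!: rmod_homI additive_mapI)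

lemma rmod_hom_compose:
  "\<lbrakk>right_module R L; f \<in> rmod_hom R L M; g \<in> rmod_hom R M N\<rbrakk> \<Longrightarrow> compose (carrier L) g f \<in> rmod_hom R L N"
  by (rule rmod_hom_cong[of _ _ "\<lambda>x. g (f x)"]) (auto simp: compose_def rmod_hom_comp)

lemma category_rmod_cat: "category (rmod_cat R)"
proof (unfold_locales, goal_cases)
  case (3 X Y f)
  then show ?case
    by (auto simp: rmod_cat_sel compose_def restrict_def extensional_def fun_eq_iff)
next
  case (4 X Y f)
  then show ?case
    by (auto simp: rmod_cat_sel compose_def restrict_def extensional_def fun_eq_iff rmod_homD)
next
  case (5 W X Y Z f g h)
  then show ?case
    by (auto simp: rmod_cat_sel compose_def restrict_def fun_eq_iff rmod_homD)
qed (auto simp: rmod_cat_sel rmod_hom_restrict_id rmod_hom_compose)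

section \<open>Tensoring right modules with the coring\<close>

context coring
begin

abbreviation "TX M \<equiv> rmod_tensor (carrier A) M X"
abbreviation "XX \<equiv> bimod_tensor (carrier A) X X"

lemma tensor_product_X:
  "right_module A M \<Longrightarrow> tensor_product (carrier A) M (ract M) X (lact X) (TX M)"
  by (rule rmod_tensor_product)
    (simp_all add: X.lact_closed X.abelian_group_axioms right_module.axioms(2) right_module.ract_closed)

lemma right_module_tensor_X: "right_module A M \<Longrightarrow> right_module A (TX M)"
  by (rule rmod_tensor_right_module[OF tensor_product_X X.bimodule_axioms]) auto

lemma tensor_X_ract:
  assumes "right_module A M" "a \<in> carrier A"
  shows "(\<lambda>t. t \<triangleleft>\<^bsub>TX M\<^esub> a) \<in> additive_maps (TX M) (TX M)"
    and "\<lbrakk>m \<in> carrier M; x \<in> carrier X\<rbrakk> \<Longrightarrow> (m \<boxtimes>\<^bsub>TX M\<^esub> x) \<triangleleft>\<^bsub>TX M\<^esub> a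
      = m \<boxtimes>\<^bsub>TX M\<^esub> (x \<triangleleft>\<^bsub>X\<^esub> a)"
  using rmod_tensor_ract_additive[OF tensor_product_X[OF assms(1)] X.bimodule_axioms order.refl assms(2)]
    rmod_tensor_ract_pure[OF tensor_product_X[OF assms(1)] X.bimodule_axioms order.refl assms(2)]
  by simp_all

lemma tensor_product_XX: "tensor_product (carrier A) X (ract X) X (lact X) XX"
  by (rule bimod_tensor_product) (simp_all add: X.lact_closed X.ract_closed X.abelian_group_axioms)

lemma lact_XX:
  assumes "a \<in> carrier A"
  shows "(\<lambda>t. a \<triangleright>\<^bsub>XX\<^esub> t) \<in> additive_maps XX XX"
    and "\<lbrakk>x \<in> carrier X; y \<in> carrier X\<rbrakk> \<Longrightarrow> a \<triangleright>\<^bsub>XX\<^esub> (x \<boxtimes>\<^bsub>XX\<^esub> y) = (a \<triangleright>\<^bsub>X\<^esub> x) \<boxtimes>\<^bsub>XX\<^esub> y"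
  using bimod_tensor_lact_additive[OF tensor_product_XX X.bimodule_axioms order.refl assms]
    bimod_tensor_lact_pure[OF tensor_product_XX X.bimodule_axioms order.refl assms]
  by simp_all

lemma tensor_product_X_XX:
  assumes "right_module A M"
  shows "tensor_product (carrier A) M (ract M) XX (lact XX) (rmod_tensor (carrier A) M XX)"
proof -
  interpret M: right_module A M by (rule assms)
  show ?thesis
    by (rule rmod_tensor_product)
      (simp_all add: tensor_product.abelian_group_T[OF tensor_product_XX] right_module.axioms(2)[OF assms]
        M.ract_closed additive_map_closed[OF lact_XX(1)])
qed

lemma
  shows comult_additive: "ccomult X \<in> additive_maps X XX"
    and comult_lact: "\<lbrakk>a \<in> carrier A; x \<in> carrier X\<rbrakk> \<Longrightarrow> ccomult X (a \<triangleright>\<^bsub>X\<^esub> x) = a \<triangleright>\<^bsub>XX\<^esub> ccomult X x"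
  using ccomult_hom by (auto simp: bimod_hom_def rmod_hom_def)

lemma
  shows counit_additive: "ccounit X \<in> additive_maps X A"
    and counit_lact: "\<lbrakk>a \<in> carrier A; x \<in> carrier X\<rbrakk> \<Longrightarrow> ccounit X (a \<triangleright>\<^bsub>X\<^esub> x) = a \<otimes>\<^bsub>A\<^esub> ccounit X x"
  using ccounit_hom by (auto simp: bimod_hom_def rmod_hom_def regular_bimod_def hom_def)

lemma
  assumes M: "right_module A M" and N: "right_module A N" and f: "f \<in> rmod_hom A M N"
  shows tensor_map_X_hom: "tensor_map (TX N) f id
      \<in> rmod_hom A (TX M) (TX N)"
    and tensor_map_X_pure: "\<lbrakk>m \<in> carrier M; x \<in> carrier X\<rbrakk> \<Longrightarrow>
      tensor_map (TX N) f id (m \<boxtimes>\<^bsub>TX M\<^esub> x)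
      = f m \<boxtimes>\<^bsub>TX N\<^esub> x"
proof -
  let ?MX = "TX M" and ?NX = "TX N"
  interpret MX: tensor_product "carrier A" M "ract M" X "lact X" ?MX by (rule tensor_product_X[OF M])
  note map = MX.tensor_map_additive[OF tensor_product_X[OF N] rmod_homD(1,4)[OF f] additive_map_id]
    MX.tensor_map_pure[OF tensor_product_X[OF N] rmod_homD(1,4)[OF f] additive_map_id]
  show "\<lbrakk>m \<in> carrier M; x \<in> carrier X\<rbrakk> \<Longrightarrow>
      tensor_map ?NX f id (m \<boxtimes>\<^bsub>?MX\<^esub> x) = f m \<boxtimes>\<^bsub>?NX\<^esub> x"
    by (simp add: map(2))
  have 1: "tensor_map ?NX f id \<in> additive_maps ?MX ?NX"
    by (rule map(1)) auto
  show "tensor_map ?NX f id \<in> rmod_hom A ?MX ?NX"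
  proof (rule rmod_homI[OF 1])
    fix t a assume t: "t \<in> carrier ?MX" and a: "a \<in> carrier A"
    show "tensor_map ?NX f id (t \<triangleleft>\<^bsub>?MX\<^esub> a) = tensor_map ?NX f id t \<triangleleft>\<^bsub>?NX\<^esub> a"
      by (rule MX.additive_map_eqI[OF additive_map_comp[OF tensor_X_ract(1)[OF M a] 1]
            additive_map_comp[OF 1 tensor_X_ract(1)[OF N a]] t])
        (simp add: tensor_X_ract(2)[OF M a] tensor_X_ract(2)[OF N a] map(2) X.ract_closed a rmod_homD(2)[OF f])
  qed
qed

lemma tensor_map_X_comp:
  assumes M: "right_module A L" "right_module A M" "right_module A N"
    and f: "f \<in> rmod_hom A L M" and g: "g \<in> rmod_hom A M N" and t: "t \<in> carrier (TX L)"
  shows "tensor_map (TX N) g id (tensor_map (TX M) f id t)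
    = tensor_map (TX N) (\<lambda>x. g (f x)) id t"
  by (rule tensor_product.additive_map_eqI[OF tensor_product_X[OF M(1)]
        additive_map_comp[OF rmod_homD(1)[OF tensor_map_X_hom[OF M(1,2) f]] rmod_homD(1)[OF tensor_map_X_hom[OF M(2,3) g]]]
        rmod_homD(1)[OF tensor_map_X_hom[OF M(1,3) rmod_hom_comp[OF f g]]] t])
    (simp add: tensor_map_X_pure[OF M(1,2) f] tensor_map_X_pure[OF M(2,3) g]
      tensor_map_X_pure[OF M(1,3) rmod_hom_comp[OF f g]] rmod_homD(2)[OF f])

text \<open>Allows a map to be replaced by its restriction to the carrier, as is constantly required
  when morphisms are extensional functions.\<close>

lemma tensor_map_X_cong:
  assumes M: "right_module A M" and N: "right_module A N"
    and f: "f \<in> rmod_hom A M N" and t: "t \<in> carrier (TX M)"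
    and eq: "\<And>x. x \<in> carrier M \<Longrightarrow> f x = g x"
  shows "tensor_map (TX N) f id t = tensor_map (TX N) g id t"
proof -
  note g = rmod_hom_cong[OF M f eq]
  show ?thesis
    by (rule tensor_product.additive_map_eqI[OF tensor_product_X[OF M]
          rmod_homD(1)[OF tensor_map_X_hom[OF M N f]] rmod_homD(1)[OF tensor_map_X_hom[OF M N g]] t])
      (simp_all add: tensor_map_X_pure[OF M N f] tensor_map_X_pure[OF M N g] eq)
qed

lemma tensor_map_X_id:
  assumes M: "right_module A M" and t: "t \<in> carrier (TX M)"
  shows "tensor_map (TX M) (\<lambda>x. x) id t = t"
proof -
  have id: "(\<lambda>x. x) \<in> rmod_hom A M M"
    by (auto intro!: rmod_homI additive_mapI)
  have "tensor_map (TX M) (\<lambda>x. x) id t = id t"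
    by (rule tensor_product.additive_map_eqI[OF tensor_product_X[OF M]
          rmod_homD(1)[OF tensor_map_X_hom[OF M M id]] additive_map_id t])
      (simp add: tensor_map_X_pure[OF M M id])
  then show ?thesis by simp
qed

lemma
  assumes M: "right_module A M"
  shows tensor_assoc_X_additive: "tensor_assoc (rmod_tensor (carrier A) M XX) XX
      \<in> additive_maps (TX (TX M)) (rmod_tensor (carrier A) M XX)"
    and tensor_assoc_X_pure: "\<lbrakk>m \<in> carrier M; x \<in> carrier X; y \<in> carrier X\<rbrakk> \<Longrightarrow>
      tensor_assoc (rmod_tensor (carrier A) M XX) XX
        ((m \<boxtimes>\<^bsub>TX M\<^esub> x) \<boxtimes>\<^bsub>TX (TX M)\<^esub> y)
      = m \<boxtimes>\<^bsub>rmod_tensor (carrier A) M XX\<^esub> (x \<boxtimes>\<^bsub>XX\<^esub> y)"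
  by (simp_all add: tensor_assoc_additive[OF tensor_product_X[OF M] tensor_product_X[OF right_module_tensor_X[OF M]]
      tensor_product_XX tensor_product_X_XX[OF M] tensor_X_ract[OF M] lact_XX(2)]
    tensor_assoc_pure[OF tensor_product_X[OF M] tensor_product_X[OF right_module_tensor_X[OF M]]
      tensor_product_XX tensor_product_X_XX[OF M] tensor_X_ract[OF M] lact_XX(2)])

end

section \<open>Transport of module structures along injections\<close>

lemma abelian_group_cong:
  assumes "abelian_group M" "carrier N = carrier M" "add N = add M" "\<zero>\<^bsub>N\<^esub> = \<zero>\<^bsub>M\<^esub>"
  shows "abelian_group N"
proof -
  interpret abelian_group M by (rule assms(1))
  show ?thesis
    by (rule abelian_groupI; unfold assms(2-4)) (auto simp: a_ac intro: add.l_inv_ex)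
qed

lemma right_module_cong:
  assumes "right_module R M" "carrier N = carrier M" "add N = add M" "\<zero>\<^bsub>N\<^esub> = \<zero>\<^bsub>M\<^esub>" "ract N = ract M"
  shows "right_module R N"
  using assms abelian_group_cong[of M N]
  by (simp add: right_module_def right_module_axioms_def)

text \<open>Identifies, as equal records, the tensor products formed over a comodule and over its
  underlying module; the coactions of transported and of induced comodules are defined over the
  latter.\<close>

lemma rmod_tensor_cong:
  assumes "carrier N = carrier M" "add N = add M" "ract N = ract M"
  shows "rmod_tensor S N X = rmod_tensor S M X"
  using assms by (simp add: rmod_tensor_def tensor_def tensor_relators_def)

lemma transport_rmod_sel:
  "carrier (transport_rmod \<theta> M) = \<theta> ` carrier M"
  "\<zero>\<^bsub>transport_rmod \<theta> M\<^esub> = \<theta> \<zero>\<^bsub>M\<^esub>"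
  "x \<oplus>\<^bsub>transport_rmod \<theta> M\<^esub> y = \<theta> (inv_into (carrier M) \<theta> x \<oplus>\<^bsub>M\<^esub> inv_into (carrier M) \<theta> y)"
  "x \<triangleleft>\<^bsub>transport_rmod \<theta> M\<^esub> a = \<theta> (inv_into (carrier M) \<theta> x \<triangleleft>\<^bsub>M\<^esub> a)"
  by (simp_all add: transport_rmod_def Let_def)

lemma transport_comod_sel:
  "carrier (transport_comod A X \<theta> M) = carrier (transport_rmod \<theta> M)"
  "\<zero>\<^bsub>transport_comod A X \<theta> M\<^esub> = \<zero>\<^bsub>transport_rmod \<theta> M\<^esub>"
  "add (transport_comod A X \<theta> M) = add (transport_rmod \<theta> M)"
  "ract (transport_comod A X \<theta> M) = ract (transport_rmod \<theta> M)"
  "coact (transport_comod A X \<theta> M) = (\<lambda>x. tensor_map (rmod_tensor (carrier A) (transport_rmod \<theta> M) X) \<theta> id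
            (coact M (inv_into (carrier M) \<theta> x)))"
  by (simp_all add: transport_comod_def Let_def)

lemma (in right_module) transport_right_module:
  assumes inj: "inj_on \<theta> (carrier M)"
  shows "right_module R (transport_rmod \<theta> M)"
proof -
  note simps = transport_rmod_sel inv_into_f_f[OF inj] ract_closed
  have "abelian_group (transport_rmod \<theta> M)"
  proof (rule abelian_groupI)
    fix x assume "x \<in> carrier (transport_rmod \<theta> M)"
    then obtain m where "m \<in> carrier M" "x = \<theta> m"
      by (auto simp: simps)
    then show "\<exists>y \<in> carrier (transport_rmod \<theta> M). y \<oplus>\<^bsub>transport_rmod \<theta> M\<^esub> x = \<zero>\<^bsub>transport_rmod \<theta> M\<^esub>"
      by (intro bexI[of _ "\<theta> (\<ominus>\<^bsub>M\<^esub> m)"]) (auto simp: simps M.l_neg)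
  qed (auto simp: simps M.a_ac)
  then show ?thesis
    by (auto simp: right_module_def right_module_axioms_def R.ring_axioms simps
        ract_add_left ract_add_right ract_mult ract_one)
qed

lemma (in right_module) transport_rmod_hom:
  assumes inj: "inj_on \<theta> (carrier M)"
  shows "\<theta> \<in> rmod_hom R M (transport_rmod \<theta> M)"
  by (intro rmod_homI additive_mapI) (simp_all add: transport_rmod_sel inv_into_f_f[OF inj])

lemma comodule_homD:
  assumes "f \<in> comodule_hom A X M N"
  shows "f \<in> rmod_hom A M N"
    and "m \<in> carrier M \<Longrightarrow> coact N (f m) = tensor_map (rmod_tensor (carrier A) N X) f id (coact M m)"
  using assms by (auto simp: comodule_hom_def)

lemma comodule_homI:
  assumes "f \<in> rmod_hom A M N"
    and "\<And>m. m \<in> carrier M \<Longrightarrow> coact N (f m) = tensor_map (rmod_tensor (carrier A) N X) f id (coact M m)"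
  shows "f \<in> comodule_hom A X M N"
  using assms by (auto simp: comodule_hom_def)

lemma (in coring_comodule) coact_closed:
  "m \<in> carrier M \<Longrightarrow> coact M m \<in> carrier (rmod_tensor (carrier A) M X)"
  by (rule rmod_homD(2)[OF coact_hom])

section \<open>Coassociativity in Sweedler form, comodule morphisms and the category of
  comodules\<close>

context coring
begin

lemma
  assumes M: "right_module A M"
  shows comult_map_additive: "tensor_map (rmod_tensor (carrier A) M XX) id (ccomult X)
      \<in> additive_maps (TX M) (rmod_tensor (carrier A) M XX)"
    and comult_map_pure: "\<lbrakk>m \<in> carrier M; x \<in> carrier X\<rbrakk> \<Longrightarrow>
      tensor_map (rmod_tensor (carrier A) M XX) id (ccomult X) (m \<boxtimes>\<^bsub>TX M\<^esub> x)
      = m \<boxtimes>\<^bsub>rmod_tensor (carrier A) M XX\<^esub> ccomult X x"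
proof -
  interpret MX: tensor_product "carrier A" M "ract M" X "lact X" "TX M"
    by (rule tensor_product_X[OF M])
  note map = MX.tensor_map_additive[OF tensor_product_X_XX[OF M] additive_map_id _ comult_additive comult_lact]
    MX.tensor_map_pure[OF tensor_product_X_XX[OF M] additive_map_id _ comult_additive comult_lact]
  show "tensor_map (rmod_tensor (carrier A) M XX) id (ccomult X)
      \<in> additive_maps (TX M) (rmod_tensor (carrier A) M XX)"
    by (rule map(1)) auto
  show "\<lbrakk>m \<in> carrier M; x \<in> carrier X\<rbrakk> \<Longrightarrow>
      tensor_map (rmod_tensor (carrier A) M XX) id (ccomult X) (m \<boxtimes>\<^bsub>TX M\<^esub> x)
      = m \<boxtimes>\<^bsub>rmod_tensor (carrier A) M XX\<^esub> ccomult X x"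
    using map(2)[of m x] by simp
qed

text \<open>Sweedler notation for comodules: in \<open>f m0 m1 m2\<close> the last two legs may come
  from the coproduct, or the first two from a second application of the coaction. The balancedness
  of both integrands is recorded, since every later rewriting under the outer lift requires
  it.\<close>

lemma
  assumes M: "coring_comodule A X M" and G: "abelian_group G"
    and f: "balanced_map3 (carrier A) M (ract M) (lact X) X (carrier A) (ract X) X (lact X) G f"
  shows comodule_coassoc: "m \<in> carrier M \<Longrightarrow>
      tensor_lift G (\<lambda>n x. tensor_lift G (f n) (ccomult X x)) (coact M m)
      = tensor_lift G (\<lambda>n z. tensor_lift G (\<lambda>n' y. f n' y z) (coact M n)) (coact M m)"
    and balanced_comult: "balanced_map (carrier A) M (ract M) X (lact X) G (\<lambda>n x. tensor_lift G (f n) (ccomult X x))"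
    and balanced_coact: "balanced_map (carrier A) M (ract M) X (lact X) G
      (\<lambda>n z. tensor_lift G (\<lambda>n' y. f n' y z) (coact M n))"
proof -
  interpret M: coring_comodule A X M by (rule M)
  have Mm: "right_module A M" by (rule M.right_module_axioms)
  interpret MX: tensor_product "carrier A" M "ract M" X "lact X" "TX M"
    by (rule tensor_product_X[OF Mm])
  note MXm = right_module_tensor_X[OF Mm]
  note tp = tensor_product_X[OF Mm] tensor_product_X[OF MXm] tensor_product_XX tensor_product_X_XX[OF Mm]
    tensor_X_ract[OF Mm] lact_XX
  note left = balanced_map3_left[OF tp G f]
  note right = balanced_map3_right[OF tp G f]
  note lin = rmod_homD(1,4)[OF M.coact_hom]
  have "balanced_map (carrier A) M (ract M) X (lact X) G (\<lambda>x y. tensor_lift G (f (id x)) (ccomult X y))"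
    by (rule MX.balanced_map_comp[OF tensor_product_X_XX[OF Mm] additive_map_id _ comult_additive comult_lact right]) auto
  then show "balanced_map (carrier A) M (ract M) X (lact X) G (\<lambda>n x. tensor_lift G (f n) (ccomult X x))"
    by simp
  have "balanced_map (carrier A) M (ract M) X (lact X) G
      (\<lambda>n z. tensor_lift G (\<lambda>n' y. f n' y (id z)) (coact M n))"
    by (rule MX.balanced_map_comp[OF tensor_product_X[OF MXm] lin additive_map_id _ left]) auto
  then show "balanced_map (carrier A) M (ract M) X (lact X) G
      (\<lambda>n z. tensor_lift G (\<lambda>n' y. f n' y z) (coact M n))"
    by simp
  assume m: "m \<in> carrier M"
  let ?t = "coact M m"
  have t: "?t \<in> carrier (TX M)"
    by (rule M.coact_closed[OF m])
  have "tensor_lift G (\<lambda>n x. tensor_lift G (f n) (ccomult X x)) ?t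
      = tensor_lift G (\<lambda>n w. tensor_lift G (f n) w) (tensor_map (rmod_tensor (carrier A) M XX) id (ccomult X) ?t)"
    by (subst MX.tensor_lift_tensor_map[OF tensor_product_X_XX[OF Mm] additive_map_id _ comult_additive comult_lact G right t])
      simp_all
  also have "\<dots> = tensor_lift G (\<lambda>n w. tensor_lift G (f n) w) (tensor_assoc (rmod_tensor (carrier A) M XX) XX
      (tensor_map (TX (TX M)) (coact M) id ?t))"
    by (simp add: M.coact_coassoc[OF m])
  also have "\<dots> = tensor_lift G (\<lambda>u z. tensor_lift G (\<lambda>n' y. f n' y z) u)
      (tensor_map (TX (TX M)) (coact M) id ?t)"
    by (rule tensor_lift_assoc[OF tp G f])
      (auto intro!: additive_map_closed[OF MX.tensor_map_additive[OF tensor_product_X[OF MXm] lin additive_map_id] t])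
  also have "\<dots> = tensor_lift G (\<lambda>n z. tensor_lift G (\<lambda>n' y. f n' y z) (coact M n)) ?t"
    by (subst MX.tensor_lift_tensor_map[OF tensor_product_X[OF MXm] lin additive_map_id _ G left t])
      simp_all
  finally show "tensor_lift G (\<lambda>n x. tensor_lift G (f n) (ccomult X x)) ?t
      = tensor_lift G (\<lambda>n z. tensor_lift G (\<lambda>n' y. f n' y z) (coact M n)) ?t" .
qed

text \<open>A left linear functional \<open>h\<close> on the coring yields an additive map
  \<open>m \<mapsto> m0 h(m1)\<close> on every comodule. The counit and the left linear extension of
  \<open>i\<close> are the functionals of interest.\<close>

lemma balanced_lact_map:
  assumes M: "right_module A M" and h: "h \<in> additive_maps X A"
    "\<And>a x. \<lbrakk>a \<in> carrier A; x \<in> carrier X\<rbrakk> \<Longrightarrow> h (a \<triangleright>\<^bsub>X\<^esub> x) = a \<otimes>\<^bsub>A\<^esub> h x"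
  shows "balanced_map (carrier A) M (ract M) X (lact X) M (\<lambda>n x. n \<triangleleft>\<^bsub>M\<^esub> h x)"
proof -
  interpret M: right_module A M by (rule M)
  show ?thesis
    by (intro balanced_mapI)
      (simp_all add: additive_map_closed[OF h(1)] additive_map_add[OF h(1)] h(2) M.ract_closed
        M.ract_add_left M.ract_add_right M.ract_mult)
qed

text \<open>Naturality of associativity, coproduct and counit in the module lets the comodule axioms
  descend along a surjection that intertwines the coactions. The use is transport of a comodule
  along an injective encoding.\<close>

lemma comodule_image:
  assumes M: "coring_comodule A X M" and N: "right_module A N"
    and f: "f \<in> rmod_hom A M N" and surj: "f ` carrier M = carrier N"
    and coact: "coact N \<in> rmod_hom A N (TX N)"
    and comm: "\<And>m. m \<in> carrier M \<Longrightarrow> coact N (f m) = tensor_map (TX N) f id (coact M m)"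
  shows "coring_comodule A X N"
proof -
  interpret M: coring_comodule A X M by (rule M)
  interpret N: right_module A N by (rule N)
  have Mm: "right_module A M" by (rule M.right_module_axioms)
  let ?MX = "TX M" and ?NX = "TX N"
  let ?MXX = "rmod_tensor (carrier A) M XX" and ?NXX = "rmod_tensor (carrier A) N XX"
  let ?MX_X = "TX ?MX" and ?NX_X = "TX ?NX"
  interpret MX: tensor_product "carrier A" M "ract M" X "lact X" ?MX by (rule tensor_product_X[OF Mm])
  interpret NX: tensor_product "carrier A" N "ract N" X "lact X" ?NX by (rule tensor_product_X[OF N])
  note MXm = right_module_tensor_X[OF Mm] and NXm = right_module_tensor_X[OF N]
  interpret MX_X: tensor_product "carrier A" ?MX "ract ?MX" X "lact X" ?MX_X by (rule tensor_product_X[OF MXm])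
  interpret NX_X: tensor_product "carrier A" ?NX "ract ?NX" X "lact X" ?NX_X by (rule tensor_product_X[OF NXm])
  interpret MXX: tensor_product "carrier A" M "ract M" XX "lact XX" ?MXX by (rule tensor_product_X_XX[OF Mm])
  interpret XX: tensor_product "carrier A" X "ract X" X "lact X" XX by (rule tensor_product_XX)
  define \<Phi> where "\<Phi> = tensor_map ?NX f id"
  define \<Psi> where "\<Psi> = tensor_map ?NXX f id"
  note tf = tensor_map_X_hom[OF Mm N f, folded \<Phi>_def] tensor_map_X_pure[OF Mm N f, folded \<Phi>_def]
  note comm = comm[folded \<Phi>_def]
  note tcM = tensor_map_X_hom[OF Mm MXm M.coact_hom] tensor_map_X_pure[OF Mm MXm M.coact_hom]
  note tcN = tensor_map_X_hom[OF N NXm coact] tensor_map_X_pure[OF N NXm coact]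
  note asM = tensor_assoc_X_additive[OF Mm] tensor_assoc_X_pure[OF Mm]
  note asN = tensor_assoc_X_additive[OF N] tensor_assoc_X_pure[OF N]
  have fXX: "\<Psi> \<in> additive_maps ?MXX ?NXX"
    unfolding \<Psi>_def
    by (rule MXX.tensor_map_additive[OF tensor_product_X_XX[OF N] rmod_homD(1,4)[OF f] additive_map_id]) auto
  have fXX_pure: "\<Psi> (m \<boxtimes>\<^bsub>?MXX\<^esub> w) = f m \<boxtimes>\<^bsub>?NXX\<^esub> w"
    if "m \<in> carrier M" "w \<in> carrier XX" for m w
    using that by (simp add: \<Psi>_def MXX.tensor_map_pure[OF tensor_product_X_XX[OF N] rmod_homD(1,4)[OF f] additive_map_id])
  have inner: "tensor_assoc ?NXX XX (\<Phi> u \<boxtimes>\<^bsub>?NX_X\<^esub> x)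
      = \<Psi> (tensor_assoc ?MXX XX (u \<boxtimes>\<^bsub>?MX_X\<^esub> x))"
    if "u \<in> carrier ?MX" "x \<in> carrier X" for u x
    using that
  proof (induction u rule: MX.tensor_induct)
    case (pure n y)
    then show ?case
      by (simp only: tf(2) asM(2) asN(2) rmod_homD(2)[OF f] fXX_pure XX.pure_closed)
  next
    case (add t u)
    then show ?case
      by (simp add: rmod_homD[OF tf(1)] NX_X.pure_add_left MX_X.pure_add_left NX_X.pure_closed MX_X.pure_closed
          additive_map_add[OF asN(1)] additive_map_add[OF asM(1)] additive_map_closed[OF asM(1)] additive_map_add[OF fXX])
  qed
  show ?thesis
  proof (intro coring_comodule.intro coring_comodule_axioms.intro N coact)
    fix n assume "n \<in> carrier N"
    then obtain m where m: "m \<in> carrier M" "n = f m"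
      using surj by auto
    have t: "coact M m \<in> carrier ?MX" by (rule M.coact_closed[OF m(1)])
    \<comment> \<open>Naturality moves \<open>f\<close> to the outside, where coassociativity of
      \<open>M\<close> applies.\<close>
    have "tensor_assoc ?NXX XX (tensor_map ?NX_X (coact N) id (\<Phi> (coact M m)))
        = \<Psi> (tensor_assoc ?MXX XX (tensor_map ?MX_X (coact M) id (coact M m)))"
      by (rule MX.additive_map_eqI[OF
            additive_map_comp[OF additive_map_comp[OF rmod_homD(1)[OF tf(1)] rmod_homD(1)[OF tcN(1)]] asN(1)]
            additive_map_comp[OF additive_map_comp[OF rmod_homD(1)[OF tcM(1)] asM(1)] fXX] t])
        (simp add: tf tcN tcM rmod_homD(2)[OF f] comm inner M.coact_closed)
    also have "\<dots> = \<Psi> (tensor_map ?MXX id (ccomult X) (coact M m))"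
      by (simp add: M.coact_coassoc m)
    also have "\<dots> = tensor_map ?NXX id (ccomult X) (\<Phi> (coact M m))"
      by (rule MX.additive_map_eqI[OF additive_map_comp[OF comult_map_additive[OF Mm] fXX]
            additive_map_comp[OF rmod_homD(1)[OF tf(1)] comult_map_additive[OF N]] t])
        (simp add: tf comult_map_pure[OF Mm] comult_map_pure[OF N] fXX_pure rmod_homD(2)[OF f]
          additive_map_closed[OF comult_additive])
    finally show "tensor_assoc ?NXX XX (tensor_map ?NX_X (coact N) id (coact N n))
        = tensor_map ?NXX id (ccomult X) (coact N n)"
      by (simp add: m comm)
    note balM = balanced_lact_map[OF Mm counit_additive counit_lact]
      and balN = balanced_lact_map[OF N counit_additive counit_lact]
    have "tensor_lift N (\<lambda>n x. n \<triangleleft>\<^bsub>N\<^esub> ccounit X x) (\<Phi> (coact M m))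
        = f (tensor_lift M (\<lambda>n x. n \<triangleleft>\<^bsub>M\<^esub> ccounit X x) (coact M m))"
      by (rule MX.additive_map_eqI[OF
            additive_map_comp[OF rmod_homD(1)[OF tf(1)] NX.tensor_lift_additive[OF N.M.abelian_group_axioms balN]]
            additive_map_comp[OF MX.tensor_lift_additive[OF M.M.abelian_group_axioms balM] rmod_homD(1)[OF f]] t])
        (simp_all add: tf NX.tensor_lift_pure[OF N.M.abelian_group_axioms balN]
          MX.tensor_lift_pure[OF M.M.abelian_group_axioms balM] rmod_homD[OF f] additive_map_closed[OF counit_additive])
    then show "tensor_lift N (\<lambda>n x. n \<triangleleft>\<^bsub>N\<^esub> ccounit X x) (coact N n) = n"
      by (simp add: m comm M.coact_counit)
  qed
qed

lemma comodule_hom_comp: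
  assumes "coring_comodule A X L" "coring_comodule A X M" "coring_comodule A X N"
    and f: "f \<in> comodule_hom A X L M" and g: "g \<in> comodule_hom A X M N"
  shows "(\<lambda>x. g (f x)) \<in> comodule_hom A X L N"
  by (intro comodule_homI rmod_hom_comp[OF comodule_homD(1)[OF f] comodule_homD(1)[OF g]])
    (simp add: comodule_homD[OF f] comodule_homD[OF g] rmod_homD(2)[OF comodule_homD(1)[OF f]] coring_comodule.coact_closed[OF assms(1)]
      tensor_map_X_comp[OF coring_comodule.axioms(1)[OF assms(1)] coring_comodule.axioms(1)[OF assms(2)]
        coring_comodule.axioms(1)[OF assms(3)] comodule_homD(1)[OF f] comodule_homD(1)[OF g]])

lemma comodule_hom_cong:
  assumes M: "coring_comodule A X M" and N: "coring_comodule A X N"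
    and f: "f \<in> comodule_hom A X M N" and eq: "\<And>x. x \<in> carrier M \<Longrightarrow> f x = g x"
  shows "g \<in> comodule_hom A X M N"
  using comodule_homD(2)[OF f]
  by (intro comodule_homI rmod_hom_cong[OF coring_comodule.axioms(1)[OF M] comodule_homD(1)[OF f] eq])
    (simp_all add: eq[symmetric] coring_comodule.coact_closed[OF M]
      tensor_map_X_cong[OF coring_comodule.axioms(1)[OF M] coring_comodule.axioms(1)[OF N] comodule_homD(1)[OF f] _ eq])

lemma comodule_hom_id:
  assumes M: "coring_comodule A X M"
  shows "(\<lambda>x. x) \<in> comodule_hom A X M M"
  by (intro comodule_homI rmod_homI additive_mapI)
    (simp_all add: tensor_map_X_id[OF coring_comodule.axioms(1)[OF M]] coring_comodule.coact_closed[OF M])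

text \<open>Apply the inverse, tensored with \<open>X\<close>, to
  \<open>coact (f x) = (f \<otimes> X) (coact x)\<close> and cancel by functoriality.\<close>

lemma comodule_hom_inv_into:
  assumes M: "coring_comodule A X M" and N: "coring_comodule A X N"
    and f: "f \<in> comodule_hom A X M N" and bij: "bij_betw f (carrier M) (carrier N)"
  shows "inv_into (carrier M) f \<in> comodule_hom A X N M"
proof -
  let ?g = "inv_into (carrier M) f"
  note Mm = coring_comodule.axioms(1)[OF M] and Nm = coring_comodule.axioms(1)[OF N]
  have g: "?g \<in> rmod_hom A N M"
    by (rule right_module.rmod_hom_inv_into[OF Mm comodule_homD(1)[OF f] bij])
  have gf: "?g (f x) = x" if "x \<in> carrier M" for x
    using bij that by (simp add: bij_betw_inv_into_left)
  show ?thesis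
  proof (rule comodule_homI[OF g])
    fix y assume y: "y \<in> carrier N"
    then have gy: "?g y \<in> carrier M" "f (?g y) = y"
      using rmod_homD(2)[OF g] bij by (auto simp: bij_betw_inv_into_right)
    have "tensor_map (TX M) ?g id (coact N y)
        = tensor_map (TX M) (\<lambda>x. ?g (f x)) id (coact M (?g y))"
      using comodule_homD(2)[OF f gy(1)] gy
      by (simp add: tensor_map_X_comp[OF Mm Nm Mm comodule_homD(1)[OF f] g] coring_comodule.coact_closed[OF M])
    also have "\<dots> = tensor_map (TX M) (\<lambda>x. x) id (coact M (?g y))"
      using gy by (intro tensor_map_X_cong[OF Mm Mm rmod_hom_comp[OF comodule_homD(1)[OF f] g]])
        (simp_all add: gf coring_comodule.coact_closed[OF M])
    finally show "coact M (?g y) = tensor_map (TX M) ?g id (coact N y)"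
      using gy by (simp add: tensor_map_X_id[OF Mm] coring_comodule.coact_closed[OF M])
  qed
qed

lemma category_comod_cat: "category (comod_cat A X)"
proof (unfold_locales, goal_cases)
  case (1 M)
  then show ?case
    by (auto simp: comod_cat_sel intro: comodule_hom_cong[OF _ _ comodule_hom_id])
next
  case (2 L M N f g)
  then show ?case
    by (auto simp: comod_cat_sel compose_def intro: comodule_hom_cong[OF _ _ comodule_hom_comp, of L N M f g])
next
  case (3 M N f)
  then show ?case
    by (auto simp: comod_cat_sel compose_def restrict_def extensional_def fun_eq_iff)
next
  case (4 M N f)
  then show ?case
    by (auto simp: comod_cat_sel compose_def restrict_def extensional_def fun_eq_iff comodule_hom_def rmod_homD)
next
  case (5 W M N Z f g h)
  then show ?case
    by (auto simp: comod_cat_sel compose_def restrict_def fun_eq_iff comodule_hom_def rmod_homD)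
qed

text \<open>The transported coaction is
  \<open>(\<theta> \<otimes> X) \<circ> coact \<circ> \<theta>'\<close> with
  \<open>\<theta>'\<close> inverse to \<open>\<theta>\<close>, so \<open>\<theta>\<close> is
  colinear by construction and \<open>comodule_image\<close> supplies the axioms.\<close>

lemma
  assumes M: "coring_comodule A X M" and inj: "inj_on \<theta> (carrier M)"
  shows transport_comodule: "coring_comodule A X (transport_comod A X \<theta> M)"
    and transport_comod_hom: "\<theta> \<in> comodule_hom A X M (transport_comod A X \<theta> M)"
    and bij_betw_transport_comod: "bij_betw \<theta> (carrier M) (carrier (transport_comod A X \<theta> M))"
proof -
  let ?N = "transport_comod A X \<theta> M"
  interpret M: coring_comodule A X M by (rule M)
  have Mm: "right_module A M" by (rule M.right_module_axioms)
  have Nm: "right_module A ?N"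
    by (rule right_module_cong[OF M.transport_right_module[OF inj]]) (simp_all add: transport_comod_sel)
  have \<theta>: "\<theta> \<in> rmod_hom A M ?N"
    using M.transport_rmod_hom[OF inj] by (simp add: rmod_hom_def hom_def transport_comod_sel)
  show bij: "bij_betw \<theta> (carrier M) (carrier ?N)"
    using inj by (simp add: bij_betw_def transport_comod_sel transport_rmod_sel)
  have NX: "rmod_tensor (carrier A) (transport_rmod \<theta> M) X = TX ?N"
    by (rule rmod_tensor_cong) (simp_all add: transport_comod_sel)
  have comm: "coact ?N (\<theta> m) = tensor_map (TX ?N) \<theta> id (coact M m)"
    if "m \<in> carrier M" for m
    using that by (simp add: transport_comod_sel(5) NX inv_into_f_f[OF inj])
  have "coact ?N \<in> rmod_hom A ?N (TX ?N)"
    using rmod_hom_comp[OF rmod_hom_comp[OF M.rmod_hom_inv_into[OF \<theta> bij] M.coact_hom] tensor_map_X_hom[OF Mm Nm \<theta>]]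
    by (simp add: transport_comod_sel(5) NX)
  then show "coring_comodule A X ?N"
    by (intro comodule_image[OF M Nm \<theta> _ _ comm]) (use bij in \<open>auto simp: bij_betw_def\<close>)
  show "\<theta> \<in> comodule_hom A X M ?N"
    by (rule comodule_homI[OF \<theta> comm])
qed

end

section \<open>Comodules over the coalgebra \<open>C\<close> in Sweedler form\<close>

abbreviation k_balanced ::
  "('k, 's) ring_scheme \<Rightarrow> ('k, 'm, 'x) module_scheme \<Rightarrow> ('k, 'n, 'y) module_scheme
    \<Rightarrow> ('g, 'z) ring_scheme \<Rightarrow> ('m \<Rightarrow> 'n \<Rightarrow> 'g) \<Rightarrow> bool" where
  "k_balanced k M N \<equiv> balanced_map (carrier k) M (\<lambda>x c. c \<odot>\<^bsub>M\<^esub> x) N (\<lambda>c y. c \<odot>\<^bsub>N\<^esub> y)"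

abbreviation k_balanced3 ::
  "('k, 's) ring_scheme \<Rightarrow> ('k, 'm, 'x) module_scheme \<Rightarrow> ('k, 'n, 'y) module_scheme \<Rightarrow> ('k, 'p, 'w) module_scheme
    \<Rightarrow> ('g, 'z) ring_scheme \<Rightarrow> ('m \<Rightarrow> 'n \<Rightarrow> 'p \<Rightarrow> 'g) \<Rightarrow> bool" where
  "k_balanced3 k M N P \<equiv> balanced_map3 (carrier k) M (\<lambda>x c. c \<odot>\<^bsub>M\<^esub> x) (\<lambda>c y. c \<odot>\<^bsub>N\<^esub> y) N
     (carrier k) (\<lambda>x c. c \<odot>\<^bsub>N\<^esub> x) P (\<lambda>c y. c \<odot>\<^bsub>P\<^esub> y)"

lemma kmod_homD:
  assumes "f \<in> kmod_hom k M N"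
  shows "f \<in> additive_maps M N"
    and "x \<in> carrier M \<Longrightarrow> f x \<in> carrier N"
    and "\<lbrakk>x \<in> carrier M; y \<in> carrier M\<rbrakk> \<Longrightarrow> f (x \<oplus>\<^bsub>M\<^esub> y) = f x \<oplus>\<^bsub>N\<^esub> f y"
    and "\<lbrakk>x \<in> carrier M; c \<in> carrier k\<rbrakk> \<Longrightarrow> f (c \<odot>\<^bsub>M\<^esub> x) = c \<odot>\<^bsub>N\<^esub> f x"
  using assms by (auto simp: kmod_hom_def hom_def)

lemma
  assumes M: "module k M" and N: "module k N" and P: "module k P"
  shows kmod_assoc_products:
      "tensor_product (carrier k) M (\<lambda>x c. c \<odot>\<^bsub>M\<^esub> x) N (\<lambda>c y. c \<odot>\<^bsub>N\<^esub> y) (kmod_tensor k M N)"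
      "tensor_product (carrier k) (kmod_tensor k M N) (\<lambda>x c. c \<odot>\<^bsub>kmod_tensor k M N\<^esub> x) P (\<lambda>c y. c \<odot>\<^bsub>P\<^esub> y)
        (kmod_tensor k (kmod_tensor k M N) P)"
      "tensor_product (carrier k) N (\<lambda>x c. c \<odot>\<^bsub>N\<^esub> x) P (\<lambda>c y. c \<odot>\<^bsub>P\<^esub> y) (kmod_tensor k N P)"
      "tensor_product (carrier k) M (\<lambda>x c. c \<odot>\<^bsub>M\<^esub> x) (kmod_tensor k N P) (\<lambda>c y. c \<odot>\<^bsub>kmod_tensor k N P\<^esub> y)
        (kmod_tensor k M (kmod_tensor k N P))"
    and kmod_assoc_scalars:
      "c \<in> carrier k \<Longrightarrow> (\<lambda>t. c \<odot>\<^bsub>kmod_tensor k M N\<^esub> t) \<in> additive_maps (kmod_tensor k M N) (kmod_tensor k M N)"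
      "\<lbrakk>x \<in> carrier M; y \<in> carrier N; c \<in> carrier k\<rbrakk>
        \<Longrightarrow> c \<odot>\<^bsub>kmod_tensor k M N\<^esub> (x \<boxtimes>\<^bsub>kmod_tensor k M N\<^esub> y) = x \<boxtimes>\<^bsub>kmod_tensor k M N\<^esub> (c \<odot>\<^bsub>N\<^esub> y)"
      "c \<in> carrier k \<Longrightarrow> (\<lambda>t. c \<odot>\<^bsub>kmod_tensor k N P\<^esub> t) \<in> additive_maps (kmod_tensor k N P) (kmod_tensor k N P)"
      "\<lbrakk>y \<in> carrier N; z \<in> carrier P; c \<in> carrier k\<rbrakk>
        \<Longrightarrow> c \<odot>\<^bsub>kmod_tensor k N P\<^esub> (y \<boxtimes>\<^bsub>kmod_tensor k N P\<^esub> z) = (c \<odot>\<^bsub>N\<^esub> y) \<boxtimes>\<^bsub>kmod_tensor k N P\<^esub> z"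
  using kmod_tensor_product[OF M N] kmod_tensor_product[OF kmod_tensor_module[OF M N] P]
    kmod_tensor_product[OF N P] kmod_tensor_product[OF M kmod_tensor_module[OF N P]]
    kmod_tensor_smult_additive[OF M N] kmod_tensor_smult_pure[OF M N]
    kmod_tensor_smult_additive[OF N P] kmod_tensor_smult_pure[OF N P]
    tensor_product.pure_balanced[OF kmod_tensor_product[OF M N]]
  by simp_all

context coalgebra_comodule
begin

text \<open>The counterpart over \<open>k\<close> of \<open>comodule_coassoc\<close>, applied below
  both to \<open>A\<close> with \<open>\<rho>\<close> and to \<open>C\<close> with
  \<open>\<Delta>\<close>.\<close>

lemma
  assumes G: "abelian_group G" and f: "k_balanced3 k M C C G f"
  shows coassoc: "m \<in> carrier M \<Longrightarrow>
      tensor_lift G (\<lambda>n x. tensor_lift G (f n) (comult C x)) (\<rho> m)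
      = tensor_lift G (\<lambda>n z. tensor_lift G (\<lambda>n' y. f n' y z) (\<rho> n)) (\<rho> m)"
    and k_balanced_comult: "k_balanced k M C G (\<lambda>n x. tensor_lift G (f n) (comult C x))"
    and k_balanced_coaction: "k_balanced k M C G (\<lambda>n z. tensor_lift G (\<lambda>n' y. f n' y z) (\<rho> n))"
proof -
  have C: "module k C" by (rule k_coalgebra.axioms(1)[OF k_coalgebra_axioms])
  have M: "module k M" by (rule coalgebra_comodule.axioms(2)[OF coalgebra_comodule_axioms])
  let ?MC = "kmod_tensor k M C" and ?CC = "kmod_tensor k C C"
  interpret MC: tensor_product "carrier k" M "\<lambda>x c. c \<odot>\<^bsub>M\<^esub> x" C "\<lambda>c y. c \<odot>\<^bsub>C\<^esub> y" ?MC
    by (rule kmod_tensor_product[OF M C])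
  note tp = kmod_assoc_products[OF M C C] kmod_assoc_scalars[OF M C C]
  note left = balanced_map3_left[OF tp G f]
  note right = balanced_map3_right[OF tp G f]
  note lin\<rho> = kmod_homD(1,4)[OF coaction_hom] and lin\<Delta> = kmod_homD(1,4)[OF comult_hom]
  have "k_balanced k M C G (\<lambda>x y. tensor_lift G (f (id x)) (comult C y))"
    by (rule MC.balanced_map_comp[OF tp(4) additive_map_id _ lin\<Delta> right]) auto
  then show "k_balanced k M C G (\<lambda>n x. tensor_lift G (f n) (comult C x))"
    by simp
  have "k_balanced k M C G (\<lambda>n z. tensor_lift G (\<lambda>n' y. f n' y (id z)) (\<rho> n))"
    by (rule MC.balanced_map_comp[OF tp(2) lin\<rho> additive_map_id _ left]) auto
  then show "k_balanced k M C G (\<lambda>n z. tensor_lift G (\<lambda>n' y. f n' y z) (\<rho> n))"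
    by simp
  assume m: "m \<in> carrier M"
  have t: "\<rho> m \<in> carrier ?MC"
    by (rule kmod_homD(2)[OF coaction_hom m])
  have "tensor_lift G (\<lambda>n x. tensor_lift G (f n) (comult C x)) (\<rho> m)
      = tensor_lift G (\<lambda>n w. tensor_lift G (f n) w) (tensor_map (kmod_tensor k M ?CC) id (comult C) (\<rho> m))"
    by (subst MC.tensor_lift_tensor_map[OF tp(4) additive_map_id _ lin\<Delta> G right t]) simp_all
  also have "\<dots> = tensor_lift G (\<lambda>n w. tensor_lift G (f n) w)
      (tensor_assoc (kmod_tensor k M ?CC) ?CC (tensor_map (kmod_tensor k ?MC C) \<rho> id (\<rho> m)))"
    by (simp add: coaction_coassoc[OF m])
  also have "\<dots> = tensor_lift G (\<lambda>u z. tensor_lift G (\<lambda>n' y. f n' y z) u) (tensor_map (kmod_tensor k ?MC C) \<rho> id (\<rho> m))"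
    by (rule tensor_lift_assoc[OF tp G f])
      (auto intro!: additive_map_closed[OF MC.tensor_map_additive[OF tp(2) lin\<rho> additive_map_id] t])
  also have "\<dots> = tensor_lift G (\<lambda>n z. tensor_lift G (\<lambda>n' y. f n' y z) (\<rho> n)) (\<rho> m)"
    by (subst MC.tensor_lift_tensor_map[OF tp(2) lin\<rho> additive_map_id _ G left t]) simp_all
  finally show "tensor_lift G (\<lambda>n x. tensor_lift G (f n) (comult C x)) (\<rho> m)
      = tensor_lift G (\<lambda>n z. tensor_lift G (\<lambda>n' y. f n' y z) (\<rho> n)) (\<rho> m)" .
qed

end

text \<open>Coassociativity of \<open>C\<close> thereby becomes an instance of
  \<open>coassoc\<close>.\<close>

lemma (in k_coalgebra) regular_comodule: "coalgebra_comodule k C C (comult C)"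
  by (intro coalgebra_comodule.intro coalgebra_comodule_axioms.intro)
    (simp_all add: k_coalgebra_axioms k_coalgebra.axioms(1)[OF k_coalgebra_axioms] comult_hom comult_coassoc counit_right)

section \<open>Cleft extensions\<close>

context cleft_extension
begin

abbreviation "X \<equiv> cleft_coring k A C r"
abbreviation "g \<equiv> \<rho> \<one>\<^bsub>A\<^esub>"

lemma module_A: "module k A" and module_C: "module k C"
  by (rule k_algebra.axioms(1)[OF k_algebra_axioms]) (rule k_coalgebra.axioms(1)[OF k_coalgebra_axioms])

lemmas A_smult = module.smult_closed[OF module_A] module.smult_l_distr[OF module_A] module.smult_r_distr[OF module_A]
  module.smult_assoc1[OF module_A]
lemma abelian_group_A: "abelian_group A" and abelian_group_C: "abelian_group C"
  by (rule module.axioms(2)[OF module_A]) (rule module.axioms(2)[OF module_C])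

lemmas A_group = abelian_group.l_neg[OF abelian_group_A] abelian_group.r_neg[OF abelian_group_A] abelian_group.a_inv_closed[OF abelian_group_A]
  abelian_monoid.zero_closed[OF abelian_group.axioms(1)[OF abelian_group_A]]
  abelian_monoid.a_closed[OF abelian_group.axioms(1)[OF abelian_group_A]]
  abelian_monoid.l_zero[OF abelian_group.axioms(1)[OF abelian_group_A]]
  abelian_monoid.a_ac[OF abelian_group.axioms(1)[OF abelian_group_A]]

lemma cleft_coring_sel:
  "carrier X = carrier (kmod_tensor k A C)" "\<zero>\<^bsub>X\<^esub> = \<zero>\<^bsub>kmod_tensor k A C\<^esub>" "add X = add (kmod_tensor k A C)"
  "lact X = (\<lambda>a. tensor_map (kmod_tensor k A C) (\<lambda>b. a \<otimes>\<^bsub>A\<^esub> b) id)"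
  "ccounit X = tensor_lift A (\<lambda>a c. counit C c \<odot>\<^bsub>A\<^esub> a)"
  by (simp_all add: cleft_coring_def cleft_bimod_def Let_def)

lemma pure_X: "a \<boxtimes>\<^bsub>kmod_tensor k A C\<^esub> c = a \<boxtimes>\<^bsub>X\<^esub> c"
  by (simp add: pure_tensor_def cleft_coring_sel)

lemma additive_X: "additive_maps G X = additive_maps G (kmod_tensor k A C)"
  by (simp add: hom_def cleft_coring_sel)

text \<open>The coring itself plays the tensor product of \<open>A\<close> and \<open>C\<close> over
  \<open>k\<close>, as it shares the additive structure of \<open>kmod_tensor k A C\<close>; maps
  out of \<open>X\<close> can then be defined and compared on \<open>a \<otimes> c\<close>.\<close>

sublocale AC: tensor_product "carrier k" A "\<lambda>x c. c \<odot>\<^bsub>A\<^esub> x" C "\<lambda>c y. c \<odot>\<^bsub>C\<^esub> y" "cleft_coring k A C r"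
  using kmod_tensor_product[OF module_A module_C]
  by (simp add: tensor_product_def tensor_product_axioms_def cleft_coring_sel)

sublocale CC: tensor_product "carrier k" C "\<lambda>x c. c \<odot>\<^bsub>C\<^esub> x" C "\<lambda>c y. c \<odot>\<^bsub>C\<^esub> y" "kmod_tensor k C C"
  by (rule kmod_tensor_product[OF module_C module_C])

sublocale XX: tensor_product "carrier A" X "ract X" X "lact X" XX
  by (rule tensor_product_XX)

lemma lact_pure:
  assumes a: "a \<in> carrier A" and x: "x \<in> carrier A" "c \<in> carrier C"
  shows "a \<triangleright>\<^bsub>X\<^esub> (x \<boxtimes>\<^bsub>X\<^esub> c) = (a \<otimes>\<^bsub>A\<^esub> x) \<boxtimes>\<^bsub>X\<^esub> c"
proof -
  have "(\<lambda>b. a \<otimes>\<^bsub>A\<^esub> b) \<in> additive_maps A A"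
    using a by (intro additive_mapI) (simp_all add: A.r_distr)
  moreover have "a \<otimes>\<^bsub>A\<^esub> (s \<odot>\<^bsub>A\<^esub> x) = s \<odot>\<^bsub>A\<^esub> (a \<otimes>\<^bsub>A\<^esub> x)" if "x \<in> carrier A" "s \<in> carrier k" for x s
    using a that by (simp add: smult_mult_right)
  ultimately have "tensor_map (kmod_tensor k A C) (\<lambda>b. a \<otimes>\<^bsub>A\<^esub> b) id (x \<boxtimes>\<^bsub>X\<^esub> c) = (a \<otimes>\<^bsub>A\<^esub> x) \<boxtimes>\<^bsub>kmod_tensor k A C\<^esub> id c"
    by (intro AC.tensor_map_pure[OF kmod_tensor_product[OF module_A module_C] _ _ additive_map_id]) (simp_all add: x)
  then show ?thesis
    by (simp add: cleft_coring_sel pure_X)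
qed

lemma \<rho>_hom: "\<rho> \<in> rmod_hom A (regular_bimod A) X"
  by (rule coaction_right_linear)

lemma
  shows \<rho>_additive: "\<rho> \<in> additive_maps A X"
    and \<rho>_closed: "a \<in> carrier A \<Longrightarrow> \<rho> a \<in> carrier X"
    and \<rho>_mult: "\<lbrakk>a \<in> carrier A; b \<in> carrier A\<rbrakk> \<Longrightarrow> \<rho> (a \<otimes>\<^bsub>A\<^esub> b) = \<rho> a \<triangleleft>\<^bsub>X\<^esub> b"
  using rmod_homD[OF \<rho>_hom] by (simp_all add: regular_bimod_def hom_def)

lemma g_closed: "g \<in> carrier X"
  by (simp add: \<rho>_closed)

lemma \<rho>_eq: "a \<in> carrier A \<Longrightarrow> \<rho> a = g \<triangleleft>\<^bsub>X\<^esub> a"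
  using \<rho>_mult[of "\<one>\<^bsub>A\<^esub>" a] by simp

text \<open>One test element suffices: \<open>a = 1\<close> gives one direction, and right linearity
  of \<open>\<rho>\<close> the other, as \<open>\<rho> (b a) = (b g) a = b (g a)\<close>.\<close>

lemma B_iff: "b \<in> B \<longleftrightarrow> b \<in> carrier A \<and> \<rho> b = b \<triangleright>\<^bsub>X\<^esub> g"
proof
  assume "b \<in> B"
  then have "b \<in> carrier A" "\<rho> (b \<otimes>\<^bsub>A\<^esub> \<one>\<^bsub>A\<^esub>) = b \<triangleright>\<^bsub>X\<^esub> g"
    using A.one_closed unfolding B_eq coinvariants_def cleft_coring_sel by blast+
  then show "b \<in> carrier A \<and> \<rho> b = b \<triangleright>\<^bsub>X\<^esub> g"
    by simp
next
  assume b: "b \<in> carrier A \<and> \<rho> b = b \<triangleright>\<^bsub>X\<^esub> g"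
  then have "\<rho> (b \<otimes>\<^bsub>A\<^esub> a) = b \<triangleright>\<^bsub>X\<^esub> \<rho> a" if "a \<in> carrier A" for a
    using that by (simp add: \<rho>_mult \<rho>_eq[of a] X.lact_ract g_closed)
  then show "b \<in> B"
    using b by (simp add: B_eq coinvariants_def cleft_coring_sel)
qed

lemma B_subset: "B \<subseteq> carrier A"
  by (auto simp: B_iff)

lemma \<rho>_B: "\<lbrakk>b \<in> B; a \<in> carrier A\<rbrakk> \<Longrightarrow> \<rho> (b \<otimes>\<^bsub>A\<^esub> a) = b \<triangleright>\<^bsub>X\<^esub> \<rho> a"
  by (simp add: B_iff \<rho>_mult \<rho>_eq[of a] X.lact_ract g_closed)

lemma
  shows B_zero: "\<zero>\<^bsub>A\<^esub> \<in> B" and B_one: "\<one>\<^bsub>A\<^esub> \<in> B"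
    and B_add: "\<lbrakk>a \<in> B; b \<in> B\<rbrakk> \<Longrightarrow> a \<oplus>\<^bsub>A\<^esub> b \<in> B"
    and B_uminus: "a \<in> B \<Longrightarrow> \<ominus>\<^bsub>A\<^esub> a \<in> B"
    and B_mult: "\<lbrakk>a \<in> B; b \<in> B\<rbrakk> \<Longrightarrow> a \<otimes>\<^bsub>A\<^esub> b \<in> B"
proof -
  have lact_zero: "\<zero>\<^bsub>A\<^esub> \<triangleright>\<^bsub>X\<^esub> x = \<zero>\<^bsub>X\<^esub>" if "x \<in> carrier X" for x
    using X.lact_add_left[OF that A_group(4) A_group(4)] X.lact_closed[OF that A_group(4)]
    by (simp add: A_group)
  show zero: "\<zero>\<^bsub>A\<^esub> \<in> B"
    using additive_map_zero[OF abelian_group_A X.abelian_group_axioms \<rho>_additive]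
    by (simp add: B_iff lact_zero g_closed A_group)
  show "\<one>\<^bsub>A\<^esub> \<in> B"
    by (simp add: B_iff X.lact_one g_closed)
  show add: "a \<oplus>\<^bsub>A\<^esub> b \<in> B" if "a \<in> B" "b \<in> B" for a b
    using that by (simp add: B_iff A_group additive_map_add[OF \<rho>_additive] X.lact_add_left g_closed)
  show "a \<otimes>\<^bsub>A\<^esub> b \<in> B" if "a \<in> B" "b \<in> B"
    using that \<rho>_B[of a b] by (simp add: B_iff X.lact_mult g_closed)
  show "\<ominus>\<^bsub>A\<^esub> a \<in> B" if a: "a \<in> B"
  proof -
    have aA: "a \<in> carrier A" "\<ominus>\<^bsub>A\<^esub> a \<in> carrier A" using a by (simp_all add: B_iff A_group)
    have "\<rho> (\<ominus>\<^bsub>A\<^esub> a) \<oplus>\<^bsub>X\<^esub> \<rho> a = \<zero>\<^bsub>X\<^esub>"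
      using aA zero by (simp add: A_group B_iff lact_zero g_closed flip: additive_map_add[OF \<rho>_additive])
    moreover have "(\<ominus>\<^bsub>A\<^esub> a) \<triangleright>\<^bsub>X\<^esub> g \<oplus>\<^bsub>X\<^esub> a \<triangleright>\<^bsub>X\<^esub> g = \<zero>\<^bsub>X\<^esub>"
      using aA by (simp add: A_group lact_zero g_closed flip: X.lact_add_left)
    ultimately show ?thesis
      using a aA X.add.right_cancel[of "a \<triangleright>\<^bsub>X\<^esub> g" "\<rho> (\<ominus>\<^bsub>A\<^esub> a)" "(\<ominus>\<^bsub>A\<^esub> a) \<triangleright>\<^bsub>X\<^esub> g"]
      by (simp add: B_iff \<rho>_closed X.lact_closed g_closed)
  qed
qed

lemma ring_B: "ring (A\<lparr>carrier := B\<rparr>)"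
proof -
  have cl: "b \<in> carrier A" if "b \<in> B" for b using that B_subset by blast
  have "\<exists>y\<in>B. y \<oplus>\<^bsub>A\<^esub> x = \<zero>\<^bsub>A\<^esub>" if "x \<in> B" for x
    using that by (intro bexI[of _ "\<ominus>\<^bsub>A\<^esub> x"]) (simp_all add: B_uminus A_group cl)
  then show ?thesis
    by (intro ringI abelian_groupI monoidI)
      (auto simp: B_zero B_one B_add B_mult A_group A.m_assoc A.l_distr A.r_distr cl)
qed

text \<open>The action of \<open>s\<close> on \<open>X\<close> is multiplication by
  \<open>s 1\<close> from either side, by \<open>k_central\<close>. In this guise a scalar can be
  moved across a tensor sign over \<open>A\<close>.\<close>

lemma scalar_central:
  assumes "s \<in> carrier k" "x \<in> carrier A" "c \<in> carrier C"
  shows "(s \<odot>\<^bsub>A\<^esub> \<one>\<^bsub>A\<^esub>) \<triangleright>\<^bsub>X\<^esub> (x \<boxtimes>\<^bsub>X\<^esub> c) = (s \<odot>\<^bsub>A\<^esub> x) \<boxtimes>\<^bsub>X\<^esub> c"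
    "(x \<boxtimes>\<^bsub>X\<^esub> c) \<triangleleft>\<^bsub>X\<^esub> (s \<odot>\<^bsub>A\<^esub> \<one>\<^bsub>A\<^esub>) = (s \<odot>\<^bsub>A\<^esub> x) \<boxtimes>\<^bsub>X\<^esub> c"
    "x \<boxtimes>\<^bsub>X\<^esub> (s \<odot>\<^bsub>C\<^esub> c) = (s \<odot>\<^bsub>A\<^esub> x) \<boxtimes>\<^bsub>X\<^esub> c"
proof -
  show 1: "(s \<odot>\<^bsub>A\<^esub> \<one>\<^bsub>A\<^esub>) \<triangleright>\<^bsub>X\<^esub> (x \<boxtimes>\<^bsub>X\<^esub> c) = (s \<odot>\<^bsub>A\<^esub> x) \<boxtimes>\<^bsub>X\<^esub> c"
    using assms by (simp add: lact_pure A_smult smult_mult_left)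
  show "(x \<boxtimes>\<^bsub>X\<^esub> c) \<triangleleft>\<^bsub>X\<^esub> (s \<odot>\<^bsub>A\<^esub> \<one>\<^bsub>A\<^esub>) = (s \<odot>\<^bsub>A\<^esub> x) \<boxtimes>\<^bsub>X\<^esub> c"
    using k_central[OF assms(1) AC.pure_closed[OF assms(2,3)]] 1 by simp
  show "x \<boxtimes>\<^bsub>X\<^esub> (s \<odot>\<^bsub>C\<^esub> c) = (s \<odot>\<^bsub>A\<^esub> x) \<boxtimes>\<^bsub>X\<^esub> c"
    using AC.pure_balanced[OF assms(2,1,3)] by simp
qed

end

lemma balanced_map3D:
  assumes "balanced_map3 S M ra la N S' ra' P la' G f"
  shows "\<lbrakk>x \<in> carrier M; y \<in> carrier N; z \<in> carrier P\<rbrakk> \<Longrightarrow> f x y z \<in> carrier G"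
    and "\<lbrakk>x \<in> carrier M; x' \<in> carrier M; y \<in> carrier N; z \<in> carrier P\<rbrakk>
      \<Longrightarrow> f (x \<oplus>\<^bsub>M\<^esub> x') y z = f x y z \<oplus>\<^bsub>G\<^esub> f x' y z"
    and "\<lbrakk>x \<in> carrier M; y \<in> carrier N; y' \<in> carrier N; z \<in> carrier P\<rbrakk>
      \<Longrightarrow> f x (y \<oplus>\<^bsub>N\<^esub> y') z = f x y z \<oplus>\<^bsub>G\<^esub> f x y' z"
    and "\<lbrakk>x \<in> carrier M; y \<in> carrier N; z \<in> carrier P; z' \<in> carrier P\<rbrakk>
      \<Longrightarrow> f x y (z \<oplus>\<^bsub>P\<^esub> z') = f x y z \<oplus>\<^bsub>G\<^esub> f x y z'"
    and "\<lbrakk>x \<in> carrier M; s \<in> S; y \<in> carrier N; z \<in> carrier P\<rbrakk> \<Longrightarrow> f (ra x s) y z = f x (la s y) z"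
    and "\<lbrakk>x \<in> carrier M; y \<in> carrier N; s \<in> S'; z \<in> carrier P\<rbrakk> \<Longrightarrow> f x (ra' y s) z = f x y (la' s z)"
    and "z \<in> carrier P \<Longrightarrow> balanced_map S M ra N la G (\<lambda>x y. f x y z)"
    and "x \<in> carrier M \<Longrightarrow> balanced_map S' N ra' P la' G (f x)"
  using assms by (auto simp: balanced_map3_def balanced_map_def hom_def)

lemma k_balanced3_comp:
  assumes "k_balanced3 k M N P G f" and "h \<in> kmod_hom k L M"
  shows "k_balanced3 k L N P G (\<lambda>x. f (h x))"
  using balanced_map3D(1-6)[OF assms(1)]
  by (intro balanced_map3I) (simp_all add: kmod_homD[OF assms(2)])

section \<open>Counit and coproduct of the coring, and the grouplike element\<close>

context cleft_extension
begin

lemma cring_k: "cring k"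
  by (rule module.axioms(1)[OF module_A])

lemma
  shows counit_closed: "c \<in> carrier C \<Longrightarrow> counit C c \<in> carrier k"
    and counit_add: "\<lbrakk>c \<in> carrier C; d \<in> carrier C\<rbrakk> \<Longrightarrow> counit C (c \<oplus>\<^bsub>C\<^esub> d) = counit C c \<oplus>\<^bsub>k\<^esub> counit C d"
    and counit_smult: "\<lbrakk>c \<in> carrier C; s \<in> carrier k\<rbrakk> \<Longrightarrow> counit C (s \<odot>\<^bsub>C\<^esub> c) = s \<otimes>\<^bsub>k\<^esub> counit C c"
  using kmod_homD[OF counit_hom] by (simp_all add: regular_kmod_def)

lemma smult_swap:
  assumes "module k M" "s \<in> carrier k" "t \<in> carrier k" "x \<in> carrier M"
  shows "(s \<otimes>\<^bsub>k\<^esub> t) \<odot>\<^bsub>M\<^esub> x = t \<odot>\<^bsub>M\<^esub> (s \<odot>\<^bsub>M\<^esub> x)"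
proof -
  have "s \<otimes>\<^bsub>k\<^esub> t = t \<otimes>\<^bsub>k\<^esub> s"
    using comm_monoid.m_comm[OF cring.axioms(2)[OF cring_k]] assms by simp
  then show ?thesis
    using assms by (simp add: module.smult_assoc1)
qed

lemma
  assumes M: "module k M"
  shows k_balanced_counit_right: "k_balanced k M C M (\<lambda>x c. counit C c \<odot>\<^bsub>M\<^esub> x)"
    and k_balanced_counit_left: "k_balanced k C M M (\<lambda>c x. counit C c \<odot>\<^bsub>M\<^esub> x)"
proof -
  interpret M: module k M by (rule M)
  show "k_balanced k M C M (\<lambda>x c. counit C c \<odot>\<^bsub>M\<^esub> x)"
    by (intro balanced_mapI)
      (simp_all add: counit_closed counit_add counit_smult M.smult_r_distr M.smult_l_distr smult_swap[OF M])
  show "k_balanced k C M M (\<lambda>c x. counit C c \<odot>\<^bsub>M\<^esub> x)"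
    by (intro balanced_mapI)
      (simp_all add: counit_closed counit_add counit_smult M.smult_r_distr M.smult_l_distr smult_swap[OF M])
qed

lemma comult_closed: "c \<in> carrier C \<Longrightarrow> comult C c \<in> carrier (kmod_tensor k C C)"
  by (rule kmod_homD(2)[OF comult_hom])

lemma C_comodule: "coalgebra_comodule k C C (comult C)"
  by (rule regular_comodule)

text \<open>The left \<open>A\<close>-linear extension of \<open>f\<close>, under the correspondence
  between left \<open>A\<close>-linear maps from \<open>A \<otimes> C\<close> to \<open>A\<close>
  and \<open>k\<close>-linear maps from \<open>C\<close> to \<open>A\<close>.\<close>

definition left_ext :: "('c \<Rightarrow> 'a) \<Rightarrow> ('a, 'c) tensors \<Rightarrow> 'a" where
  "left_ext f = tensor_lift A (\<lambda>a c. a \<otimes>\<^bsub>A\<^esub> f c)"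

lemma
  assumes f: "f \<in> kmod_hom k C A"
  shows left_ext_additive: "left_ext f \<in> additive_maps X A"
    and left_ext_pure: "\<lbrakk>a \<in> carrier A; c \<in> carrier C\<rbrakk> \<Longrightarrow> left_ext f (a \<boxtimes>\<^bsub>X\<^esub> c) = a \<otimes>\<^bsub>A\<^esub> f c"
    and left_ext_closed: "x \<in> carrier X \<Longrightarrow> left_ext f x \<in> carrier A"
    and left_ext_lact: "\<lbrakk>a \<in> carrier A; x \<in> carrier X\<rbrakk> \<Longrightarrow> left_ext f (a \<triangleright>\<^bsub>X\<^esub> x) = a \<otimes>\<^bsub>A\<^esub> left_ext f x"
proof -
  have bal: "k_balanced k A C A (\<lambda>a c. a \<otimes>\<^bsub>A\<^esub> f c)"
    by (intro balanced_mapI)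
      (simp_all add: kmod_homD[OF f] A.l_distr A.r_distr smult_mult_left smult_mult_right)
  show add: "left_ext f \<in> additive_maps X A"
    unfolding left_ext_def by (rule AC.tensor_lift_additive[OF abelian_group_A bal])
  then show "x \<in> carrier X \<Longrightarrow> left_ext f x \<in> carrier A"
    by (rule additive_map_closed)
  show pure: "left_ext f (a \<boxtimes>\<^bsub>X\<^esub> c) = a \<otimes>\<^bsub>A\<^esub> f c" if "a \<in> carrier A" "c \<in> carrier C" for a c
    unfolding left_ext_def using that by (rule AC.tensor_lift_pure[OF abelian_group_A bal])
  show "left_ext f (a \<triangleright>\<^bsub>X\<^esub> x) = a \<otimes>\<^bsub>A\<^esub> left_ext f x" if a: "a \<in> carrier A" and x: "x \<in> carrier X"
  proof -
    have "(\<lambda>b. a \<otimes>\<^bsub>A\<^esub> b) \<in> additive_maps A A"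
      using a by (intro additive_mapI) (simp_all add: A.r_distr)
    from additive_map_comp[OF X.additive_lact[OF a] add] additive_map_comp[OF add this] x
    show ?thesis
      by (rule AC.additive_map_eqI) (use a in \<open>simp add: lact_pure pure A.m_assoc kmod_homD(2)[OF f]\<close>)
  qed
qed

lemma ccounit_pure: "\<lbrakk>a \<in> carrier A; c \<in> carrier C\<rbrakk> \<Longrightarrow> ccounit X (a \<boxtimes>\<^bsub>X\<^esub> c) = counit C c \<odot>\<^bsub>A\<^esub> a"
  unfolding cleft_coring_sel by (rule AC.tensor_lift_pure[OF abelian_group_A k_balanced_counit_right[OF module_A]])

lemma ccounit_\<rho>: "a \<in> carrier A \<Longrightarrow> ccounit X (\<rho> a) = a"
  unfolding cleft_coring_sel by (rule coaction_counit)

text \<open>The critical condition moves \<open>s\<close> from the first copy of \<open>C\<close> to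
  the second, across a tensor sign over \<open>A\<close>: it travels as the central element
  \<open>s 1\<close>.\<close>

lemma comult_balanced: "k_balanced3 k A C C XX (\<lambda>a c c'. (a \<boxtimes>\<^bsub>X\<^esub> c) \<boxtimes>\<^bsub>XX\<^esub> (\<one>\<^bsub>A\<^esub> \<boxtimes>\<^bsub>X\<^esub> c'))"
proof (rule balanced_map3I)
  fix x y s z assume *: "x \<in> carrier A" "y \<in> carrier C" "s \<in> carrier k" "z \<in> carrier C"
  have "(x \<boxtimes>\<^bsub>X\<^esub> y) \<boxtimes>\<^bsub>XX\<^esub> (\<one>\<^bsub>A\<^esub> \<boxtimes>\<^bsub>X\<^esub> (s \<odot>\<^bsub>C\<^esub> z))
      = (x \<boxtimes>\<^bsub>X\<^esub> y) \<boxtimes>\<^bsub>XX\<^esub> ((s \<odot>\<^bsub>A\<^esub> \<one>\<^bsub>A\<^esub>) \<triangleright>\<^bsub>X\<^esub> (\<one>\<^bsub>A\<^esub> \<boxtimes>\<^bsub>X\<^esub> z))"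
    using * by (simp add: scalar_central)
  also have "\<dots> = ((x \<boxtimes>\<^bsub>X\<^esub> y) \<triangleleft>\<^bsub>X\<^esub> (s \<odot>\<^bsub>A\<^esub> \<one>\<^bsub>A\<^esub>)) \<boxtimes>\<^bsub>XX\<^esub> (\<one>\<^bsub>A\<^esub> \<boxtimes>\<^bsub>X\<^esub> z)"
    using * by (simp add: XX.pure_balanced AC.pure_closed A_smult)
  also have "\<dots> = (x \<boxtimes>\<^bsub>X\<^esub> (s \<odot>\<^bsub>C\<^esub> y)) \<boxtimes>\<^bsub>XX\<^esub> (\<one>\<^bsub>A\<^esub> \<boxtimes>\<^bsub>X\<^esub> z)"
    using * by (simp add: scalar_central)
  finally show "(x \<boxtimes>\<^bsub>X\<^esub> (s \<odot>\<^bsub>C\<^esub> y)) \<boxtimes>\<^bsub>XX\<^esub> (\<one>\<^bsub>A\<^esub> \<boxtimes>\<^bsub>X\<^esub> z)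
      = (x \<boxtimes>\<^bsub>X\<^esub> y) \<boxtimes>\<^bsub>XX\<^esub> (\<one>\<^bsub>A\<^esub> \<boxtimes>\<^bsub>X\<^esub> (s \<odot>\<^bsub>C\<^esub> z))" by simp
qed (simp_all add: XX.pure_closed AC.pure_closed AC.pure_add_left AC.pure_add_right XX.pure_add_left
    XX.pure_add_right AC.pure_balanced)

text \<open>\<open>cleft_coring\<close> phrases its coproduct over \<open>cleft_bimod\<close>. The
  pure tensors and the tensor square agree with those of \<open>X\<close>, so the formula may be
  read over \<open>X\<close>.\<close>

lemma ccomult_eq: "ccomult X = tensor_lift XX (\<lambda>a c. tensor_lift XX
    (\<lambda>c' c''. (a \<boxtimes>\<^bsub>X\<^esub> c') \<boxtimes>\<^bsub>XX\<^esub> (\<one>\<^bsub>A\<^esub> \<boxtimes>\<^bsub>X\<^esub> c'')) (comult C c))"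
proof -
  have 1: "a \<boxtimes>\<^bsub>cleft_bimod k A C r\<^esub> c = a \<boxtimes>\<^bsub>X\<^esub> c" for a c
    by (simp add: pure_tensor_def cleft_coring_def Let_def)
  have 2: "bimod_tensor (carrier A) (cleft_bimod k A C r) (cleft_bimod k A C r) = XX"
    by (simp add: bimod_tensor_def rmod_tensor_def tensor_def tensor_relators_def cleft_coring_def Let_def)
  have "ccomult X = (let X = cleft_bimod k A C r; XX = bimod_tensor (carrier A) X X
      in tensor_lift XX (\<lambda>a c. tensor_lift XX
            (\<lambda>c' c''. (a \<boxtimes>\<^bsub>X\<^esub> c') \<boxtimes>\<^bsub>XX\<^esub> (\<one>\<^bsub>A\<^esub> \<boxtimes>\<^bsub>X\<^esub> c'')) (comult C c)))"
    by (simp add: cleft_coring_def Let_def)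
  then show ?thesis
    by (simp add: Let_def 1 2)
qed

lemma ccomult_pure:
  assumes "a \<in> carrier A" "c \<in> carrier C"
  shows "ccomult X (a \<boxtimes>\<^bsub>X\<^esub> c)
    = tensor_lift XX (\<lambda>c' c''. (a \<boxtimes>\<^bsub>X\<^esub> c') \<boxtimes>\<^bsub>XX\<^esub> (\<one>\<^bsub>A\<^esub> \<boxtimes>\<^bsub>X\<^esub> c'')) (comult C c)"
  unfolding ccomult_eq
  by (rule AC.tensor_lift_pure[OF XX.abelian_group_T k_balanced_comult[OF XX.abelian_group_T comult_balanced] assms])

lemma pure_lift: "t \<in> carrier X \<Longrightarrow> tensor_lift X (\<lambda>a c. a \<boxtimes>\<^bsub>X\<^esub> c) t = t"
  using AC.tensor_lift_unique[OF AC.abelian_group_T AC.pure_balanced_map additive_map_id, of t] by simp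

text \<open>Coassociativity of \<open>\<rho>\<close> turns the left side into
  \<open>\<rho> (a0) \<otimes> (1 \<otimes> a1)\<close>, and in \<open>\<rho> (a0) = g a0\<close>
  the factor \<open>a0\<close> crosses the tensor sign. For \<open>a = 1\<close> this says that
  \<open>g\<close> is grouplike; in general it makes the induced coaction coassociative.\<close>

lemma ccomult_\<rho>:
  assumes a: "a \<in> carrier A"
  shows "ccomult X (\<rho> a) = g \<boxtimes>\<^bsub>XX\<^esub> \<rho> a"
proof -
  note G = XX.abelian_group_T
  let ?f = "\<lambda>a c c'. (a \<boxtimes>\<^bsub>X\<^esub> c) \<boxtimes>\<^bsub>XX\<^esub> (\<one>\<^bsub>A\<^esub> \<boxtimes>\<^bsub>X\<^esub> c')"
  have inner: "tensor_lift XX (\<lambda>x y. ?f x y z) (\<rho> b) = g \<boxtimes>\<^bsub>XX\<^esub> (b \<boxtimes>\<^bsub>X\<^esub> z)"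
    if b: "b \<in> carrier A" and z: "z \<in> carrier C" for b z
  proof -
    have e: "\<one>\<^bsub>A\<^esub> \<boxtimes>\<^bsub>X\<^esub> z \<in> carrier X"
      using z by (simp add: AC.pure_closed)
    have "(\<lambda>t. t \<boxtimes>\<^bsub>XX\<^esub> (\<one>\<^bsub>A\<^esub> \<boxtimes>\<^bsub>X\<^esub> z)) \<in> additive_maps X XX"
      using e by (intro additive_mapI) (simp_all add: XX.pure_closed XX.pure_add_left)
    from AC.additive_map_tensor_lift[OF AC.abelian_group_T G AC.pure_balanced_map this \<rho>_closed[OF b]]
    have "tensor_lift XX (\<lambda>x y. ?f x y z) (\<rho> b) = \<rho> b \<boxtimes>\<^bsub>XX\<^esub> (\<one>\<^bsub>A\<^esub> \<boxtimes>\<^bsub>X\<^esub> z)"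
      by (simp add: pure_lift \<rho>_closed b)
    also have "\<dots> = g \<boxtimes>\<^bsub>XX\<^esub> (b \<boxtimes>\<^bsub>X\<^esub> z)"
      using b z e by (simp add: \<rho>_eq[of b] XX.pure_balanced g_closed lact_pure)
    finally show ?thesis .
  qed
  have "ccomult X (\<rho> a) = tensor_lift XX (\<lambda>b z. tensor_lift XX (\<lambda>x y. ?f x y z) (\<rho> b)) (\<rho> a)"
    unfolding ccomult_eq by (rule coassoc[OF G comult_balanced a])
  also have "\<dots> = tensor_lift XX (\<lambda>b z. g \<boxtimes>\<^bsub>XX\<^esub> (b \<boxtimes>\<^bsub>X\<^esub> z)) (\<rho> a)"
    by (rule AC.tensor_lift_cong[OF G k_balanced_coaction[OF G comult_balanced] \<rho>_closed[OF a] inner])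
  also have "\<dots> = g \<boxtimes>\<^bsub>XX\<^esub> tensor_lift X (\<lambda>b z. b \<boxtimes>\<^bsub>X\<^esub> z) (\<rho> a)"
    by (rule AC.additive_map_tensor_lift[OF AC.abelian_group_T G AC.pure_balanced_map _ \<rho>_closed[OF a], symmetric])
      (intro additive_mapI; simp add: XX.pure_closed XX.pure_add_right g_closed)
  finally show ?thesis
    by (simp add: pure_lift \<rho>_closed a)
qed

end

section \<open>Identities for the cleaving map \<open>j\<close> and its convolution inverse
  \<open>i\<close>\<close>

locale cleaving = cleft_extension k A C \<rho> B r
  for k (structure) and A (structure) and C :: "('k, 'c, 'z) coalg_scheme" (structure)
    and \<rho> :: "'a \<Rightarrow> ('a, 'c) tensors" and B :: "'a set"
    and r :: "('a, 'c) tensors \<Rightarrow> 'a \<Rightarrow> ('a, 'c) tensors" +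
  fixes j i :: "'c \<Rightarrow> 'a"
  assumes j_comodule_hom: "j \<in> coalgebra_comodule_hom k C C (comult C) A \<rho>"
    and i_hom: "i \<in> kmod_hom k C A"
    and conv_j_i: "c \<in> carrier C \<Longrightarrow> convolution C A j i c = counit C c \<odot>\<^bsub>A\<^esub> \<one>\<^bsub>A\<^esub>"
    and conv_i_j: "c \<in> carrier C \<Longrightarrow> convolution C A i j c = counit C c \<odot>\<^bsub>A\<^esub> \<one>\<^bsub>A\<^esub>"
begin

lemma j_hom: "j \<in> kmod_hom k C A"
  using j_comodule_hom by (simp add: coalgebra_comodule_hom_def)

lemmas j = kmod_homD[OF j_hom] and i = kmod_homD[OF i_hom]

lemma conv_balanced:
  assumes f: "f \<in> kmod_hom k C A" and f': "f' \<in> kmod_hom k C A"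
  shows "k_balanced k C C A (\<lambda>x y. f x \<otimes>\<^bsub>A\<^esub> f' y)"
  by (intro balanced_mapI)
    (simp_all add: kmod_homD[OF f] kmod_homD[OF f'] A.l_distr A.r_distr smult_mult_left smult_mult_right)

lemma j_pure_balanced: "k_balanced k C C X (\<lambda>x y. j x \<boxtimes>\<^bsub>X\<^esub> y)"
  by (intro balanced_mapI)
    (simp_all add: j AC.pure_closed AC.pure_add_left AC.pure_add_right AC.pure_balanced)

text \<open>Colinearity of \<open>j\<close>, with \<open>j \<otimes> id\<close> rewritten as a lift
  so that it can be fed into coassociativity.\<close>

lemma \<rho>_j:
  assumes c: "c \<in> carrier C"
  shows "\<rho> (j c) = tensor_lift X (\<lambda>x y. j x \<boxtimes>\<^bsub>X\<^esub> y) (comult C c)"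
proof -
  note AC' = kmod_tensor_product[OF module_A module_C]
  have "tensor_map (kmod_tensor k A C) j id \<in> additive_maps (kmod_tensor k C C) X"
    unfolding additive_X by (rule CC.tensor_map_additive[OF AC' j(1,4) additive_map_id]) auto
  moreover have "tensor_map (kmod_tensor k A C) j id (x \<boxtimes>\<^bsub>kmod_tensor k C C\<^esub> y) = j x \<boxtimes>\<^bsub>X\<^esub> y"
    if "x \<in> carrier C" "y \<in> carrier C" for x y
    using CC.tensor_map_pure[OF AC' j(1,4) additive_map_id _ that] by (simp add: pure_X)
  ultimately have "tensor_map (kmod_tensor k A C) j id (comult C c) = tensor_lift X (\<lambda>x y. j x \<boxtimes>\<^bsub>X\<^esub> y) (comult C c)"
    by (intro CC.tensor_lift_unique[OF AC.abelian_group_T j_pure_balanced _ comult_closed[OF c]])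
  then show ?thesis
    using j_comodule_hom c by (simp add: coalgebra_comodule_hom_def)
qed

lemma i_balanced: "k_balanced3 k A C C X (\<lambda>a y z. (a \<boxtimes>\<^bsub>X\<^esub> y) \<triangleleft>\<^bsub>X\<^esub> i z)"
proof (rule balanced_map3I)
  fix x y s z assume *: "x \<in> carrier A" "y \<in> carrier C" "s \<in> carrier k" "z \<in> carrier C"
  \<comment> \<open>Written as \<open>(s 1) i(z)\<close>, the scalar acts on \<open>X\<close> from
    the right before \<open>i z\<close> does, where \<open>scalar_central\<close> applies.\<close>
  have "i (s \<odot>\<^bsub>C\<^esub> z) = (s \<odot>\<^bsub>A\<^esub> \<one>\<^bsub>A\<^esub>) \<otimes>\<^bsub>A\<^esub> i z"
    using * by (simp add: i smult_mult_left)
  then show "(x \<boxtimes>\<^bsub>X\<^esub> (s \<odot>\<^bsub>C\<^esub> y)) \<triangleleft>\<^bsub>X\<^esub> i z = (x \<boxtimes>\<^bsub>X\<^esub> y) \<triangleleft>\<^bsub>X\<^esub> i (s \<odot>\<^bsub>C\<^esub> z)"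
    using * by (simp add: X.ract_mult AC.pure_closed i A_smult scalar_central)
qed (simp_all add: AC.pure_closed AC.pure_add_left AC.pure_add_right AC.pure_balanced
    X.ract_closed X.ract_add_left X.ract_add_right i)

text \<open>In Sweedler notation \<open>(1 \<otimes> c1) i(c2)\<close>. For an abstract right action
  this has no direct evaluation; \<open>L_eq\<close> determines it.\<close>

definition L :: "'c \<Rightarrow> ('a, 'c) tensors" where
  "L c = tensor_lift X (\<lambda>y z. (\<one>\<^bsub>A\<^esub> \<boxtimes>\<^bsub>X\<^esub> y) \<triangleleft>\<^bsub>X\<^esub> i z) (comult C c)"

text \<open>The left and right actions on \<open>X\<close> commute, so \<open>a\<close> can be
  pulled out of the lift.\<close>

lemma L_lact:
  assumes "a \<in> carrier A" "c \<in> carrier C"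
  shows "tensor_lift X (\<lambda>y z. (a \<boxtimes>\<^bsub>X\<^esub> y) \<triangleleft>\<^bsub>X\<^esub> i z) (comult C c) = a \<triangleright>\<^bsub>X\<^esub> L c"
proof -
  have "a \<triangleright>\<^bsub>X\<^esub> L c = tensor_lift X (\<lambda>y z. a \<triangleright>\<^bsub>X\<^esub> ((\<one>\<^bsub>A\<^esub> \<boxtimes>\<^bsub>X\<^esub> y) \<triangleleft>\<^bsub>X\<^esub> i z)) (comult C c)"
    unfolding L_def
    by (rule CC.additive_map_tensor_lift[OF AC.abelian_group_T AC.abelian_group_T
          balanced_map3D(8)[OF i_balanced A.one_closed] X.additive_lact[OF assms(1)] comult_closed[OF assms(2)]])
  also have "\<dots> = tensor_lift X (\<lambda>y z. (a \<boxtimes>\<^bsub>X\<^esub> y) \<triangleleft>\<^bsub>X\<^esub> i z) (comult C c)"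
    by (rule CC.tensor_lift_cong[symmetric, OF AC.abelian_group_T balanced_map3D(8)[OF i_balanced assms(1)] comult_closed[OF assms(2)]])
      (use assms in \<open>simp add: AC.pure_closed lact_pure i flip: X.lact_ract\<close>)
  finally show ?thesis by simp
qed

lemma
  shows L_additive: "L \<in> additive_maps C X"
    and L_closed: "c \<in> carrier C \<Longrightarrow> L c \<in> carrier X"
    and L_smult: "\<lbrakk>s \<in> carrier k; c \<in> carrier C\<rbrakk> \<Longrightarrow> L (s \<odot>\<^bsub>C\<^esub> c) = (s \<odot>\<^bsub>A\<^esub> \<one>\<^bsub>A\<^esub>) \<triangleright>\<^bsub>X\<^esub> L c"
proof -
  note bal = k_balanced_comult[OF AC.abelian_group_T i_balanced]
  show "L \<in> additive_maps C X"
    using bal A.one_closed unfolding balanced_map_def L_def by blast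
  then show "c \<in> carrier C \<Longrightarrow> L c \<in> carrier X"
    by (rule additive_map_closed)
  show "\<lbrakk>s \<in> carrier k; c \<in> carrier C\<rbrakk> \<Longrightarrow> L (s \<odot>\<^bsub>C\<^esub> c) = (s \<odot>\<^bsub>A\<^esub> \<one>\<^bsub>A\<^esub>) \<triangleright>\<^bsub>X\<^esub> L c"
    using balanced_mapD(4)[OF bal A.one_closed] by (simp add: L_lact A_smult flip: L_def)
qed

text \<open>By coassociativity the left side is \<open>(j(c1) \<otimes> c2) i(c3)\<close>.
  Colinearity of \<open>j\<close> makes this
  \<open>\<rho> (j(c1)) i(c2) = g j(c1) i(c2) = g \<epsilon>(c)\<close>, and the scalar is
  central.\<close>

lemma j_L:
  assumes c: "c \<in> carrier C"
  shows "tensor_lift X (\<lambda>x y. j x \<triangleright>\<^bsub>X\<^esub> L y) (comult C c) = (counit C c \<odot>\<^bsub>A\<^esub> \<one>\<^bsub>A\<^esub>) \<triangleright>\<^bsub>X\<^esub> g"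
proof -
  note G = AC.abelian_group_T
  note cc = comult_closed[OF c]
  let ?f = "\<lambda>x y z. (j x \<boxtimes>\<^bsub>X\<^esub> y) \<triangleleft>\<^bsub>X\<^esub> i z"
  have f: "k_balanced3 k C C C X ?f"
    by (rule k_balanced3_comp[OF i_balanced j_hom])
  note C_coassoc = coalgebra_comodule.coassoc[OF C_comodule G f c]
    and C_bal = coalgebra_comodule.k_balanced_comult[OF C_comodule G f]
      coalgebra_comodule.k_balanced_coaction[OF C_comodule G f]
  have inner: "tensor_lift X (\<lambda>x y. ?f x y z) (comult C n) = g \<triangleleft>\<^bsub>X\<^esub> (j n \<otimes>\<^bsub>A\<^esub> i z)"
    if n: "n \<in> carrier C" and z: "z \<in> carrier C" for n z
  proof -
    have "tensor_lift X (\<lambda>x y. ?f x y z) (comult C n) = \<rho> (j n) \<triangleleft>\<^bsub>X\<^esub> i z"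
      unfolding \<rho>_j[OF n]
      by (rule CC.additive_map_tensor_lift[OF G G j_pure_balanced X.additive_ract[OF i(2)[OF z]] comult_closed[OF n], symmetric])
    then show ?thesis
      using n z by (simp add: \<rho>_eq[of "j n"] X.ract_mult g_closed j i)
  qed
  have "tensor_lift X (\<lambda>x y. j x \<triangleright>\<^bsub>X\<^esub> L y) (comult C c)
      = tensor_lift X (\<lambda>x y. tensor_lift X (?f x) (comult C y)) (comult C c)"
    by (rule CC.tensor_lift_cong[symmetric, OF G C_bal(1) cc]) (simp add: L_lact j)
  also have "\<dots> = tensor_lift X (\<lambda>n z. tensor_lift X (\<lambda>x y. ?f x y z) (comult C n)) (comult C c)"
    by (rule C_coassoc)
  also have "\<dots> = tensor_lift X (\<lambda>n z. g \<triangleleft>\<^bsub>X\<^esub> (j n \<otimes>\<^bsub>A\<^esub> i z)) (comult C c)"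
    by (rule CC.tensor_lift_cong[OF G C_bal(2) cc inner])
  also have "\<dots> = g \<triangleleft>\<^bsub>X\<^esub> convolution C A j i c"
    unfolding convolution_def
    by (rule CC.additive_map_tensor_lift[OF abelian_group_A G conv_balanced[OF j_hom i_hom] _ cc, symmetric])
      (intro additive_mapI; simp add: X.ract_closed X.ract_add_right g_closed)
  also have "\<dots> = (counit C c \<odot>\<^bsub>A\<^esub> \<one>\<^bsub>A\<^esub>) \<triangleright>\<^bsub>X\<^esub> g"
    using c by (simp add: conv_j_i k_central counit_closed g_closed)
  finally show ?thesis .
qed

text \<open>Since \<open>j * L = \<epsilon> g\<close> for the convolution product by \<open>j_L\<close>, and \<open>i * j = \<epsilon>\<close>, convolving
  with \<open>i\<close> on the left gives \<open>L = i g\<close>.\<close>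

lemma L_eq:
  assumes c: "c \<in> carrier C"
  shows "L c = i c \<triangleright>\<^bsub>X\<^esub> g"
proof -
  note G = AC.abelian_group_T
  note cc = comult_closed[OF c]
  \<comment> \<open>The integrand of the triple convolution of \<open>i\<close>, \<open>j\<close>
    and \<open>L\<close>; the facts \<open>left\<close> and \<open>right\<close> evaluate its two
    bracketings.\<close>
  let ?f = "\<lambda>x y z. (i x \<otimes>\<^bsub>A\<^esub> j y) \<triangleright>\<^bsub>X\<^esub> L z"
  note Lsimps = L_closed L_smult additive_map_add[OF L_additive]
  have f: "k_balanced3 k C C C X ?f"
  proof (rule balanced_map3I)
    fix x y s z assume *: "x \<in> carrier C" "y \<in> carrier C" "s \<in> carrier k" "z \<in> carrier C"
    then have "(i x \<otimes>\<^bsub>A\<^esub> j (s \<odot>\<^bsub>C\<^esub> y)) = (i x \<otimes>\<^bsub>A\<^esub> j y) \<otimes>\<^bsub>A\<^esub> (s \<odot>\<^bsub>A\<^esub> \<one>\<^bsub>A\<^esub>)"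
      by (simp add: i j smult_mult_right)
    then show "(i x \<otimes>\<^bsub>A\<^esub> j (s \<odot>\<^bsub>C\<^esub> y)) \<triangleright>\<^bsub>X\<^esub> L z = (i x \<otimes>\<^bsub>A\<^esub> j y) \<triangleright>\<^bsub>X\<^esub> L (s \<odot>\<^bsub>C\<^esub> z)"
      using * by (simp add: Lsimps i j X.lact_mult A_smult)
  qed (simp_all add: Lsimps i j A.l_distr A.r_distr X.lact_closed X.lact_add_left X.lact_add_right
      smult_mult_left smult_mult_right)
  note C_coassoc = coalgebra_comodule.coassoc[OF C_comodule G f c]
    and C_bal = coalgebra_comodule.k_balanced_comult[OF C_comodule G f]
      coalgebra_comodule.k_balanced_coaction[OF C_comodule G f]
  have jL: "k_balanced k C C X (\<lambda>x y. j x \<triangleright>\<^bsub>X\<^esub> L y)"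
  proof (rule balanced_mapI)
    fix x y s assume *: "x \<in> carrier C" "y \<in> carrier C" "s \<in> carrier k"
    then have "j (s \<odot>\<^bsub>C\<^esub> x) = j x \<otimes>\<^bsub>A\<^esub> (s \<odot>\<^bsub>A\<^esub> \<one>\<^bsub>A\<^esub>)"
      by (simp add: j smult_mult_right)
    then show "j (s \<odot>\<^bsub>C\<^esub> x) \<triangleright>\<^bsub>X\<^esub> L y = j x \<triangleright>\<^bsub>X\<^esub> L (s \<odot>\<^bsub>C\<^esub> y)"
      using * by (simp add: Lsimps j X.lact_mult A_smult)
  qed (simp_all add: Lsimps j X.lact_closed X.lact_add_left X.lact_add_right)
  have left: "tensor_lift X (?f x) (comult C w) = i (counit C w \<odot>\<^bsub>C\<^esub> x) \<triangleright>\<^bsub>X\<^esub> g"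
    if x: "x \<in> carrier C" and w: "w \<in> carrier C" for x w
  proof -
    have "tensor_lift X (?f x) (comult C w) = tensor_lift X (\<lambda>y z. i x \<triangleright>\<^bsub>X\<^esub> (j y \<triangleright>\<^bsub>X\<^esub> L z)) (comult C w)"
      by (rule CC.tensor_lift_cong[OF G balanced_map3D(8)[OF f x] comult_closed[OF w]])
        (use x in \<open>simp add: i j L_closed X.lact_mult\<close>)
    also have "\<dots> = i x \<triangleright>\<^bsub>X\<^esub> ((counit C w \<odot>\<^bsub>A\<^esub> \<one>\<^bsub>A\<^esub>) \<triangleright>\<^bsub>X\<^esub> g)"
      unfolding j_L[OF w, symmetric]
      by (rule CC.additive_map_tensor_lift[OF G G jL X.additive_lact[OF i(2)[OF x]] comult_closed[OF w], symmetric])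
    also have "\<dots> = i (counit C w \<odot>\<^bsub>C\<^esub> x) \<triangleright>\<^bsub>X\<^esub> g"
      using x w by (simp add: i g_closed A_smult counit_closed smult_mult_right flip: X.lact_mult)
    finally show ?thesis .
  qed
  have right: "tensor_lift X (\<lambda>x y. ?f x y z) (comult C n) = L (counit C n \<odot>\<^bsub>C\<^esub> z)"
    if n: "n \<in> carrier C" and z: "z \<in> carrier C" for n z
  proof -
    have "(\<lambda>a. a \<triangleright>\<^bsub>X\<^esub> L z) \<in> additive_maps A X"
      using z by (intro additive_mapI) (simp_all add: L_closed X.lact_closed X.lact_add_left)
    from CC.additive_map_tensor_lift[OF abelian_group_A G conv_balanced[OF i_hom j_hom] this comult_closed[OF n]]
    have "tensor_lift X (\<lambda>x y. ?f x y z) (comult C n) = convolution C A i j n \<triangleright>\<^bsub>X\<^esub> L z"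
      by (simp add: convolution_def)
    then show ?thesis
      using n z by (simp add: conv_i_j L_smult counit_closed)
  qed
  have ig: "(\<lambda>c. i c \<triangleright>\<^bsub>X\<^esub> g) \<in> additive_maps C X"
    by (intro additive_mapI) (simp_all add: i X.lact_closed X.lact_add_left g_closed)
  \<comment> \<open>The counit is inserted as \<open>c = \<epsilon>(c2) c1\<close>, so that
    \<open>left\<close> can be read backwards under the outer lift.\<close>
  have "i c \<triangleright>\<^bsub>X\<^esub> g = i (tensor_lift C (\<lambda>x w. counit C w \<odot>\<^bsub>C\<^esub> x) (comult C c)) \<triangleright>\<^bsub>X\<^esub> g"
    using c by (simp add: counit_right)
  also have "\<dots> = tensor_lift X (\<lambda>x w. i (counit C w \<odot>\<^bsub>C\<^esub> x) \<triangleright>\<^bsub>X\<^esub> g) (comult C c)"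
    by (rule CC.additive_map_tensor_lift[OF abelian_group_C G k_balanced_counit_right[OF module_C] ig cc])
  also have "\<dots> = tensor_lift X (\<lambda>x w. tensor_lift X (?f x) (comult C w)) (comult C c)"
    by (rule CC.tensor_lift_cong[symmetric, OF G C_bal(1) cc left])
  also have "\<dots> = tensor_lift X (\<lambda>n z. tensor_lift X (\<lambda>x y. ?f x y z) (comult C n)) (comult C c)"
    by (rule C_coassoc)
  also have "\<dots> = tensor_lift X (\<lambda>n z. L (counit C n \<odot>\<^bsub>C\<^esub> z)) (comult C c)"
    by (rule CC.tensor_lift_cong[OF G C_bal(2) cc right])
  also have "\<dots> = L (tensor_lift C (\<lambda>n z. counit C n \<odot>\<^bsub>C\<^esub> z) (comult C c))"
    by (rule CC.additive_map_tensor_lift[OF abelian_group_C G k_balanced_counit_left[OF module_C] L_additive cc, symmetric])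
  also have "\<dots> = L c"
    using c by (simp add: counit_left)
  finally show ?thesis by simp
qed

end

lemma additive_map_uminus:
  assumes "abelian_group M" "abelian_group N" "f \<in> additive_maps M N" "x \<in> carrier M"
  shows "f (\<ominus>\<^bsub>M\<^esub> x) = \<ominus>\<^bsub>N\<^esub> f x"
proof -
  interpret M: abelian_group M by (rule assms(1))
  interpret N: abelian_group N by (rule assms(2))
  have "f (\<ominus>\<^bsub>M\<^esub> x) \<oplus>\<^bsub>N\<^esub> f x = \<zero>\<^bsub>N\<^esub>"
    using assms by (simp add: M.l_neg additive_map_zero flip: additive_map_add[OF assms(3)])
  then show ?thesis
    using assms by (intro N.minus_equality[symmetric]) (simp_all add: additive_map_closed)
qed

lemma regular_bimod_sel:
  "carrier (regular_bimod A) = carrier A" "add (regular_bimod A) = add A"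
  "ract (regular_bimod A) = monoid.mult A" "lact (regular_bimod A) = monoid.mult A"
  by (simp_all add: regular_bimod_def)

section \<open>Induced comodules and coinvariants\<close>

text \<open>With \<open>A\<close> as a comodule via \<open>\<rho>\<close>, these are the comodule
  maps from \<open>A\<close> to \<open>M\<close>, identified with their values at \<open>1\<close>:
  such a map is \<open>a \<mapsto> m a\<close>, and colinearity says that \<open>m\<close> has
  coaction \<open>m \<otimes> g\<close>. The action is that of \<open>M\<close>; only the scalars
  get restricted to \<open>B\<close>.\<close>

definition coinv ::
  "('a, 's) ring_scheme \<Rightarrow> ('a, 'x, 'z) coring_scheme \<Rightarrow> 'x \<Rightarrow> ('a, 'm, 'x, 'y) comod_scheme \<Rightarrow> ('a, 'm) rmod" where
  "coinv A X g M = \<lparr>carrier = {m \<in> carrier M. coact M m = m \<boxtimes>\<^bsub>rmod_tensor (carrier A) M X\<^esub> g},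
     monoid.mult = undefined, one = undefined, ring.zero = \<zero>\<^bsub>M\<^esub>, add = add M, ract = ract M\<rparr>"

lemma coinv_sel:
  "m \<in> carrier (coinv A X g M) \<longleftrightarrow> m \<in> carrier M \<and> coact M m = m \<boxtimes>\<^bsub>rmod_tensor (carrier A) M X\<^esub> g"
  "\<zero>\<^bsub>coinv A X g M\<^esub> = \<zero>\<^bsub>M\<^esub>" "add (coinv A X g M) = add M" "ract (coinv A X g M) = ract M"
  by (simp_all add: coinv_def)

context cleft_extension
begin

text \<open>Centrality of \<open>s 1\<close> on \<open>X\<close> says that it commutes with
  \<open>g\<close>. Scalars can hence be moved across tensor signs over \<open>B\<close>
  too.\<close>

lemma scalar_B: "s \<in> carrier k \<Longrightarrow> s \<odot>\<^bsub>A\<^esub> \<one>\<^bsub>A\<^esub> \<in> B"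
  by (simp add: B_iff \<rho>_eq[of "s \<odot>\<^bsub>A\<^esub> \<one>\<^bsub>A\<^esub>"] A_smult k_central g_closed)

lemma B_carrier: "b \<in> B \<Longrightarrow> b \<in> carrier A"
  using B_subset by blast

lemma g_B: "b \<in> B \<Longrightarrow> g \<triangleleft>\<^bsub>X\<^esub> b = b \<triangleright>\<^bsub>X\<^esub> g"
  using B_iff \<rho>_eq[of b] by simp

abbreviation "co \<equiv> coinv A X g"
abbreviation "ind \<equiv> induced_comodule A B X \<rho>"

text \<open>Stability under \<open>b \<in> B\<close> comes from commutation with \<open>g\<close>:
  the coaction of \<open>m b\<close> is
  \<open>m \<otimes> g b = m \<otimes> b g = m b \<otimes> g\<close>.\<close>

lemma coinv_right_module:
  assumes "coring_comodule A X M"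
  shows "right_module (A\<lparr>carrier := B\<rparr>) (co M)"
proof -
  interpret M: coring_comodule A X M by (rule assms)
  let ?MX = "TX M"
  have Mm: "right_module A M" by (rule M.right_module_axioms)
  interpret MX: tensor_product "carrier A" M "ract M" X "lact X" ?MX by (rule tensor_product_X[OF Mm])
  have pg: "(\<lambda>m. m \<boxtimes>\<^bsub>?MX\<^esub> g) \<in> additive_maps M ?MX"
    by (intro additive_mapI) (simp_all add: MX.pure_closed MX.pure_add_left g_closed)
  note Mg = right_module.axioms(2)[OF Mm]
  note hom = rmod_homD[OF M.coact_hom]
  note zero = additive_map_zero[OF Mg MX.abelian_group_T hom(1)] additive_map_zero[OF Mg MX.abelian_group_T pg]
  note uminus = additive_map_uminus[OF Mg MX.abelian_group_T hom(1)] additive_map_uminus[OF Mg MX.abelian_group_T pg]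
  have "abelian_group (co M)"
  proof (rule abelian_groupI)
    fix m assume "m \<in> carrier (co M)"
    then show "\<exists>y\<in>carrier (co M). y \<oplus>\<^bsub>co M\<^esub> m = \<zero>\<^bsub>co M\<^esub>"
      by (intro bexI[of _ "\<ominus>\<^bsub>M\<^esub> m"]) (simp_all add: coinv_sel uminus abelian_group.l_neg[OF Mg] abelian_group.a_inv_closed[OF Mg])
  qed (simp_all add: coinv_sel zero hom(3) MX.pure_add_left g_closed M.a_closed M.M.zero_closed M.M.a_ac M.M.l_zero)
  moreover have "m \<triangleleft>\<^bsub>M\<^esub> b \<in> carrier (co M)" if "m \<in> carrier (co M)" "b \<in> B" for m b
    using that by (simp add: coinv_sel hom(4) B_carrier M.ract_closed tensor_X_ract(2)[OF Mm] g_closed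
        g_B MX.pure_balanced)
  ultimately show ?thesis
    by (simp add: right_module_def right_module_axioms_def ring_B coinv_sel M.ract_add_left M.ract_add_right
        M.ract_mult M.ract_one B_carrier)
qed

lemma induced_tensor_product:
  assumes N: "right_module (A\<lparr>carrier := B\<rparr>) N"
  shows "tensor_product B N (ract N) (regular_bimod A) (lact (regular_bimod A)) (rmod_tensor B N (regular_bimod A))"
proof -
  have R: "abelian_group (regular_bimod A)"
    by (rule right_module.axioms(2)[OF bimodule.axioms(1)[OF bimodule_regular[OF A.ring_axioms]]])
  have ract: "n \<triangleleft>\<^bsub>N\<^esub> b \<in> carrier N" if "n \<in> carrier N" "b \<in> B" for n b
    using right_module.ract_closed[OF N that(1), of b] that(2) by simp
  have lact: "b \<triangleright>\<^bsub>regular_bimod A\<^esub> a \<in> carrier (regular_bimod A)"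
    if "a \<in> carrier (regular_bimod A)" "b \<in> B" for a b
    using that by (simp add: regular_bimod_sel B_carrier)
  show ?thesis
    by (rule rmod_tensor_product[OF right_module.axioms(2)[OF N] R ract lact])
qed

lemma induced_sel:
  "carrier (ind N) = carrier (rmod_tensor B N (regular_bimod A))"
  "\<zero>\<^bsub>ind N\<^esub> = \<zero>\<^bsub>rmod_tensor B N (regular_bimod A)\<^esub>"
  "add (ind N) = add (rmod_tensor B N (regular_bimod A))"
  "ract (ind N) = ract (rmod_tensor B N (regular_bimod A))"
  by (simp_all add: induced_comodule_def Let_def)

lemma ind_tensor_product:
  assumes "right_module (A\<lparr>carrier := B\<rparr>) N"
  shows "tensor_product B N (ract N) (regular_bimod A) (monoid.mult A) (ind N)"
  using induced_tensor_product[OF assms]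
  by (simp add: tensor_product_def tensor_product_axioms_def induced_sel regular_bimod_sel)

lemma ind_pure: "n \<boxtimes>\<^bsub>rmod_tensor B N (regular_bimod A)\<^esub> a = n \<boxtimes>\<^bsub>ind N\<^esub> a"
  by (simp add: pure_tensor_def induced_sel)

lemma
  assumes N: "right_module (A\<lparr>carrier := B\<rparr>) N"
  shows ind_right_module: "right_module A (ind N)"
    and ind_ract_pure: "\<lbrakk>n \<in> carrier N; a \<in> carrier A; b \<in> carrier A\<rbrakk>
      \<Longrightarrow> (n \<boxtimes>\<^bsub>ind N\<^esub> a) \<triangleleft>\<^bsub>ind N\<^esub> b = n \<boxtimes>\<^bsub>ind N\<^esub> (a \<otimes>\<^bsub>A\<^esub> b)"
proof -
  note T = induced_tensor_product[OF N] and R = bimodule_regular[OF A.ring_axioms]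
  show "right_module A (ind N)"
    by (rule right_module_cong[OF rmod_tensor_right_module[OF T R B_subset]]) (simp_all add: induced_sel)
  show "\<lbrakk>n \<in> carrier N; a \<in> carrier A; b \<in> carrier A\<rbrakk>
      \<Longrightarrow> (n \<boxtimes>\<^bsub>ind N\<^esub> a) \<triangleleft>\<^bsub>ind N\<^esub> b = n \<boxtimes>\<^bsub>ind N\<^esub> (a \<otimes>\<^bsub>A\<^esub> b)"
    using rmod_tensor_ract_pure[OF T R B_subset, of b n a]
    by (simp add: induced_sel ind_pure regular_bimod_sel)
qed

lemma ind_coact_eq: "coact (ind N) = tensor_lift (TX (ind N))
    (\<lambda>n a. (n \<boxtimes>\<^bsub>ind N\<^esub> \<one>\<^bsub>A\<^esub>) \<boxtimes>\<^bsub>TX (ind N)\<^esub> \<rho> a)"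
proof -
  have "rmod_tensor (carrier A) (ind N) X = rmod_tensor (carrier A) (rmod_tensor B N (regular_bimod A)) X"
    by (rule rmod_tensor_cong) (simp_all add: induced_sel)
  then show ?thesis
    by (simp add: ind_pure[symmetric]) (simp add: induced_comodule_def Let_def)
qed

text \<open>Well-definedness over \<open>B\<close> rests on left \<open>B\<close>-linearity of
  \<open>\<rho>\<close>: in \<open>(n b \<otimes> 1) \<otimes> \<rho> a\<close> the element
  \<open>b\<close> becomes a right factor of \<open>n \<otimes> 1\<close>, crosses the sign over
  \<open>A\<close>, and is absorbed by \<open>b \<rho>(a) = \<rho>(b a)\<close>.\<close>

lemma
  assumes N: "right_module (A\<lparr>carrier := B\<rparr>) N"
  shows ind_coact_hom: "coact (ind N) \<in> rmod_hom A (ind N) (TX (ind N))"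
    and ind_coact_pure: "\<lbrakk>n \<in> carrier N; a \<in> carrier A\<rbrakk>
      \<Longrightarrow> coact (ind N) (n \<boxtimes>\<^bsub>ind N\<^esub> a) = (n \<boxtimes>\<^bsub>ind N\<^esub> \<one>\<^bsub>A\<^esub>) \<boxtimes>\<^bsub>TX (ind N)\<^esub> \<rho> a"
proof -
  let ?T = "ind N"
  let ?TX = "TX ?T"
  interpret T: tensor_product B N "ract N" "regular_bimod A" "monoid.mult A" ?T by (rule ind_tensor_product[OF N])
  have Tm: "right_module A ?T" by (rule ind_right_module[OF N])
  interpret Tm: right_module A ?T by (rule Tm)
  interpret TX: tensor_product "carrier A" ?T "ract ?T" X "lact X" ?TX by (rule tensor_product_X[OF Tm])
  note simps = regular_bimod_sel T.pure_closed T.pure_add_left T.pure_add_right TX.pure_closed TX.pure_add_left TX.pure_add_right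
  have one: "n \<boxtimes>\<^bsub>?T\<^esub> \<one>\<^bsub>A\<^esub> \<in> carrier ?T" if "n \<in> carrier N" for n
    using that by (simp add: simps)
  have bal: "balanced_map B N (ract N) (regular_bimod A) (monoid.mult A) ?TX (\<lambda>n a. (n \<boxtimes>\<^bsub>?T\<^esub> \<one>\<^bsub>A\<^esub>) \<boxtimes>\<^bsub>?TX\<^esub> \<rho> a)"
  proof (rule balanced_mapI)
    fix n b a assume *: "n \<in> carrier N" "b \<in> B" "a \<in> carrier (regular_bimod A)"
    then have "(n \<triangleleft>\<^bsub>N\<^esub> b) \<boxtimes>\<^bsub>?T\<^esub> \<one>\<^bsub>A\<^esub> = (n \<boxtimes>\<^bsub>?T\<^esub> \<one>\<^bsub>A\<^esub>) \<triangleleft>\<^bsub>?T\<^esub> b"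
      using T.pure_balanced[of n b "\<one>\<^bsub>A\<^esub>"] by (simp add: regular_bimod_sel ind_ract_pure[OF N] B_carrier)
    then show "((n \<triangleleft>\<^bsub>N\<^esub> b) \<boxtimes>\<^bsub>?T\<^esub> \<one>\<^bsub>A\<^esub>) \<boxtimes>\<^bsub>?TX\<^esub> \<rho> a = (n \<boxtimes>\<^bsub>?T\<^esub> \<one>\<^bsub>A\<^esub>) \<boxtimes>\<^bsub>?TX\<^esub> \<rho> (b \<otimes>\<^bsub>A\<^esub> a)"
      using * by (simp add: regular_bimod_sel one TX.pure_balanced B_carrier \<rho>_closed \<rho>_B)
  qed (simp_all add: simps \<rho>_closed additive_map_add[OF \<rho>_additive])
  show pure: "coact (ind N) (n \<boxtimes>\<^bsub>?T\<^esub> a) = (n \<boxtimes>\<^bsub>?T\<^esub> \<one>\<^bsub>A\<^esub>) \<boxtimes>\<^bsub>?TX\<^esub> \<rho> a"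
    if "n \<in> carrier N" "a \<in> carrier A" for n a
    unfolding ind_coact_eq using that
    by (intro T.tensor_lift_pure[OF TX.abelian_group_T bal]) (simp_all add: regular_bimod_sel)
  have add: "coact ?T \<in> additive_maps ?T ?TX"
    unfolding ind_coact_eq by (rule T.tensor_lift_additive[OF TX.abelian_group_T bal])
  show "coact ?T \<in> rmod_hom A ?T ?TX"
  proof (rule rmod_homI[OF add])
    fix t a assume t: "t \<in> carrier ?T" and a: "a \<in> carrier A"
    show "coact ?T (t \<triangleleft>\<^bsub>?T\<^esub> a) = coact ?T t \<triangleleft>\<^bsub>?TX\<^esub> a"
      by (rule T.additive_map_eqI[OF additive_map_comp[OF Tm.additive_ract[OF a] add]
            additive_map_comp[OF add tensor_X_ract(1)[OF Tm a]] t])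
        (simp add: regular_bimod_sel ind_ract_pure[OF N] a pure one tensor_X_ract(2)[OF Tm] \<rho>_closed \<rho>_mult)
  qed
qed

text \<open>On \<open>n \<otimes> a\<close> both sides of coassociativity are
  \<open>(n \<otimes> 1) \<otimes> (g \<otimes> \<rho> a)\<close>, by \<open>ccomult_\<rho>\<close>;
  the counit axiom reduces to \<open>ccounit_\<rho>\<close>.\<close>

lemma ind_comodule:
  assumes N: "right_module (A\<lparr>carrier := B\<rparr>) N"
  shows "coring_comodule A X (ind N)"
proof -
  let ?T = "ind N"
  let ?TX = "TX ?T" and ?TXX = "rmod_tensor (carrier A) ?T XX"
  let ?TX_X = "TX ?TX"
  interpret T: tensor_product B N "ract N" "regular_bimod A" "monoid.mult A" ?T by (rule ind_tensor_product[OF N])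
  have Tm: "right_module A ?T" by (rule ind_right_module[OF N])
  interpret Tm: right_module A ?T by (rule Tm)
  interpret TX: tensor_product "carrier A" ?T "ract ?T" X "lact X" ?TX by (rule tensor_product_X[OF Tm])
  note hom = ind_coact_hom[OF N] and pure = ind_coact_pure[OF N]
  have one: "n \<boxtimes>\<^bsub>?T\<^esub> \<one>\<^bsub>A\<^esub> \<in> carrier ?T" if "n \<in> carrier N" for n
    using that by (simp add: regular_bimod_sel T.pure_closed)
  note TXm = right_module_tensor_X[OF Tm]
  note map = tensor_map_X_hom[OF Tm TXm hom] tensor_map_X_pure[OF Tm TXm hom]
  have id: "(\<lambda>t. t) \<in> additive_maps ?T ?T" by (rule additive_mapI) auto
  note bal = balanced_lact_map[OF Tm counit_additive counit_lact]
  have eps: "ccounit X x \<in> carrier A" if "x \<in> carrier X" for x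
    using that by (rule additive_map_closed[OF counit_additive])
  show ?thesis
  proof (intro coring_comodule.intro coring_comodule_axioms.intro Tm hom)
    fix t assume t: "t \<in> carrier ?T"
    show "tensor_assoc ?TXX XX (tensor_map ?TX_X (coact ?T) id (coact ?T t)) = tensor_map ?TXX id (ccomult X) (coact ?T t)"
      by (rule T.additive_map_eqI[OF additive_map_comp[OF additive_map_comp[OF rmod_homD(1)[OF hom] rmod_homD(1)[OF map(1)]]
              tensor_assoc_X_additive[OF Tm]] additive_map_comp[OF rmod_homD(1)[OF hom] comult_map_additive[OF Tm]] t])
        (simp add: regular_bimod_sel pure map(2) one \<rho>_closed g_closed tensor_assoc_X_pure[OF Tm]
          comult_map_pure[OF Tm] ccomult_\<rho>)
    have "tensor_lift ?T (\<lambda>n x. n \<triangleleft>\<^bsub>?T\<^esub> ccounit X x) \<in> additive_maps ?TX ?T"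
      by (rule TX.tensor_lift_additive[OF T.abelian_group_T]) (rule bal; simp)
    from additive_map_comp[OF rmod_homD(1)[OF hom] this] id t
    show "tensor_lift ?T (\<lambda>n x. n \<triangleleft>\<^bsub>?T\<^esub> ccounit X x) (coact ?T t) = t"
    proof (rule T.additive_map_eqI)
      fix n a assume "n \<in> carrier N" "a \<in> carrier (regular_bimod A)"
      then show "tensor_lift ?T (\<lambda>n x. n \<triangleleft>\<^bsub>?T\<^esub> ccounit X x) (coact ?T (n \<boxtimes>\<^bsub>?T\<^esub> a)) = n \<boxtimes>\<^bsub>?T\<^esub> a"
        by (subst pure) (simp_all add: regular_bimod_sel TX.tensor_lift_pure[OF T.abelian_group_T bal] one \<rho>_closed
            ccounit_\<rho> ind_ract_pure[OF N])
    qed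
  qed
qed

text \<open>Intended for elements of \<open>ind (co M)\<close>, where it is the counit of the
  adjunction between induction and coinvariants.\<close>

definition act :: "('a, 'm, 'y) rmod_scheme \<Rightarrow> ('m, 'a) tensors \<Rightarrow> 'm" where
  "act M = tensor_lift M (\<lambda>n a. n \<triangleleft>\<^bsub>M\<^esub> a)"

lemma
  assumes M: "coring_comodule A X M"
  shows act_hom: "act M \<in> comodule_hom A X (ind (co M)) M"
    and act_pure: "\<lbrakk>n \<in> carrier (co M); a \<in> carrier A\<rbrakk> \<Longrightarrow> act M (n \<boxtimes>\<^bsub>ind (co M)\<^esub> a) = n \<triangleleft>\<^bsub>M\<^esub> a"
proof -
  let ?N = "co M" and ?T = "ind (co M)"
  let ?TX = "TX ?T" and ?MX = "TX M"
  interpret M: coring_comodule A X M by (rule M)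
  have Mm: "right_module A M" by (rule M.right_module_axioms)
  have N: "right_module (A\<lparr>carrier := B\<rparr>) ?N" by (rule coinv_right_module[OF M])
  interpret T: tensor_product B ?N "ract ?N" "regular_bimod A" "monoid.mult A" ?T by (rule ind_tensor_product[OF N])
  have Tc: "coring_comodule A X ?T" by (rule ind_comodule[OF N])
  interpret Tc: coring_comodule A X ?T by (rule Tc)
  have Tm: "right_module A ?T" by (rule ind_right_module[OF N])
  have Mg: "abelian_group M" by (rule right_module.axioms(2)[OF Mm])
  have bal: "balanced_map B ?N (ract ?N) (regular_bimod A) (monoid.mult A) M (\<lambda>n a. n \<triangleleft>\<^bsub>M\<^esub> a)"
    by (rule balanced_mapI) (simp_all add: coinv_sel regular_bimod_sel M.ract_closed M.ract_add_left M.ract_add_right M.ract_mult B_carrier)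
  show pure: "act M (n \<boxtimes>\<^bsub>?T\<^esub> a) = n \<triangleleft>\<^bsub>M\<^esub> a" if "n \<in> carrier ?N" "a \<in> carrier A" for n a
    unfolding act_def using that by (intro T.tensor_lift_pure[OF Mg bal]) (simp_all add: regular_bimod_sel)
  have add: "act M \<in> additive_maps ?T M"
    unfolding act_def by (rule T.tensor_lift_additive[OF Mg bal])
  have hom: "act M \<in> rmod_hom A ?T M"
  proof (rule rmod_homI[OF add])
    fix t a assume t: "t \<in> carrier ?T" and a: "a \<in> carrier A"
    show "act M (t \<triangleleft>\<^bsub>?T\<^esub> a) = act M t \<triangleleft>\<^bsub>M\<^esub> a"
      by (rule T.additive_map_eqI[OF additive_map_comp[OF right_module.additive_ract[OF Tm a] add]
            additive_map_comp[OF add M.additive_ract[OF a]] t])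
        (simp add: regular_bimod_sel ind_ract_pure[OF N] a pure M.ract_mult, simp add: coinv_sel M.ract_mult a)
  qed
  note map = tensor_map_X_hom[OF Tm Mm hom] tensor_map_X_pure[OF Tm Mm hom]
  show "act M \<in> comodule_hom A X ?T M"
  proof (rule comodule_homI[OF hom])
    fix t assume t: "t \<in> carrier ?T"
    show "coact M (act M t) = tensor_map ?MX (act M) id (coact ?T t)"
    proof (rule T.additive_map_eqI[OF additive_map_comp[OF add rmod_homD(1)[OF M.coact_hom]]
            additive_map_comp[OF rmod_homD(1)[OF Tc.coact_hom] rmod_homD(1)[OF map(1)]] t])
      fix n a assume *: "n \<in> carrier ?N" "a \<in> carrier (regular_bimod A)"
      then have "n \<boxtimes>\<^bsub>?T\<^esub> \<one>\<^bsub>A\<^esub> \<in> carrier ?T"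
        by (simp add: T.pure_closed regular_bimod_sel)
      then have "tensor_map ?MX (act M) id (coact ?T (n \<boxtimes>\<^bsub>?T\<^esub> a)) = (n \<triangleleft>\<^bsub>M\<^esub> \<one>\<^bsub>A\<^esub>) \<boxtimes>\<^bsub>?MX\<^esub> \<rho> a"
        using * by (simp add: ind_coact_pure[OF N] regular_bimod_sel map(2) \<rho>_closed pure)
      \<comment> \<open>Coinvariance of \<open>n\<close> and linearity of the coaction give
        \<open>(n \<otimes> g) a\<close>, and \<open>g a = \<rho> a\<close>.\<close>
      moreover have "coact M (n \<triangleleft>\<^bsub>M\<^esub> a) = n \<boxtimes>\<^bsub>?MX\<^esub> \<rho> a"
        using * by (simp add: coinv_sel regular_bimod_sel rmod_homD(4)[OF M.coact_hom] tensor_X_ract(2)[OF Mm] g_closed \<rho>_eq[of a])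
      ultimately show "coact M (act M (n \<boxtimes>\<^bsub>?T\<^esub> a)) = tensor_map ?MX (act M) id (coact ?T (n \<boxtimes>\<^bsub>?T\<^esub> a))"
        using * by (simp add: pure regular_bimod_sel) (simp add: coinv_sel M.ract_one)
    qed
  qed
qed

end

context cleft_extension
begin

lemma ract_smult:
  assumes "x \<in> carrier X" "s \<in> carrier k" "a \<in> carrier A"
  shows "x \<triangleleft>\<^bsub>X\<^esub> (s \<odot>\<^bsub>A\<^esub> a) = (s \<odot>\<^bsub>A\<^esub> \<one>\<^bsub>A\<^esub>) \<triangleright>\<^bsub>X\<^esub> (x \<triangleleft>\<^bsub>X\<^esub> a)"
proof -
  have "x \<triangleleft>\<^bsub>X\<^esub> (s \<odot>\<^bsub>A\<^esub> a) = (x \<triangleleft>\<^bsub>X\<^esub> (s \<odot>\<^bsub>A\<^esub> \<one>\<^bsub>A\<^esub>)) \<triangleleft>\<^bsub>X\<^esub> a"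
    using assms by (simp add: A_smult smult_mult_left flip: X.ract_mult)
  then show ?thesis
    using assms by (simp add: A_smult X.lact_ract flip: k_central)
qed

end

section \<open>Bijectivity of the counit\<close>

context cleaving
begin

definition h :: "('a, 'c) tensors \<Rightarrow> 'a" where
  "h = left_ext i"

lemma
  shows h_additive: "h \<in> additive_maps X A"
    and h_pure: "\<lbrakk>a \<in> carrier A; c \<in> carrier C\<rbrakk> \<Longrightarrow> h (a \<boxtimes>\<^bsub>X\<^esub> c) = a \<otimes>\<^bsub>A\<^esub> i c"
    and h_closed: "x \<in> carrier X \<Longrightarrow> h x \<in> carrier A"
    and h_lact: "\<lbrakk>a \<in> carrier A; x \<in> carrier X\<rbrakk> \<Longrightarrow> h (a \<triangleright>\<^bsub>X\<^esub> x) = a \<otimes>\<^bsub>A\<^esub> h x"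
  unfolding h_def
  by (rule left_ext_additive[OF i_hom], erule (1) left_ext_pure[OF i_hom], erule left_ext_closed[OF i_hom],
      erule (1) left_ext_lact[OF i_hom])

lemma h_add: "\<lbrakk>x \<in> carrier X; y \<in> carrier X\<rbrakk> \<Longrightarrow> h (x \<oplus>\<^bsub>X\<^esub> y) = h x \<oplus>\<^bsub>A\<^esub> h y"
  by (rule additive_map_add[OF h_additive])

lemma h_scalar:
  assumes "x \<in> carrier X" "s \<in> carrier k"
  shows "h (x \<triangleleft>\<^bsub>X\<^esub> (s \<odot>\<^bsub>A\<^esub> \<one>\<^bsub>A\<^esub>)) = h x \<otimes>\<^bsub>A\<^esub> (s \<odot>\<^bsub>A\<^esub> \<one>\<^bsub>A\<^esub>)"
  using assms by (simp add: A_smult h_lact h_closed smult_mult_left smult_mult_right flip: k_central)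

lemma h_smult:
  assumes "x \<in> carrier X" "s \<in> carrier k" "a \<in> carrier A"
  shows "h (x \<triangleleft>\<^bsub>X\<^esub> (s \<odot>\<^bsub>A\<^esub> a)) = s \<odot>\<^bsub>A\<^esub> h (x \<triangleleft>\<^bsub>X\<^esub> a)"
  using assms by (simp add: ract_smult X.ract_closed A_smult h_lact h_closed smult_mult_left)

lemma XX_h_balanced: "balanced_map (carrier A) X (ract X) X (lact X) X (\<lambda>y z. y \<triangleleft>\<^bsub>X\<^esub> h z)"
  by (rule balanced_lact_map[OF X.right_module_axioms h_additive h_lact])

text \<open>On \<open>a \<otimes> c\<close> the left side is
  \<open>(a \<otimes> c1) i(c2) = a L(c)\<close>, and \<open>L_eq\<close> turns it into
  \<open>a i(c) g\<close>. This is the source of coinvariance, for \<open>q\<close> as well as for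
  \<open>proj\<close>.\<close>

lemma comult_h:
  assumes x: "x \<in> carrier X"
  shows "tensor_lift X (\<lambda>y z. y \<triangleleft>\<^bsub>X\<^esub> h z) (ccomult X x) = h x \<triangleright>\<^bsub>X\<^esub> g"
proof -
  note G = AC.abelian_group_T
  have hg: "(\<lambda>a. a \<triangleright>\<^bsub>X\<^esub> g) \<in> additive_maps A X"
    by (intro additive_mapI) (simp_all add: X.lact_closed X.lact_add_left g_closed)
  note lift = XX.tensor_lift_additive[OF G XX_h_balanced]
  from additive_map_comp[OF comult_additive lift] additive_map_comp[OF h_additive hg] x
  show ?thesis
  proof (rule AC.additive_map_eqI)
    fix a c assume *: "a \<in> carrier A" "c \<in> carrier C"
    note cc = comult_closed[OF *(2)]
    have "tensor_lift X (\<lambda>y z. y \<triangleleft>\<^bsub>X\<^esub> h z) (ccomult X (a \<boxtimes>\<^bsub>X\<^esub> c))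
        = tensor_lift X (\<lambda>c' c''. tensor_lift X (\<lambda>y z. y \<triangleleft>\<^bsub>X\<^esub> h z) ((a \<boxtimes>\<^bsub>X\<^esub> c') \<boxtimes>\<^bsub>XX\<^esub> (\<one>\<^bsub>A\<^esub> \<boxtimes>\<^bsub>X\<^esub> c''))) (comult C c)"
      unfolding ccomult_pure[OF *]
      by (rule CC.additive_map_tensor_lift[OF XX.abelian_group_T G balanced_map3D(8)[OF comult_balanced *(1)] lift cc])
    also have "\<dots> = tensor_lift X (\<lambda>y z. (a \<boxtimes>\<^bsub>X\<^esub> y) \<triangleleft>\<^bsub>X\<^esub> i z) (comult C c)"
      by (rule CC.tensor_lift_cong[symmetric, OF G balanced_map3D(8)[OF i_balanced *(1)] cc])
        (use * in \<open>simp add: XX.tensor_lift_pure[OF G XX_h_balanced] AC.pure_closed h_pure i\<close>)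
    also have "\<dots> = h (a \<boxtimes>\<^bsub>X\<^esub> c) \<triangleright>\<^bsub>X\<^esub> g"
      using * by (simp add: L_lact L_eq h_pure X.lact_mult i g_closed)
    finally show "tensor_lift X (\<lambda>y z. y \<triangleleft>\<^bsub>X\<^esub> h z) (ccomult X (a \<boxtimes>\<^bsub>X\<^esub> c)) = h (a \<boxtimes>\<^bsub>X\<^esub> c) \<triangleright>\<^bsub>X\<^esub> g" .
  qed
qed

text \<open>Packages \<open>h (y a) j(c)\<close> as a balanced map on two copies of
  \<open>X\<close>, so that the composite of \<open>act_inv\<close> and \<open>act\<close> becomes
  an expression in \<open>m0\<close>, \<open>m1\<close>, \<open>m2\<close> open to
  coassociativity.\<close>

definition hj :: "('a, 'c) tensors \<Rightarrow> ('a, 'c) tensors \<Rightarrow> 'a" where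
  "hj y = tensor_lift A (\<lambda>a c. h (y \<triangleleft>\<^bsub>X\<^esub> a) \<otimes>\<^bsub>A\<^esub> j c)"

lemma hj_inner: "y \<in> carrier X \<Longrightarrow> k_balanced k A C A (\<lambda>a c. h (y \<triangleleft>\<^bsub>X\<^esub> a) \<otimes>\<^bsub>A\<^esub> j c)"
  by (rule balanced_mapI)
    (simp_all add: h_closed X.ract_closed j X.ract_add_right h_add A.l_distr A.r_distr
      h_smult smult_mult_left smult_mult_right)

lemma
  shows hj_balanced: "balanced_map (carrier A) X (ract X) X (lact X) A hj"
    and hj_pure: "\<lbrakk>y \<in> carrier X; a \<in> carrier A; c \<in> carrier C\<rbrakk> \<Longrightarrow> hj y (a \<boxtimes>\<^bsub>X\<^esub> c) = h (y \<triangleleft>\<^bsub>X\<^esub> a) \<otimes>\<^bsub>A\<^esub> j c"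
    and hj_lact: "\<lbrakk>b \<in> carrier A; y \<in> carrier X; z \<in> carrier X\<rbrakk> \<Longrightarrow> hj (b \<triangleright>\<^bsub>X\<^esub> y) z = b \<otimes>\<^bsub>A\<^esub> hj y z"
proof -
  note pure = AC.tensor_lift_pure[OF abelian_group_A hj_inner]
  show "hj y (a \<boxtimes>\<^bsub>X\<^esub> c) = h (y \<triangleleft>\<^bsub>X\<^esub> a) \<otimes>\<^bsub>A\<^esub> j c" if "y \<in> carrier X" "a \<in> carrier A" "c \<in> carrier C" for y a c
    unfolding hj_def using that by (rule pure)
  show "balanced_map (carrier A) X (ract X) X (lact X) A hj"
    unfolding hj_def
  proof (rule AC.balanced_lift_right[OF abelian_group_A AC.abelian_group_T hj_inner])
    show "\<And>b. b \<in> carrier A \<Longrightarrow> lact X b \<in> additive_maps X X"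
      by (rule X.additive_lact)
  qed (simp_all add: X.ract_add_left X.ract_closed h_add h_closed A.l_distr j lact_pure pure X.ract_mult)
  show "hj (b \<triangleright>\<^bsub>X\<^esub> y) z = b \<otimes>\<^bsub>A\<^esub> hj y z" if b: "b \<in> carrier A" and y: "y \<in> carrier X" and z: "z \<in> carrier X" for b y z
  proof -
    have mul: "(\<lambda>a. b \<otimes>\<^bsub>A\<^esub> a) \<in> additive_maps A A"
      using b by (intro additive_mapI) (simp_all add: A.r_distr)
    show ?thesis
      unfolding hj_def
      by (rule AC.additive_map_eqI[OF AC.tensor_lift_additive[OF abelian_group_A hj_inner[OF X.lact_closed[OF y b]]]
            additive_map_comp[OF AC.tensor_lift_additive[OF abelian_group_A hj_inner[OF y]] mul] z])
        (simp add: pure y b X.lact_closed X.lact_ract X.ract_closed h_lact h_closed j A.m_assoc)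
  qed
qed

text \<open>The coproduct \<open>(a \<otimes> c1) \<otimes> (1 \<otimes> c2)\<close> goes to
  \<open>a i(c1) j(c2)\<close>, which is \<open>a \<epsilon>(c)\<close> because \<open>i\<close> is
  a left convolution inverse of \<open>j\<close>.\<close>

lemma comult_hj:
  assumes x: "x \<in> carrier X"
  shows "tensor_lift A hj (ccomult X x) = ccounit X x"
proof -
  note G = XX.abelian_group_T
  note lift = XX.tensor_lift_additive[OF abelian_group_A hj_balanced]
  from additive_map_comp[OF comult_additive lift] counit_additive x
  show ?thesis
  proof (rule AC.additive_map_eqI)
    fix a c assume *: "a \<in> carrier A" "c \<in> carrier C"
    note cc = comult_closed[OF *(2)]
    note bal = conv_balanced[OF i_hom j_hom]
    have mul: "(\<lambda>b. a \<otimes>\<^bsub>A\<^esub> b) \<in> additive_maps A A"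
      using * by (intro additive_mapI) (simp_all add: A.r_distr)
    have "tensor_lift A hj (ccomult X (a \<boxtimes>\<^bsub>X\<^esub> c))
        = tensor_lift A (\<lambda>c' c''. tensor_lift A hj ((a \<boxtimes>\<^bsub>X\<^esub> c') \<boxtimes>\<^bsub>XX\<^esub> (\<one>\<^bsub>A\<^esub> \<boxtimes>\<^bsub>X\<^esub> c''))) (comult C c)"
      unfolding ccomult_pure[OF *]
      by (rule CC.additive_map_tensor_lift[OF G abelian_group_A balanced_map3D(8)[OF comult_balanced *(1)] lift cc])
    also have "\<dots> = tensor_lift A (\<lambda>x y. a \<otimes>\<^bsub>A\<^esub> (i x \<otimes>\<^bsub>A\<^esub> j y)) (comult C c)"
    proof (rule CC.tensor_lift_cong[symmetric, OF abelian_group_A _ cc])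
      show "k_balanced k C C A (\<lambda>x y. a \<otimes>\<^bsub>A\<^esub> (i x \<otimes>\<^bsub>A\<^esub> j y))"
        using balanced_mapD[OF bal] by (intro balanced_mapI) (simp_all add: * A.r_distr)
    qed (use * in \<open>simp add: XX.tensor_lift_pure[OF abelian_group_A hj_balanced] AC.pure_closed hj_pure X.ract_one
        h_pure i j A.m_assoc\<close>)
    also have "\<dots> = a \<otimes>\<^bsub>A\<^esub> convolution C A i j c"
      unfolding convolution_def
      by (rule CC.additive_map_tensor_lift[OF abelian_group_A abelian_group_A bal mul cc, symmetric])
    also have "\<dots> = ccounit X (a \<boxtimes>\<^bsub>X\<^esub> c)"
      using * by (simp add: conv_i_j ccounit_pure counit_closed smult_mult_right)
    finally show "tensor_lift A hj (ccomult X (a \<boxtimes>\<^bsub>X\<^esub> c)) = ccounit X (a \<boxtimes>\<^bsub>X\<^esub> c)" .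
  qed
qed

text \<open>The map \<open>p\<close> for the comodule \<open>A\<close> itself, that is
  \<open>a \<mapsto> a0 i(a1)\<close>.\<close>

definition q :: "'a \<Rightarrow> 'a" where
  "q a = h (\<rho> a)"

text \<open>Apply \<open>comult_h\<close> to \<open>\<rho> a\<close>, whose coproduct is
  \<open>g \<otimes> \<rho> a\<close>: the result is that \<open>h (\<rho> a)\<close> commutes with
  \<open>g\<close>.\<close>

lemma q_B: "a \<in> carrier A \<Longrightarrow> q a \<in> B"
proof -
  assume a: "a \<in> carrier A"
  have "g \<triangleleft>\<^bsub>X\<^esub> h (\<rho> a) = h (\<rho> a) \<triangleright>\<^bsub>X\<^esub> g"
    using comult_h[OF \<rho>_closed[OF a]] a
    by (simp add: ccomult_\<rho> XX.tensor_lift_pure[OF AC.abelian_group_T XX_h_balanced] g_closed \<rho>_closed)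
  then show ?thesis
    using a by (simp add: q_def B_iff \<rho>_eq[of "h (\<rho> a)"] h_closed \<rho>_closed)
qed

lemma q_closed: "a \<in> carrier A \<Longrightarrow> q a \<in> carrier A"
  using q_B B_carrier by blast

lemma q_add: "\<lbrakk>a \<in> carrier A; b \<in> carrier A\<rbrakk> \<Longrightarrow> q (a \<oplus>\<^bsub>A\<^esub> b) = q a \<oplus>\<^bsub>A\<^esub> q b"
  by (simp add: q_def h_add \<rho>_closed additive_map_add[OF \<rho>_additive])

lemma q_lact: "\<lbrakk>b \<in> B; a \<in> carrier A\<rbrakk> \<Longrightarrow> q (b \<otimes>\<^bsub>A\<^esub> a) = b \<otimes>\<^bsub>A\<^esub> q a"
  by (simp add: q_def \<rho>_B h_lact \<rho>_closed B_carrier)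

lemma q_smult:
  assumes "s \<in> carrier k" "a \<in> carrier A"
  shows "q (s \<odot>\<^bsub>A\<^esub> a) = s \<odot>\<^bsub>A\<^esub> q a"
  using q_lact[OF scalar_B[OF assms(1)] assms(2)] assms by (simp add: smult_mult_left q_closed)

text \<open>Colinearity gives \<open>q (j c) = j(c1) i(c2)\<close>, so this is the identity that
  makes \<open>i\<close> a right convolution inverse of \<open>j\<close>.\<close>

lemma q_j:
  assumes c: "c \<in> carrier C"
  shows "q (j c) = counit C c \<odot>\<^bsub>A\<^esub> \<one>\<^bsub>A\<^esub>"
proof -
  have "q (j c) = tensor_lift A (\<lambda>x y. h (j x \<boxtimes>\<^bsub>X\<^esub> y)) (comult C c)"
    unfolding q_def \<rho>_j[OF c]
    by (rule CC.additive_map_tensor_lift[OF AC.abelian_group_T abelian_group_A j_pure_balanced h_additive comult_closed[OF c]])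
  also have "\<dots> = convolution C A j i c"
    unfolding convolution_def
    by (rule CC.tensor_lift_cong[symmetric, OF abelian_group_A conv_balanced[OF j_hom i_hom] comult_closed[OF c]])
      (simp add: h_pure j)
  finally show ?thesis
    using c by (simp add: conv_j_i)
qed

text \<open>This is \<open>comult_hj\<close> at \<open>\<rho> a\<close>: the coproduct is
  \<open>g \<otimes> \<rho> a\<close>, the counit returns \<open>a\<close>, and
  \<open>h (g b)\<close> is \<open>q b\<close>. It exhibits \<open>A\<close> as spanned over
  \<open>B\<close> by the values of \<open>j\<close>.\<close>

lemma q_j_\<rho>:
  assumes a: "a \<in> carrier A"
  shows "tensor_lift A (\<lambda>b c. q b \<otimes>\<^bsub>A\<^esub> j c) (\<rho> a) = a"
proof -
  have "a = hj g (\<rho> a)"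
    using comult_hj[OF \<rho>_closed[OF a]] a
    by (simp add: ccomult_\<rho> XX.tensor_lift_pure[OF abelian_group_A hj_balanced] g_closed \<rho>_closed ccounit_\<rho>)
  also have "\<dots> = tensor_lift A (\<lambda>b c. q b \<otimes>\<^bsub>A\<^esub> j c) (\<rho> a)"
    unfolding hj_def
    by (rule AC.tensor_lift_cong[OF abelian_group_A hj_inner[OF g_closed] \<rho>_closed[OF a]])
      (simp add: q_def flip: \<rho>_eq)
  finally show ?thesis by simp
qed

text \<open>The map \<open>p\<close> of the overview.\<close>

definition proj :: "('a, 'm, ('a, 'c) tensors, 'e) comod_scheme \<Rightarrow> 'm \<Rightarrow> 'm" where
  "proj M m = tensor_lift M (\<lambda>n x. n \<triangleleft>\<^bsub>M\<^esub> h x) (coact M m)"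

text \<open>Under \<open>M \<otimes>\<^sub>A X = M \<otimes>\<^sub>k C\<close> the inverse of the counit \<open>n \<otimes> a \<mapsto> n a\<close> is
  \<open>m \<mapsto> m\<^sub>0 i(m\<^sub>1) \<otimes> j(m\<^sub>2)\<close>.\<close>

definition act_inv :: "('a, 'm, ('a, 'c) tensors, 'e) comod_scheme \<Rightarrow> 'm \<Rightarrow> ('m, 'a) tensors" where
  "act_inv M m = tensor_lift (ind (co M)) (\<lambda>n x. tensor_lift (ind (co M))
      (\<lambda>a c. proj M (n \<triangleleft>\<^bsub>M\<^esub> a) \<boxtimes>\<^bsub>ind (co M)\<^esub> j c) x) (coact M m)"

section \<open>Coinvariance of \<open>proj\<close> and invertibility of the counit, for a fixed
  comodule \<open>M\<close>\<close>

context
  fixes M :: "('a, 'm, ('a, 'c) tensors, 'e) comod_scheme"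
  assumes M: "coring_comodule A X M"
begin

abbreviation (input) "T \<equiv> ind (co M)"

lemma Mm: "right_module A M"
  by (rule coring_comodule.axioms(1)[OF M])

lemma Mg: "abelian_group M"
  by (rule right_module.axioms(2)[OF Mm])

lemma MX: "tensor_product (carrier A) M (ract M) X (lact X) (TX M)"
  by (rule tensor_product_X[OF Mm])

lemma T: "tensor_product B (co M) (ract (co M)) (regular_bimod A) (monoid.mult A) T"
  by (rule ind_tensor_product[OF coinv_right_module[OF M]])

lemmas M_coact = rmod_homD[OF coring_comodule.coact_hom[OF M]]
lemmas M_ract = right_module.ract_closed[OF Mm] right_module.ract_add_left[OF Mm] right_module.ract_add_right[OF Mm]
  right_module.ract_mult[OF Mm] right_module.ract_one[OF Mm]

lemma h_balanced: "balanced_map (carrier A) M (ract M) X (lact X) M (\<lambda>n x. n \<triangleleft>\<^bsub>M\<^esub> h x)"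
  by (rule balanced_lact_map[OF Mm h_additive h_lact])

lemma proj_additive: "proj M \<in> additive_maps M M"
  using additive_map_comp[OF M_coact(1) tensor_product.tensor_lift_additive[OF MX Mg h_balanced]]
  by (simp add: proj_def[abs_def])

lemma proj_closed: "m \<in> carrier M \<Longrightarrow> proj M m \<in> carrier M"
  by (rule additive_map_closed[OF proj_additive])

text \<open>\<open>proj\<close> is not linear over \<open>A\<close> in general; linearity of the
  coaction pushes \<open>a\<close> onto the last leg instead, which is the shape that
  \<open>hj\<close> absorbs.\<close>

lemma proj_ract:
  assumes m: "m \<in> carrier M" and a: "a \<in> carrier A"
  shows "proj M (m \<triangleleft>\<^bsub>M\<^esub> a) = tensor_lift M (\<lambda>n x. n \<triangleleft>\<^bsub>M\<^esub> h (x \<triangleleft>\<^bsub>X\<^esub> a)) (coact M m)"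
proof -
  have "tensor_lift M (\<lambda>n x. n \<triangleleft>\<^bsub>M\<^esub> h x) (coact M m \<triangleleft>\<^bsub>TX M\<^esub> a)
      = tensor_lift M (\<lambda>n x. n \<triangleleft>\<^bsub>M\<^esub> h (x \<triangleleft>\<^bsub>X\<^esub> a)) (coact M m)"
  proof (rule tensor_product.tensor_lift_unique[OF MX Mg _
        additive_map_comp[OF tensor_X_ract(1)[OF Mm a] tensor_product.tensor_lift_additive[OF MX Mg h_balanced]] M_coact(2)[OF m]])
    show "balanced_map (carrier A) M (ract M) X (lact X) M (\<lambda>n x. n \<triangleleft>\<^bsub>M\<^esub> h (x \<triangleleft>\<^bsub>X\<^esub> a))"
      by (rule balanced_lact_map[OF Mm additive_map_comp[OF X.additive_ract[OF a] h_additive]])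
        (simp add: a X.lact_ract h_lact X.ract_closed)
  qed (simp add: a tensor_X_ract(2)[OF Mm] tensor_product.tensor_lift_pure[OF MX Mg h_balanced] X.ract_closed)
  then show ?thesis
    by (simp add: proj_def M_coact m a)
qed

text \<open>The coaction of \<open>m0 h(m1)\<close> is \<open>m0 \<otimes> m1 h(m2)\<close> by
  linearity and coassociativity. Now \<open>comult_h\<close> gives
  \<open>m0 \<otimes> h(m1) g\<close>, and \<open>h(m1)\<close> crosses to the left.\<close>

lemma proj_co:
  assumes m: "m \<in> carrier M"
  shows "proj M m \<in> carrier (co M)"
proof -
  interpret MX: tensor_product "carrier A" M "ract M" X "lact X" "TX M" by (rule MX)
  note G = MX.abelian_group_T
  note t = M_coact(2)[OF m]
  let ?f = "\<lambda>n y z. n \<boxtimes>\<^bsub>TX M\<^esub> (y \<triangleleft>\<^bsub>X\<^esub> h z)"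
  have f: "balanced_map3 (carrier A) M (ract M) (lact X) X (carrier A) (ract X) X (lact X) (TX M) ?f"
    by (rule balanced_map3I)
      (simp_all add: MX.pure_closed MX.pure_add_left MX.pure_add_right X.ract_closed X.ract_add_left X.ract_add_right
        h_closed h_add MX.pure_balanced X.lact_ract h_lact X.ract_mult)
  have left: "tensor_lift (TX M) (?f n) (ccomult X x) = (n \<triangleleft>\<^bsub>M\<^esub> h x) \<boxtimes>\<^bsub>TX M\<^esub> g"
    if n: "n \<in> carrier M" and x: "x \<in> carrier X" for n x
  proof -
    have add: "(\<lambda>x. n \<boxtimes>\<^bsub>TX M\<^esub> x) \<in> additive_maps X (TX M)"
      using n by (intro additive_mapI) (simp_all add: MX.pure_closed MX.pure_add_right)
    have "tensor_lift (TX M) (?f n) (ccomult X x) = n \<boxtimes>\<^bsub>TX M\<^esub> tensor_lift X (\<lambda>y z. y \<triangleleft>\<^bsub>X\<^esub> h z) (ccomult X x)"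
      by (rule XX.additive_map_tensor_lift[OF AC.abelian_group_T G XX_h_balanced add, symmetric])
        (rule additive_map_closed[OF comult_additive x])
    then show ?thesis
      using n x by (simp add: comult_h MX.pure_balanced h_closed g_closed)
  qed
  have right: "tensor_lift (TX M) (\<lambda>n' y. ?f n' y z) (coact M n) = coact M (n \<triangleleft>\<^bsub>M\<^esub> h z)"
    if n: "n \<in> carrier M" and z: "z \<in> carrier X" for n z
  proof -
    have "coact M n \<triangleleft>\<^bsub>TX M\<^esub> h z = tensor_lift (TX M) (\<lambda>n' y. ?f n' y z) (coact M n)"
      by (rule MX.tensor_lift_unique[OF G balanced_map3D(7)[OF f z] tensor_X_ract(1)[OF Mm h_closed[OF z]] M_coact(2)[OF n]])
        (simp add: tensor_X_ract(2)[OF Mm h_closed[OF z]])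
    then show ?thesis
      using n z by (simp add: M_coact(4) h_closed)
  qed
  have pg: "(\<lambda>m. m \<boxtimes>\<^bsub>TX M\<^esub> g) \<in> additive_maps M (TX M)"
    by (intro additive_mapI) (simp_all add: MX.pure_closed MX.pure_add_left g_closed)
  have "proj M m \<boxtimes>\<^bsub>TX M\<^esub> g = tensor_lift (TX M) (\<lambda>n x. (n \<triangleleft>\<^bsub>M\<^esub> h x) \<boxtimes>\<^bsub>TX M\<^esub> g) (coact M m)"
    unfolding proj_def by (rule MX.additive_map_tensor_lift[OF Mg G h_balanced pg t])
  also have "\<dots> = tensor_lift (TX M) (\<lambda>n x. tensor_lift (TX M) (?f n) (ccomult X x)) (coact M m)"
    by (rule MX.tensor_lift_cong[symmetric, OF G balanced_comult[OF M G f] t left])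
  also have "\<dots> = tensor_lift (TX M) (\<lambda>n z. tensor_lift (TX M) (\<lambda>n' y. ?f n' y z) (coact M n)) (coact M m)"
    by (rule comodule_coassoc[OF M G f m])
  also have "\<dots> = tensor_lift (TX M) (\<lambda>n z. coact M (n \<triangleleft>\<^bsub>M\<^esub> h z)) (coact M m)"
    by (rule MX.tensor_lift_cong[OF G balanced_coact[OF M G f] t right])
  also have "\<dots> = coact M (proj M m)"
    unfolding proj_def by (rule MX.additive_map_tensor_lift[OF Mg G h_balanced M_coact(1) t, symmetric])
  finally show ?thesis
    using m by (simp add: coinv_sel proj_closed)
qed

text \<open>Linearity of \<open>proj\<close> over the image of \<open>k\<close>, as required for the
  integrand of \<open>act_inv\<close> to be balanced over \<open>k\<close>; \<open>h\<close>
  commutes with scalars because they are central on \<open>X\<close>.\<close>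

lemma proj_smult:
  assumes m: "m \<in> carrier M" and s: "s \<in> carrier k"
  shows "proj M (m \<triangleleft>\<^bsub>M\<^esub> (s \<odot>\<^bsub>A\<^esub> \<one>\<^bsub>A\<^esub>)) = proj M m \<triangleleft>\<^bsub>M\<^esub> (s \<odot>\<^bsub>A\<^esub> \<one>\<^bsub>A\<^esub>)"
proof -
  have s1: "s \<odot>\<^bsub>A\<^esub> \<one>\<^bsub>A\<^esub> \<in> carrier A" using s by (simp add: A_smult)
  have "proj M m \<triangleleft>\<^bsub>M\<^esub> (s \<odot>\<^bsub>A\<^esub> \<one>\<^bsub>A\<^esub>)
      = tensor_lift M (\<lambda>n x. (n \<triangleleft>\<^bsub>M\<^esub> h x) \<triangleleft>\<^bsub>M\<^esub> (s \<odot>\<^bsub>A\<^esub> \<one>\<^bsub>A\<^esub>)) (coact M m)"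
    unfolding proj_def
    by (rule tensor_product.additive_map_tensor_lift[OF MX Mg Mg h_balanced
          right_module.additive_ract[OF Mm s1] M_coact(2)[OF m]])
  also have "\<dots> = tensor_lift M (\<lambda>n x. n \<triangleleft>\<^bsub>M\<^esub> h (x \<triangleleft>\<^bsub>X\<^esub> (s \<odot>\<^bsub>A\<^esub> \<one>\<^bsub>A\<^esub>))) (coact M m)"
  proof (rule tensor_product.tensor_lift_cong[symmetric, OF MX Mg _ M_coact(2)[OF m]])
    show "balanced_map (carrier A) M (ract M) X (lact X) M (\<lambda>n x. n \<triangleleft>\<^bsub>M\<^esub> h (x \<triangleleft>\<^bsub>X\<^esub> (s \<odot>\<^bsub>A\<^esub> \<one>\<^bsub>A\<^esub>)))"
      by (rule balanced_lact_map[OF Mm additive_map_comp[OF X.additive_ract[OF s1] h_additive]])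
        (simp add: s1 X.lact_ract h_lact X.ract_closed)
  qed (simp add: s s1 h_scalar M_ract h_closed)
  finally show ?thesis
    using m s1 by (simp add: proj_ract)
qed

lemma act_inv_inner:
  assumes n: "n \<in> carrier M"
  shows "k_balanced k A C T (\<lambda>a c. proj M (n \<triangleleft>\<^bsub>M\<^esub> a) \<boxtimes>\<^bsub>T\<^esub> j c)"
proof -
  interpret T: tensor_product B "co M" "ract (co M)" "regular_bimod A" "monoid.mult A" T by (rule T)
  have eq: "n \<triangleleft>\<^bsub>M\<^esub> (s \<odot>\<^bsub>A\<^esub> a) = (n \<triangleleft>\<^bsub>M\<^esub> a) \<triangleleft>\<^bsub>M\<^esub> (s \<odot>\<^bsub>A\<^esub> \<one>\<^bsub>A\<^esub>)" if "s \<in> carrier k" "a \<in> carrier A" for s a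
    using n that by (simp add: A_smult smult_mult_right flip: M_ract(4))
  show ?thesis
  proof (rule balanced_mapI)
    fix a s c assume *: "a \<in> carrier A" "s \<in> carrier k" "c \<in> carrier C"
    have "proj M (n \<triangleleft>\<^bsub>M\<^esub> (s \<odot>\<^bsub>A\<^esub> a)) \<boxtimes>\<^bsub>T\<^esub> j c = (proj M (n \<triangleleft>\<^bsub>M\<^esub> a) \<triangleleft>\<^bsub>co M\<^esub> (s \<odot>\<^bsub>A\<^esub> \<one>\<^bsub>A\<^esub>)) \<boxtimes>\<^bsub>T\<^esub> j c"
      using * n by (simp add: eq proj_smult M_ract coinv_sel)
    \<comment> \<open>The element \<open>s 1\<close> lies in \<open>B\<close>, and the value of
      \<open>proj\<close> is coinvariant, so the scalar may cross the tensor sign over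
      \<open>B\<close>.\<close>
    also have "\<dots> = proj M (n \<triangleleft>\<^bsub>M\<^esub> a) \<boxtimes>\<^bsub>T\<^esub> ((s \<odot>\<^bsub>A\<^esub> \<one>\<^bsub>A\<^esub>) \<otimes>\<^bsub>A\<^esub> j c)"
      using * n by (intro T.pure_balanced) (simp_all add: proj_co M_ract scalar_B regular_bimod_sel j)
    also have "\<dots> = proj M (n \<triangleleft>\<^bsub>M\<^esub> a) \<boxtimes>\<^bsub>T\<^esub> j (s \<odot>\<^bsub>C\<^esub> c)"
      using * by (simp add: j smult_mult_left)
    finally show "proj M (n \<triangleleft>\<^bsub>M\<^esub> (s \<odot>\<^bsub>A\<^esub> a)) \<boxtimes>\<^bsub>T\<^esub> j c = proj M (n \<triangleleft>\<^bsub>M\<^esub> a) \<boxtimes>\<^bsub>T\<^esub> j (s \<odot>\<^bsub>C\<^esub> c)" .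
  qed (use n T.pure_add_left T.pure_add_right in \<open>simp_all add: T.pure_closed proj_co M_ract regular_bimod_sel j
      additive_map_add[OF proj_additive] coinv_sel(3)\<close>)
qed

lemma act_inv_balanced: "balanced_map (carrier A) M (ract M) X (lact X) T
    (\<lambda>n x. tensor_lift T (\<lambda>a c. proj M (n \<triangleleft>\<^bsub>M\<^esub> a) \<boxtimes>\<^bsub>T\<^esub> j c) x)"
proof -
  interpret T: tensor_product B "co M" "ract (co M)" "regular_bimod A" "monoid.mult A" T by (rule T)
  note pure = AC.tensor_lift_pure[OF T.abelian_group_T act_inv_inner]
  show ?thesis
  proof (rule AC.balanced_lift_right[OF T.abelian_group_T Mg act_inv_inner])
    show "\<And>b. b \<in> carrier A \<Longrightarrow> lact X b \<in> additive_maps X X"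
      by (rule X.additive_lact)
  qed (use T.pure_add_left in \<open>simp_all add: M_ract additive_map_add[OF proj_additive] proj_co
      regular_bimod_sel j lact_pure pure coinv_sel(3)\<close>)
qed

lemma act_inv_additive: "act_inv M \<in> additive_maps M T"
  using additive_map_comp[OF M_coact(1)
      tensor_product.tensor_lift_additive[OF MX tensor_product.abelian_group_T[OF T] act_inv_balanced]]
  by (simp add: act_inv_def[abs_def])

text \<open>The composite is \<open>m0 hj(m1, m2)\<close> after coassociativity;
  \<open>comult_hj\<close> reduces it to \<open>m0 \<epsilon>(m1)\<close>, and the counit axiom of
  \<open>M\<close> finishes.\<close>

lemma act_act_inv:
  assumes m: "m \<in> carrier M"
  shows "act M (act_inv M m) = m"
proof -
  interpret T: tensor_product B "co M" "ract (co M)" "regular_bimod A" "monoid.mult A" T by (rule T)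
  interpret MX: tensor_product "carrier A" M "ract M" X "lact X" "TX M" by (rule MX)
  note actM = rmod_homD(1)[OF comodule_homD(1)[OF act_hom[OF M]]]
  note t = M_coact(2)[OF m]
  let ?f = "\<lambda>n y z. n \<triangleleft>\<^bsub>M\<^esub> hj y z"
  have f: "balanced_map3 (carrier A) M (ract M) (lact X) X (carrier A) (ract X) X (lact X) M ?f"
    using balanced_mapD[OF hj_balanced]
    by (intro balanced_map3I) (simp_all add: M_ract hj_lact)
  \<comment> \<open>For \<open>x = a \<otimes> c\<close> both sides are
    \<open>n0 h(n1 a) j(c)\<close>.\<close>
  have right: "tensor_lift M (\<lambda>n' y. ?f n' y x) (coact M n)
      = act M (tensor_lift T (\<lambda>a c. proj M (n \<triangleleft>\<^bsub>M\<^esub> a) \<boxtimes>\<^bsub>T\<^esub> j c) x)"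
    if n: "n \<in> carrier M" and x: "x \<in> carrier X" for n x
  proof -
    have "(\<lambda>x. tensor_lift M (\<lambda>n' y. ?f n' y x) (coact M n)) \<in> additive_maps X M"
      using balanced_coact[OF M Mg f] n unfolding balanced_map_def by blast
    from this additive_map_comp[OF AC.tensor_lift_additive[OF T.abelian_group_T act_inv_inner[OF n]] actM] x
    show ?thesis
    proof (rule AC.additive_map_eqI)
      fix a c assume *: "a \<in> carrier A" "c \<in> carrier C"
      have hb: "balanced_map (carrier A) M (ract M) X (lact X) M (\<lambda>n x. n \<triangleleft>\<^bsub>M\<^esub> h (x \<triangleleft>\<^bsub>X\<^esub> a))"
        by (rule balanced_lact_map[OF Mm additive_map_comp[OF X.additive_ract[OF *(1)] h_additive]])
          (simp add: * X.lact_ract h_lact X.ract_closed)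
      have "act M (tensor_lift T (\<lambda>a c. proj M (n \<triangleleft>\<^bsub>M\<^esub> a) \<boxtimes>\<^bsub>T\<^esub> j c) (a \<boxtimes>\<^bsub>X\<^esub> c)) = proj M (n \<triangleleft>\<^bsub>M\<^esub> a) \<triangleleft>\<^bsub>M\<^esub> j c"
        using * n by (simp add: AC.tensor_lift_pure[OF T.abelian_group_T act_inv_inner] act_pure[OF M] proj_co M_ract j)
      also have "\<dots> = tensor_lift M (\<lambda>n' y. (n' \<triangleleft>\<^bsub>M\<^esub> h (y \<triangleleft>\<^bsub>X\<^esub> a)) \<triangleleft>\<^bsub>M\<^esub> j c) (coact M n)"
        unfolding proj_ract[OF n *(1)]
        by (rule MX.additive_map_tensor_lift[OF Mg Mg hb right_module.additive_ract[OF Mm j(2)[OF *(2)]] M_coact(2)[OF n]])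
      also have "\<dots> = tensor_lift M (\<lambda>n' y. ?f n' y (a \<boxtimes>\<^bsub>X\<^esub> c)) (coact M n)"
        by (rule MX.tensor_lift_cong[symmetric, OF Mg balanced_map3D(7)[OF f AC.pure_closed[OF *]] M_coact(2)[OF n]])
          (use * in \<open>simp add: hj_pure M_ract h_closed X.ract_closed j\<close>)
      finally show "tensor_lift M (\<lambda>n' y. ?f n' y (a \<boxtimes>\<^bsub>X\<^esub> c)) (coact M n)
          = act M (tensor_lift T (\<lambda>a c. proj M (n \<triangleleft>\<^bsub>M\<^esub> a) \<boxtimes>\<^bsub>T\<^esub> j c) (a \<boxtimes>\<^bsub>X\<^esub> c))" by simp
    qed
  qed
  have left: "tensor_lift M (?f n) (ccomult X x) = n \<triangleleft>\<^bsub>M\<^esub> ccounit X x"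
    if n: "n \<in> carrier M" and x: "x \<in> carrier X" for n x
  proof -
    have "(\<lambda>a. n \<triangleleft>\<^bsub>M\<^esub> a) \<in> additive_maps A M"
      using n by (intro additive_mapI) (simp_all add: M_ract)
    from XX.additive_map_tensor_lift[OF abelian_group_A Mg hj_balanced this additive_map_closed[OF comult_additive x]]
    show ?thesis
      using x by (simp add: comult_hj)
  qed
  have "act M (act_inv M m)
      = tensor_lift M (\<lambda>n x. act M (tensor_lift T (\<lambda>a c. proj M (n \<triangleleft>\<^bsub>M\<^esub> a) \<boxtimes>\<^bsub>T\<^esub> j c) x)) (coact M m)"
    unfolding act_inv_def
    by (rule MX.additive_map_tensor_lift[OF T.abelian_group_T Mg act_inv_balanced actM t])
  also have "\<dots> = tensor_lift M (\<lambda>n x. tensor_lift M (\<lambda>n' y. ?f n' y x) (coact M n)) (coact M m)"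
    by (rule MX.tensor_lift_cong[symmetric, OF Mg balanced_coact[OF M Mg f] t right])
  also have "\<dots> = tensor_lift M (\<lambda>n x. tensor_lift M (?f n) (ccomult X x)) (coact M m)"
    by (rule comodule_coassoc[OF M Mg f m, symmetric])
  also have "\<dots> = tensor_lift M (\<lambda>n x. n \<triangleleft>\<^bsub>M\<^esub> ccounit X x) (coact M m)"
    by (rule MX.tensor_lift_cong[OF Mg balanced_comult[OF M Mg f] t left])
  also have "\<dots> = m"
    by (rule coring_comodule.coact_counit[OF M m])
  finally show ?thesis .
qed

text \<open>For coinvariant \<open>n\<close> the coaction of \<open>n a\<close> is
  \<open>n \<otimes> \<rho> a\<close>, and \<open>proj\<close> sends \<open>n b\<close> to
  \<open>n q(b)\<close>. The result \<open>n q(a0) \<otimes> j(a1)\<close> equals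
  \<open>n \<otimes> q(a0) j(a1)\<close>, as \<open>q\<close> has values in \<open>B\<close>, and
  \<open>q_j_\<rho>\<close> applies.\<close>

lemma act_inv_act:
  assumes t: "t \<in> carrier T"
  shows "act_inv M (act M t) = t"
proof -
  interpret T: tensor_product B "co M" "ract (co M)" "regular_bimod A" "monoid.mult A" T by (rule T)
  interpret MX: tensor_product "carrier A" M "ract M" X "lact X" "TX M" by (rule MX)
  note actM = rmod_homD(1)[OF comodule_homD(1)[OF act_hom[OF M]]]
  have "act_inv M (act M t) = id t"
  proof (rule T.additive_map_eqI[OF additive_map_comp[OF actM act_inv_additive] additive_map_id t])
    fix n a assume "n \<in> carrier (co M)" "a \<in> carrier (regular_bimod A)"
    then have n: "n \<in> carrier (co M)" "n \<in> carrier M" "coact M n = n \<boxtimes>\<^bsub>TX M\<^esub> g" and a: "a \<in> carrier A"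
      by (simp_all add: coinv_sel regular_bimod_sel)
    have coact: "coact M (n \<triangleleft>\<^bsub>M\<^esub> b) = n \<boxtimes>\<^bsub>TX M\<^esub> \<rho> b" if "b \<in> carrier A" for b
      using that n(2,3) by (simp add: M_coact(4) tensor_X_ract(2)[OF Mm] g_closed \<rho>_eq[of b])
    have proj: "proj M (n \<triangleleft>\<^bsub>M\<^esub> b) = n \<triangleleft>\<^bsub>M\<^esub> q b" if "b \<in> carrier A" for b
      using that n(2) by (simp add: proj_def coact MX.tensor_lift_pure[OF Mg h_balanced] \<rho>_closed q_def)
    have add: "(\<lambda>b. n \<boxtimes>\<^bsub>T\<^esub> b) \<in> additive_maps A T"
      using n(1) T.pure_add_right T.pure_closed by (intro additive_mapI) (simp_all add: regular_bimod_sel)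
    have qj: "k_balanced k A C A (\<lambda>b c. q b \<otimes>\<^bsub>A\<^esub> j c)"
      by (rule balanced_mapI)
        (simp_all add: q_closed q_add q_smult j A.l_distr A.r_distr smult_mult_left smult_mult_right)
    have "act_inv M (act M (n \<boxtimes>\<^bsub>T\<^esub> a)) = tensor_lift T (\<lambda>b c. proj M (n \<triangleleft>\<^bsub>M\<^esub> b) \<boxtimes>\<^bsub>T\<^esub> j c) (\<rho> a)"
      using n a by (simp add: act_pure[OF M] act_inv_def coact MX.tensor_lift_pure[OF T.abelian_group_T act_inv_balanced] \<rho>_closed)
    also have "\<dots> = tensor_lift T (\<lambda>b c. n \<boxtimes>\<^bsub>T\<^esub> (q b \<otimes>\<^bsub>A\<^esub> j c)) (\<rho> a)"
    proof (rule AC.tensor_lift_cong[OF T.abelian_group_T act_inv_inner[OF n(2)] \<rho>_closed[OF a]])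
      fix b c assume "b \<in> carrier A" "c \<in> carrier C"
      then show "proj M (n \<triangleleft>\<^bsub>M\<^esub> b) \<boxtimes>\<^bsub>T\<^esub> j c = n \<boxtimes>\<^bsub>T\<^esub> (q b \<otimes>\<^bsub>A\<^esub> j c)"
        using T.pure_balanced[OF n(1) q_B, of b "j c"] by (simp add: proj coinv_sel(4) regular_bimod_sel j)
    qed
    also have "\<dots> = n \<boxtimes>\<^bsub>T\<^esub> tensor_lift A (\<lambda>b c. q b \<otimes>\<^bsub>A\<^esub> j c) (\<rho> a)"
      by (rule AC.additive_map_tensor_lift[OF abelian_group_A T.abelian_group_T qj add \<rho>_closed[OF a], symmetric])
    finally show "act_inv M (act M (n \<boxtimes>\<^bsub>T\<^esub> a)) = id (n \<boxtimes>\<^bsub>T\<^esub> a)"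
      using a by (simp add: q_j_\<rho>)
  qed
  then show ?thesis by simp
qed

lemma bij_betw_act: "bij_betw (act M) (carrier T) (carrier M)"
  by (rule bij_betw_byWitness[of _ "act_inv M"])
    (auto simp: act_inv_act act_act_inv additive_map_closed[OF act_inv_additive]
      rmod_homD(2)[OF comodule_homD(1)[OF act_hom[OF M]]])

end

end

section \<open>Bijectivity of the unit\<close>

lemma additive_map_finsum:
  assumes M: "abelian_group M" and N: "abelian_group N" and f: "f \<in> additive_maps M N"
    and "finite I" "\<And>i. i \<in> I \<Longrightarrow> x i \<in> carrier M"
  shows "f (finsum M x I) = finsum N (\<lambda>i. f (x i)) I"
proof -
  interpret M: abelian_group M by (rule M)
  interpret N: abelian_group N by (rule N)
  show ?thesis
    using assms(4,5)
  proof (induction I)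
    case empty
    show ?case by (simp add: additive_map_zero[OF M N f])
  next
    case (insert i I)
    then show ?case
      by (simp add: additive_map_add[OF f] additive_map_closed[OF f] M.finsum_closed)
  qed
qed

lemma finsum_restrict_carrier:
  assumes A: "abelian_group A" and B: "abelian_group (A\<lparr>carrier := B\<rparr>)" and sub: "B \<subseteq> carrier A"
    and "finite I" "\<And>i. i \<in> I \<Longrightarrow> x i \<in> B"
  shows "finsum (A\<lparr>carrier := B\<rparr>) x I = finsum A x I"
proof -
  interpret A: abelian_group A by (rule A)
  interpret B: abelian_group "A\<lparr>carrier := B\<rparr>" by (rule B)
  show ?thesis
    using assms(4,5)
  proof (induction I)
    case empty
    show ?case by simp
  next
    case (insert i I)
    then have "finsum (A\<lparr>carrier := B\<rparr>) x (insert i I) = x i \<oplus>\<^bsub>A\<^esub> finsum (A\<lparr>carrier := B\<rparr>) x I"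
      by (subst B.finsum_insert) auto
    also have "\<dots> = finsum A x (insert i I)"
      using insert sub by (subst A.finsum_insert) auto
    finally show ?case .
  qed
qed

text \<open>A class is the coset of any of its elements, so the encoded representative determines
  it.\<close>

lemma (in tensor_product) inj_on_tensor_code:
  assumes "inj enc"
  shows "inj_on (tensor_code enc) (carrier T)"
proof (rule inj_onI)
  fix t u assume t: "t \<in> carrier T" and u: "u \<in> carrier T" and eq: "tensor_code enc t = tensor_code enc u"
  define p where "p = (SOME p. p \<in> t)"
  have rep: "(SOME p. p \<in> t) \<in> t \<and> t = relations #>\<^bsub>F\<^esub> (SOME p. p \<in> t)" if "t \<in> carrier T" for t
  proof -
    obtain r where r: "r \<in> carrier F" "t = relations #>\<^bsub>F\<^esub> r"
      by (rule carrierE[OF \<open>t \<in> carrier T\<close>])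
    have sub: "subgroup relations F" using relations_normal by (rule normal_imp_subgroup)
    have "r \<in> t"
      using group.rcos_self[OF group_free_Abelian_group r(1) sub] by (simp add: r)
    then have "(SOME p. p \<in> t) \<in> t" by (rule someI)
    then show ?thesis
      using group.repr_independence[OF group_free_Abelian_group _ r(1) sub] r(2) by auto
  qed
  have "p = (SOME p. p \<in> u)"
    using eq injD[OF assms] by (simp add: tensor_code_def p_def)
  then show "t = u"
    using rep[OF t] rep[OF u] by (simp add: p_def)
qed

section \<open>Functoriality of induction and coinvariants, unit and counit\<close>

context cleft_extension
begin

abbreviation "BR \<equiv> A\<lparr>carrier := B\<rparr>"

lemma
  assumes N: "right_module BR N" and N': "right_module BR N'" and f: "f \<in> rmod_hom BR N N'"
  shows ind_map_hom: "tensor_map (ind N') f id \<in> comodule_hom A X (ind N) (ind N')"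
    and ind_map_pure: "\<lbrakk>n \<in> carrier N; a \<in> carrier A\<rbrakk> \<Longrightarrow> tensor_map (ind N') f id (n \<boxtimes>\<^bsub>ind N\<^esub> a) = f n \<boxtimes>\<^bsub>ind N'\<^esub> a"
proof -
  let ?T = "ind N" and ?T' = "ind N'"
  interpret T: tensor_product B N "ract N" "regular_bimod A" "monoid.mult A" ?T by (rule ind_tensor_product[OF N])
  interpret T': tensor_product B N' "ract N'" "regular_bimod A" "monoid.mult A" ?T' by (rule ind_tensor_product[OF N'])
  have fb: "f (n \<triangleleft>\<^bsub>N\<^esub> b) = f n \<triangleleft>\<^bsub>N'\<^esub> b" if "n \<in> carrier N" "b \<in> B" for n b
    using rmod_homD(4)[OF f] that by simp
  have Tm: "right_module A ?T" "right_module A ?T'" by (rule ind_right_module[OF N], rule ind_right_module[OF N'])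
  note map = T.tensor_map_additive[OF T'.tensor_product_axioms rmod_homD(1)[OF f] fb additive_map_id]
    T.tensor_map_pure[OF T'.tensor_product_axioms rmod_homD(1)[OF f] fb additive_map_id]
  have add: "tensor_map ?T' f id \<in> additive_maps ?T ?T'"
    by (rule map(1)) auto
  show pure: "tensor_map ?T' f id (n \<boxtimes>\<^bsub>?T\<^esub> a) = f n \<boxtimes>\<^bsub>?T'\<^esub> a" if "n \<in> carrier N" "a \<in> carrier A" for n a
    using map(2)[of n a] that by (simp add: regular_bimod_sel)
  have hom: "tensor_map ?T' f id \<in> rmod_hom A ?T ?T'"
  proof (rule rmod_homI[OF add])
    fix t a assume t: "t \<in> carrier ?T" and a: "a \<in> carrier A"
    show "tensor_map ?T' f id (t \<triangleleft>\<^bsub>?T\<^esub> a) = tensor_map ?T' f id t \<triangleleft>\<^bsub>?T'\<^esub> a"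
      by (rule T.additive_map_eqI[OF additive_map_comp[OF right_module.additive_ract[OF Tm(1) a] add]
            additive_map_comp[OF add right_module.additive_ract[OF Tm(2) a]] t])
        (simp add: regular_bimod_sel ind_ract_pure[OF N] ind_ract_pure[OF N'] a pure rmod_homD(2)[OF f])
  qed
  note mapX = tensor_map_X_hom[OF Tm hom] tensor_map_X_pure[OF Tm hom]
  show "tensor_map ?T' f id \<in> comodule_hom A X ?T ?T'"
  proof (rule comodule_homI[OF hom])
    fix t assume t: "t \<in> carrier ?T"
    show "coact ?T' (tensor_map ?T' f id t)
        = tensor_map (TX ?T') (tensor_map ?T' f id) id (coact ?T t)"
    proof (rule T.additive_map_eqI[OF additive_map_comp[OF add rmod_homD(1)[OF ind_coact_hom[OF N']]]
          additive_map_comp[OF rmod_homD(1)[OF ind_coact_hom[OF N]] rmod_homD(1)[OF mapX(1)]] t])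
      fix n a assume *: "n \<in> carrier N" "a \<in> carrier (regular_bimod A)"
      then have "n \<boxtimes>\<^bsub>?T\<^esub> \<one>\<^bsub>A\<^esub> \<in> carrier ?T"
        by (simp add: T.pure_closed regular_bimod_sel)
      then show "coact ?T' (tensor_map ?T' f id (n \<boxtimes>\<^bsub>?T\<^esub> a))
          = tensor_map (TX ?T') (tensor_map ?T' f id) id (coact ?T (n \<boxtimes>\<^bsub>?T\<^esub> a))"
        using * rmod_homD(2)[OF f]
        by (simp add: regular_bimod_sel pure ind_coact_pure[OF N] ind_coact_pure[OF N'] mapX(2) \<rho>_closed)
    qed
  qed
qed

lemma ind_map_cong:
  assumes N: "right_module BR N" and N': "right_module BR N'" and f: "f \<in> rmod_hom BR N N'"
    and eq: "\<And>n. n \<in> carrier N \<Longrightarrow> f n = f' n" and t: "t \<in> carrier (ind N)"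
  shows "tensor_map (ind N') f id t = tensor_map (ind N') f' id t"
proof -
  note f' = rmod_hom_cong[OF N f eq]
  note add = rmod_homD(1)[OF comodule_homD(1)[OF ind_map_hom[OF N N' f]]]
    rmod_homD(1)[OF comodule_homD(1)[OF ind_map_hom[OF N N' f']]]
  show ?thesis
    by (rule tensor_product.additive_map_eqI[OF ind_tensor_product[OF N] add t])
      (simp_all add: regular_bimod_sel ind_map_pure[OF N N' f] ind_map_pure[OF N N' f'] eq)
qed

lemma ind_map_comp:
  assumes N: "right_module BR L" "right_module BR N" "right_module BR N'"
    and f: "f \<in> rmod_hom BR L N" and f': "f' \<in> rmod_hom BR N N'" and t: "t \<in> carrier (ind L)"
  shows "tensor_map (ind N') f' id (tensor_map (ind N) f id t) = tensor_map (ind N') (\<lambda>n. f' (f n)) id t"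
proof -
  note ff = rmod_hom_comp[OF f f']
  note add = rmod_homD(1)[OF comodule_homD(1)[OF ind_map_hom[OF N(1,2) f]]]
    rmod_homD(1)[OF comodule_homD(1)[OF ind_map_hom[OF N(2,3) f']]]
    rmod_homD(1)[OF comodule_homD(1)[OF ind_map_hom[OF N(1,3) ff]]]
  show ?thesis
    by (rule tensor_product.additive_map_eqI[OF ind_tensor_product[OF N(1)] additive_map_comp[OF add(1,2)] add(3) t])
      (simp_all add: regular_bimod_sel ind_map_pure[OF N(1,2) f] ind_map_pure[OF N(2,3) f'] ind_map_pure[OF N(1,3) ff]
        rmod_homD(2)[OF f])
qed

lemma ind_map_id:
  assumes N: "right_module BR N" and t: "t \<in> carrier (ind N)"
  shows "tensor_map (ind N) (\<lambda>n. n) id t = t"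
proof -
  have id: "(\<lambda>n. n) \<in> rmod_hom BR N N"
    by (auto intro!: rmod_homI additive_mapI)
  have "tensor_map (ind N) (\<lambda>n. n) id t = id t"
    by (rule tensor_product.additive_map_eqI[OF ind_tensor_product[OF N]
          rmod_homD(1)[OF comodule_homD(1)[OF ind_map_hom[OF N N id]]] additive_map_id t])
      (simp add: regular_bimod_sel ind_map_pure[OF N N id])
  then show ?thesis by simp
qed

lemma comodule_hom_co:
  assumes M: "coring_comodule A X M" and M': "coring_comodule A X M'" and f: "f \<in> comodule_hom A X M M'"
  shows "f \<in> rmod_hom BR (co M) (co M')"
proof -
  note Mm = coring_comodule.axioms(1)[OF M] coring_comodule.axioms(1)[OF M']
  note fr = comodule_homD(1)[OF f]
  have "f m \<in> carrier (co M')" if "m \<in> carrier (co M)" for m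
    using that by (simp add: coinv_sel rmod_homD(2)[OF fr] comodule_homD(2)[OF f] tensor_map_X_pure[OF Mm fr] g_closed)
  then show ?thesis
    by (intro rmod_homI additive_mapI) (simp_all add: coinv_sel rmod_homD(3,4)[OF fr] B_carrier)
qed

text \<open>The inverse of a bijective comodule map is a comodule map too, so coinvariants are
  preserved in both directions.\<close>

lemma bij_betw_co:
  assumes M: "coring_comodule A X M" and M': "coring_comodule A X M'" and f: "f \<in> comodule_hom A X M M'"
    and bij: "bij_betw f (carrier M) (carrier M')"
  shows "bij_betw f (carrier (co M)) (carrier (co M'))"
proof -
  note inv = comodule_hom_inv_into[OF M M' f bij]
  show ?thesis
    by (rule bij_betw_byWitness[of _ "inv_into (carrier M) f"])
      (use bij rmod_homD(2)[OF comodule_hom_co[OF M M' f]] rmod_homD(2)[OF comodule_hom_co[OF M' M inv]]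
       in \<open>auto simp: coinv_sel(1) bij_betw_inv_into_left bij_betw_inv_into_right\<close>)
qed

text \<open>\<open>n \<otimes> 1\<close> is coinvariant because its coaction is
  \<open>(n \<otimes> 1) \<otimes> \<rho> 1\<close>; linearity is
  \<open>n b \<otimes> 1 = n \<otimes> b\<close>.\<close>

lemma unit_hom:
  assumes N: "right_module BR N"
  shows "(\<lambda>n. n \<boxtimes>\<^bsub>ind N\<^esub> \<one>\<^bsub>A\<^esub>) \<in> rmod_hom BR N (co (ind N))"
proof -
  interpret T: tensor_product B N "ract N" "regular_bimod A" "monoid.mult A" "ind N" by (rule ind_tensor_product[OF N])
  have cl: "n \<boxtimes>\<^bsub>ind N\<^esub> \<one>\<^bsub>A\<^esub> \<in> carrier (co (ind N))" if "n \<in> carrier N" for n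
    using that by (simp add: coinv_sel T.pure_closed regular_bimod_sel ind_coact_pure[OF N])
  show ?thesis
  proof (intro rmod_homI additive_mapI cl)
    fix n b assume "n \<in> carrier N" "b \<in> carrier BR"
    then show "(n \<triangleleft>\<^bsub>N\<^esub> b) \<boxtimes>\<^bsub>ind N\<^esub> \<one>\<^bsub>A\<^esub> = (n \<boxtimes>\<^bsub>ind N\<^esub> \<one>\<^bsub>A\<^esub>) \<triangleleft>\<^bsub>co (ind N)\<^esub> b"
      using T.pure_balanced[of n b "\<one>\<^bsub>A\<^esub>"] by (simp add: coinv_sel ind_ract_pure[OF N] B_carrier regular_bimod_sel)
  qed (simp_all add: coinv_sel T.pure_add_left regular_bimod_sel)
qed

text \<open>On \<open>n \<otimes> a\<close> this is right linearity of \<open>f\<close>.\<close>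

lemma act_naturality:
  assumes M: "coring_comodule A X M" and M': "coring_comodule A X M'" and f: "f \<in> comodule_hom A X M M'"
    and t: "t \<in> carrier (ind (co M))"
  shows "act M' (tensor_map (ind (co M')) f id t) = f (act M t)"
proof -
  note co = coinv_right_module[OF M] coinv_right_module[OF M']
  note fB = comodule_hom_co[OF M M' f]
  note add = rmod_homD(1)[OF comodule_homD(1)[OF ind_map_hom[OF co fB]]] rmod_homD(1)[OF comodule_homD(1)[OF act_hom[OF M']]]
    rmod_homD(1)[OF comodule_homD(1)[OF act_hom[OF M]]] rmod_homD(1)[OF comodule_homD(1)[OF f]]
  show ?thesis
    by (rule tensor_product.additive_map_eqI[OF ind_tensor_product[OF co(1)] additive_map_comp[OF add(1,2)]
          additive_map_comp[OF add(3,4)] t])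
      (simp add: regular_bimod_sel ind_map_pure[OF co fB] act_pure[OF M] act_pure[OF M'] rmod_homD(2)[OF fB]
        rmod_homD(4)[OF comodule_homD(1)[OF f]] coinv_sel(1)[of _ A X g M])
qed

end

section \<open>Left linear functionals from \<open>A\<close> to \<open>B\<close>, and the inverse of
  the unit\<close>

context cleaving
begin

text \<open>The functional \<open>\<phi>\<^sub>l\<close> of the overview is
  \<open>phi (v l)\<close>. Inserting \<open>v\<close> for \<open>j\<close> in the recovery formula
  \<open>q_j_\<rho>\<close> produces it.\<close>

definition phi :: "('c \<Rightarrow> 'a) \<Rightarrow> 'a \<Rightarrow> 'a" where
  "phi v a = tensor_lift A (\<lambda>b c. q b \<otimes>\<^bsub>A\<^esub> v c) (\<rho> a)"

definition contract :: "('c \<Rightarrow> 'a) \<Rightarrow> ('a, 'n, 'e) rmod_scheme \<Rightarrow> ('n, 'a) tensors \<Rightarrow> 'n" where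
  "contract v N = tensor_lift N (\<lambda>n a. n \<triangleleft>\<^bsub>N\<^esub> phi v a)"

context
  fixes v assumes v: "v \<in> kmod_hom k C BR"
begin

lemma v_hom_A: "v \<in> kmod_hom k C A"
  using v B_subset by (auto simp: kmod_hom_def hom_def)

lemma v_B: "c \<in> carrier C \<Longrightarrow> v c \<in> B"
  using kmod_homD(2)[OF v] by simp

lemma phi_balanced: "k_balanced k A C A (\<lambda>b c. q b \<otimes>\<^bsub>A\<^esub> v c)"
  by (rule balanced_mapI)
    (simp_all add: q_closed q_add q_smult kmod_homD[OF v_hom_A] A.l_distr A.r_distr smult_mult_left smult_mult_right)

lemma phi_additive: "phi v \<in> additive_maps A A"
  using additive_map_comp[OF \<rho>_additive AC.tensor_lift_additive[OF abelian_group_A phi_balanced]]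
  by (simp add: phi_def[abs_def])

text \<open>Both factors \<open>q b\<close> and \<open>v c\<close> lie in the subring
  \<open>B\<close>; this reaches all of \<open>X\<close> by additivity.\<close>

lemma phi_B:
  assumes a: "a \<in> carrier A"
  shows "phi v a \<in> B"
proof -
  have "tensor_lift A (\<lambda>b c. q b \<otimes>\<^bsub>A\<^esub> v c) x \<in> B" if "x \<in> carrier X" for x
    using that
    by (induction x rule: AC.tensor_induct)
      (simp_all add: AC.tensor_lift_pure[OF abelian_group_A phi_balanced]
        AC.tensor_lift_add[OF abelian_group_A phi_balanced] B_mult B_add q_B v_B)
  then show ?thesis
    using a by (simp add: phi_def \<rho>_closed)
qed

lemma phi_lact:
  assumes b: "b \<in> B" and a: "a \<in> carrier A"
  shows "phi v (b \<otimes>\<^bsub>A\<^esub> a) = b \<otimes>\<^bsub>A\<^esub> phi v a"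
proof -
  note bA = B_carrier[OF b]
  have mul: "(\<lambda>x. b \<otimes>\<^bsub>A\<^esub> x) \<in> additive_maps A A"
    using bA by (intro additive_mapI) (simp_all add: A.r_distr)
  note lift = AC.tensor_lift_additive[OF abelian_group_A phi_balanced]
  have "tensor_lift A (\<lambda>b c. q b \<otimes>\<^bsub>A\<^esub> v c) (b \<triangleright>\<^bsub>X\<^esub> x) = b \<otimes>\<^bsub>A\<^esub> tensor_lift A (\<lambda>b c. q b \<otimes>\<^bsub>A\<^esub> v c) x"
    if x: "x \<in> carrier X" for x
    by (rule AC.additive_map_eqI[OF additive_map_comp[OF X.additive_lact[OF bA] lift] additive_map_comp[OF lift mul] x])
      (simp add: lact_pure bA b AC.tensor_lift_pure[OF abelian_group_A phi_balanced] q_lact A.m_assoc q_closed kmod_homD[OF v_hom_A])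
  then show ?thesis
    using a b by (simp add: phi_def \<rho>_B \<rho>_closed)
qed

text \<open>Colinearity of \<open>j\<close> and \<open>q_j\<close> give
  \<open>q (j(c1)) v(c2) = \<epsilon>(c1) v(c2)\<close>, which is \<open>v c\<close> by the counit
  axiom.\<close>

lemma phi_j:
  assumes c: "c \<in> carrier C"
  shows "phi v (j c) = v c"
proof -
  note cc = comult_closed[OF c]
  note lift = AC.tensor_lift_additive[OF abelian_group_A phi_balanced]
  have "phi v (j c) = tensor_lift A (\<lambda>x y. tensor_lift A (\<lambda>b c. q b \<otimes>\<^bsub>A\<^esub> v c) (j x \<boxtimes>\<^bsub>X\<^esub> y)) (comult C c)"
    unfolding phi_def \<rho>_j[OF c]
    by (rule CC.additive_map_tensor_lift[OF AC.abelian_group_T abelian_group_A j_pure_balanced lift cc])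
  also have "\<dots> = tensor_lift A (\<lambda>x y. v (counit C x \<odot>\<^bsub>C\<^esub> y)) (comult C c)"
  proof (rule CC.tensor_lift_cong[symmetric, OF abelian_group_A _ cc])
    show "k_balanced k C C A (\<lambda>x y. v (counit C x \<odot>\<^bsub>C\<^esub> y))"
      using balanced_mapD[OF k_balanced_counit_left[OF module_C]]
      by (intro balanced_mapI) (simp_all add: kmod_homD[OF v_hom_A])
  qed (simp add: AC.tensor_lift_pure[OF abelian_group_A phi_balanced] j q_j kmod_homD[OF v_hom_A] counit_closed smult_mult_left)
  also have "\<dots> = v (tensor_lift C (\<lambda>x y. counit C x \<odot>\<^bsub>C\<^esub> y) (comult C c))"
    by (rule CC.additive_map_tensor_lift[OF abelian_group_C abelian_group_A k_balanced_counit_left[OF module_C]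
          kmod_homD(1)[OF v_hom_A] cc, symmetric])
  also have "\<dots> = v c"
    using c by (simp add: counit_left)
  finally show ?thesis .
qed

lemma
  assumes N: "right_module BR N"
  shows contract_additive: "contract v N \<in> additive_maps (ind N) N"
    and contract_pure: "\<lbrakk>n \<in> carrier N; a \<in> carrier A\<rbrakk> \<Longrightarrow> contract v N (n \<boxtimes>\<^bsub>ind N\<^esub> a) = n \<triangleleft>\<^bsub>N\<^esub> phi v a"
proof -
  interpret T: tensor_product B N "ract N" "regular_bimod A" "monoid.mult A" "ind N" by (rule ind_tensor_product[OF N])
  note N' = right_module.ract_closed[OF N] right_module.ract_add_left[OF N] right_module.ract_add_right[OF N]
    right_module.ract_mult[OF N]
  have Ng: "abelian_group N" by (rule right_module.axioms(2)[OF N])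
  have bal: "balanced_map B N (ract N) (regular_bimod A) (monoid.mult A) N (\<lambda>n a. n \<triangleleft>\<^bsub>N\<^esub> phi v a)"
    using N' by (intro balanced_mapI) (simp_all add: regular_bimod_sel phi_B phi_lact additive_map_add[OF phi_additive])
  show "contract v N \<in> additive_maps (ind N) N"
    unfolding contract_def by (rule T.tensor_lift_additive[OF Ng bal])
  show "\<lbrakk>n \<in> carrier N; a \<in> carrier A\<rbrakk> \<Longrightarrow> contract v N (n \<boxtimes>\<^bsub>ind N\<^esub> a) = n \<triangleleft>\<^bsub>N\<^esub> phi v a"
    unfolding contract_def by (rule T.tensor_lift_pure[OF Ng bal]) (simp_all add: regular_bimod_sel)
qed

text \<open>Injectivity of \<open>act\<close> identifies \<open>t \<otimes> a\<close> with the image of \<open>t a\<close> under \<open>\<eta> \<otimes> A\<close>, where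
  \<open>\<eta>\<close> is the unit; contracting both with \<open>phi v\<close> shows that \<open>t phi v a\<close> lies in the image of \<open>\<eta>\<close>.\<close>

lemma contract_coinvariant:
  assumes N: "right_module BR N" and t: "t \<in> carrier (co (ind N))" and a: "a \<in> carrier A"
  shows "t \<triangleleft>\<^bsub>ind N\<^esub> phi v a = contract v N (t \<triangleleft>\<^bsub>ind N\<^esub> a) \<boxtimes>\<^bsub>ind N\<^esub> \<one>\<^bsub>A\<^esub>"
proof -
  let ?M = "ind N"
  let ?T = "ind (co ?M)" and ?\<eta> = "\<lambda>n. n \<boxtimes>\<^bsub>ind N\<^esub> \<one>\<^bsub>A\<^esub>"
  have M: "coring_comodule A X ?M" by (rule ind_comodule[OF N])
  have co: "right_module BR (co ?M)" by (rule coinv_right_module[OF M])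
  have Mm: "right_module A ?M" by (rule ind_right_module[OF N])
  interpret M: tensor_product B N "ract N" "regular_bimod A" "monoid.mult A" ?M by (rule ind_tensor_product[OF N])
  interpret T: tensor_product B "co ?M" "ract (co ?M)" "regular_bimod A" "monoid.mult A" ?T by (rule ind_tensor_product[OF co])
  note \<eta> = unit_hom[OF N]
  note F\<eta> = rmod_homD(1)[OF comodule_homD(1)[OF ind_map_hom[OF N co \<eta>]]] ind_map_pure[OF N co \<eta>]
  note actM = rmod_homD(1)[OF comodule_homD(1)[OF act_hom[OF M]]]
  have tM: "t \<in> carrier ?M" using t by (simp add: coinv_sel)
  have ta: "t \<triangleleft>\<^bsub>?M\<^esub> a \<in> carrier ?M" by (rule right_module.ract_closed[OF Mm tM a])
  \<comment> \<open>The triangle identity: \<open>\<eta> \<otimes> A\<close> followed by the counit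
    is the identity of \<open>ind N\<close>.\<close>
  have id: "act ?M (tensor_map ?T ?\<eta> id u) = u" if u: "u \<in> carrier ?M" for u
  proof -
    have "act ?M (tensor_map ?T ?\<eta> id u) = id u"
      by (rule M.additive_map_eqI[OF additive_map_comp[OF F\<eta>(1) actM] additive_map_id u])
        (simp add: regular_bimod_sel F\<eta>(2) act_pure[OF M] rmod_homD(2)[OF \<eta>] ind_ract_pure[OF N])
    then show ?thesis by simp
  qed
  have "act ?M (t \<boxtimes>\<^bsub>?T\<^esub> a) = act ?M (tensor_map ?T ?\<eta> id (t \<triangleleft>\<^bsub>?M\<^esub> a))"
    using ta by (simp add: id act_pure[OF M t a])
  moreover have "t \<boxtimes>\<^bsub>?T\<^esub> a \<in> carrier ?T"
    using t a by (simp add: T.pure_closed regular_bimod_sel)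
  moreover have "tensor_map ?T ?\<eta> id (t \<triangleleft>\<^bsub>?M\<^esub> a) \<in> carrier ?T"
    by (rule additive_map_closed[OF F\<eta>(1) ta])
  ultimately have eq: "t \<boxtimes>\<^bsub>?T\<^esub> a = tensor_map ?T ?\<eta> id (t \<triangleleft>\<^bsub>?M\<^esub> a)"
    using bij_betw_act[OF M] by (auto simp: bij_betw_def dest: inj_onD)
  \<comment> \<open>Naturality of \<open>contract\<close> along the unit: on
    \<open>n \<otimes> b\<close> both sides are \<open>n phi(b) \<otimes> 1\<close>.\<close>
  have "contract v (co ?M) (tensor_map ?T ?\<eta> id u) = ?\<eta> (contract v N u)" if u: "u \<in> carrier ?M" for u
  proof (rule M.additive_map_eqI[OF additive_map_comp[OF F\<eta>(1) contract_additive[OF co]]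
        additive_map_comp[OF contract_additive[OF N] rmod_homD(1)[OF \<eta>]] u])
    fix n b assume *: "n \<in> carrier N" "b \<in> carrier (regular_bimod A)"
    then have "contract v (co ?M) (tensor_map ?T ?\<eta> id (n \<boxtimes>\<^bsub>?M\<^esub> b)) = ?\<eta> n \<triangleleft>\<^bsub>co ?M\<^esub> phi v b"
      by (simp add: regular_bimod_sel F\<eta>(2) contract_pure[OF co] rmod_homD(2)[OF \<eta>])
    also have "\<dots> = ?\<eta> (contract v N (n \<boxtimes>\<^bsub>?M\<^esub> b))"
      using * rmod_homD(4)[OF \<eta>, of n "phi v b"] by (simp add: regular_bimod_sel contract_pure[OF N] phi_B)
    finally show "contract v (co ?M) (tensor_map ?T ?\<eta> id (n \<boxtimes>\<^bsub>?M\<^esub> b)) = ?\<eta> (contract v N (n \<boxtimes>\<^bsub>?M\<^esub> b))" .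
  qed
  from this[OF ta] show ?thesis
    using contract_pure[OF co t a] by (simp add: eq coinv_sel(4))
qed

end

text \<open>The generator property in explicit form. The values
  \<open>v l (d l) = phi (v l) (j (d l))\<close> sum to \<open>1\<close>, so contracting
  \<open>t j(d l)\<close> with \<open>phi (v l)\<close> and summing over \<open>l\<close> inverts
  the unit.\<close>

lemma bij_betw_unit:
  assumes N: "right_module BR N"
    and I: "finite I" and v: "\<And>l. l \<in> I \<Longrightarrow> v l \<in> kmod_hom k C BR"
    and d: "\<And>l. l \<in> I \<Longrightarrow> d l \<in> carrier C" and sum: "(\<Oplus>\<^bsub>A\<^esub>l\<in>I. v l (d l)) = \<one>\<^bsub>A\<^esub>"
  shows "bij_betw (\<lambda>n. n \<boxtimes>\<^bsub>ind N\<^esub> \<one>\<^bsub>A\<^esub>) (carrier N) (carrier (co (ind N)))"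
proof -
  let ?M = "ind N" and ?\<eta> = "\<lambda>n. n \<boxtimes>\<^bsub>ind N\<^esub> \<one>\<^bsub>A\<^esub>"
  interpret M: tensor_product B N "ract N" "regular_bimod A" "monoid.mult A" ?M by (rule ind_tensor_product[OF N])
  have Mm: "right_module A ?M" by (rule ind_right_module[OF N])
  have Ng: "abelian_group N" by (rule right_module.axioms(2)[OF N])
  have Bg: "abelian_group BR" by (rule ring.is_abelian_group[OF ring_B])
  \<comment> \<open>On \<open>\<eta> n\<close> the summands are \<open>n v l (d l)\<close>. For
    coinvariant \<open>t\<close>, \<open>contract_coinvariant\<close> turns the images of the
    summands under \<open>\<eta>\<close> into \<open>t v l (d l)\<close>.\<close>
  define recover where "recover t = (\<Oplus>\<^bsub>N\<^esub>l\<in>I. contract (v l) N (t \<triangleleft>\<^bsub>?M\<^esub> j (d l)))" for t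
  note unit = unit_hom[OF N]
  have vd: "v l (d l) \<in> B" "phi (v l) (j (d l)) = v l (d l)" if "l \<in> I" for l
    using that v d by (simp_all add: v_B phi_j)
  have t_j: "t \<triangleleft>\<^bsub>?M\<^esub> j (d l) \<in> carrier ?M" if "t \<in> carrier ?M" "l \<in> I" for t l
    using that d by (simp add: right_module.ract_closed[OF Mm] j)
  have con: "contract (v l) N (t \<triangleleft>\<^bsub>?M\<^esub> j (d l)) \<in> carrier N" if "t \<in> carrier ?M" "l \<in> I" for t l
    by (rule additive_map_closed[OF contract_additive[OF v[OF that(2)] N] t_j[OF that]])
  have recover_closed: "recover t \<in> carrier N" if "t \<in> carrier ?M" for t
    using con[OF that] by (auto simp: recover_def intro!: abelian_monoid.finsum_closed[OF abelian_group.axioms(1)[OF Ng]])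
  have recover_unit: "recover (?\<eta> n) = n" if n: "n \<in> carrier N" for n
  proof -
    have add: "(\<lambda>b. n \<triangleleft>\<^bsub>N\<^esub> b) \<in> additive_maps BR N"
      using right_module.ract_closed[OF N n] right_module.ract_add_right[OF N n] by (intro additive_mapI) simp_all
    have "recover (?\<eta> n) = (\<Oplus>\<^bsub>N\<^esub>l\<in>I. n \<triangleleft>\<^bsub>N\<^esub> v l (d l))"
      unfolding recover_def
    proof (rule abelian_monoid.finsum_cong'[OF abelian_group.axioms(1)[OF Ng] refl])
      show "(\<lambda>l. n \<triangleleft>\<^bsub>N\<^esub> v l (d l)) \<in> I \<rightarrow> carrier N"
        using additive_map_closed[OF add] vd by simp
      fix l assume l: "l \<in> I"
      then show "contract (v l) N (?\<eta> n \<triangleleft>\<^bsub>?M\<^esub> j (d l)) = n \<triangleleft>\<^bsub>N\<^esub> v l (d l)"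
        using n d by (simp add: ind_ract_pure[OF N] j contract_pure[OF v[OF l] N] vd)
    qed
    \<comment> \<open>\<open>N\<close> is a module over \<open>BR\<close> only, so the sum is taken
      in \<open>BR\<close> before it is compared with the given sum in \<open>A\<close>.\<close>
    also have "\<dots> = n \<triangleleft>\<^bsub>N\<^esub> finsum BR (\<lambda>l. v l (d l)) I"
      by (rule additive_map_finsum[OF Bg Ng add I, symmetric]) (simp add: vd)
    also have "\<dots> = n"
      using right_module.ract_one[OF N n]
      by (simp add: finsum_restrict_carrier[OF abelian_group_A Bg B_subset I vd(1)] sum)
    finally show ?thesis .
  qed
  have unit_recover: "?\<eta> (recover t) = t" if t: "t \<in> carrier (co ?M)" for t
  proof -
    have tM: "t \<in> carrier ?M" using t by (simp add: coinv_sel)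
    have add: "(\<lambda>a. t \<triangleleft>\<^bsub>?M\<^esub> a) \<in> additive_maps A ?M"
      using right_module.ract_closed[OF Mm tM] right_module.ract_add_right[OF Mm tM] by (intro additive_mapI) simp_all
    have unit_M: "?\<eta> \<in> additive_maps N ?M"
      by (intro additive_mapI) (simp_all add: M.pure_closed M.pure_add_left regular_bimod_sel)
    have "?\<eta> (recover t) = (\<Oplus>\<^bsub>?M\<^esub>l\<in>I. ?\<eta> (contract (v l) N (t \<triangleleft>\<^bsub>?M\<^esub> j (d l))))"
      unfolding recover_def by (rule additive_map_finsum[OF Ng M.abelian_group_T unit_M I con[OF tM]])
    also have "\<dots> = (\<Oplus>\<^bsub>?M\<^esub>l\<in>I. t \<triangleleft>\<^bsub>?M\<^esub> v l (d l))"
    proof (rule abelian_monoid.finsum_cong'[OF abelian_group.axioms(1)[OF M.abelian_group_T] refl])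
      show "(\<lambda>l. t \<triangleleft>\<^bsub>?M\<^esub> v l (d l)) \<in> I \<rightarrow> carrier ?M"
        using additive_map_closed[OF add] vd B_carrier by simp
      fix l assume l: "l \<in> I"
      then show "?\<eta> (contract (v l) N (t \<triangleleft>\<^bsub>?M\<^esub> j (d l))) = t \<triangleleft>\<^bsub>?M\<^esub> v l (d l)"
        using contract_coinvariant[OF v[OF l] N t, of "j (d l)"] d by (simp add: j vd)
    qed
    also have "\<dots> = t \<triangleleft>\<^bsub>?M\<^esub> (\<Oplus>\<^bsub>A\<^esub>l\<in>I. v l (d l))"
      by (rule additive_map_finsum[OF abelian_group_A M.abelian_group_T add I, symmetric]) (simp add: vd B_carrier)
    also have "\<dots> = t"
      by (simp add: sum right_module.ract_one[OF Mm tM])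
    finally show ?thesis .
  qed
  show ?thesis
    by (rule bij_betw_byWitness[of _ recover])
      (use rmod_homD(2)[OF unit] recover_closed in \<open>auto simp: recover_unit unit_recover coinv_sel(1)\<close>)
qed

end

section \<open>The equivalence\<close>

lemma rmod_cat_iso:
  assumes M: "right_module R M" and N: "right_module R N"
    and f: "f \<in> rmod_hom R M N" and bij: "bij_betw f (carrier M) (carrier N)"
  shows "(\<lambda>x \<in> carrier M. f x) \<in> isos (rmod_cat R) M N"
proof -
  let ?f = "\<lambda>x \<in> carrier M. f x" and ?g = "\<lambda>y \<in> carrier N. inv_into (carrier M) f y"
  have g: "inv_into (carrier M) f \<in> rmod_hom R N M"
    by (rule right_module.rmod_hom_inv_into[OF M f bij])
  have "?f \<in> rmod_hom R M N"
    by (rule rmod_hom_cong[OF M f]) simp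
  moreover have "?g \<in> rmod_hom R N M"
    by (rule rmod_hom_cong[OF N g]) simp
  moreover have "compose (carrier M) ?g ?f = (\<lambda>x \<in> carrier M. x)" "compose (carrier N) ?f ?g = (\<lambda>y \<in> carrier N. y)"
    using bij rmod_homD(2)[OF f] rmod_homD(2)[OF g]
    by (auto simp: compose_def bij_betw_inv_into_left bij_betw_inv_into_right intro!: restrict_ext)
  ultimately show ?thesis
    unfolding isos_def rmod_cat_sel by blast
qed

lemma (in coring) comod_cat_iso:
  assumes M: "coring_comodule A X M" and N: "coring_comodule A X N"
    and f: "f \<in> comodule_hom A X M N" and bij: "bij_betw f (carrier M) (carrier N)"
  shows "(\<lambda>x \<in> carrier M. f x) \<in> isos (comod_cat A X) M N"
proof -
  let ?f = "\<lambda>x \<in> carrier M. f x" and ?g = "\<lambda>y \<in> carrier N. inv_into (carrier M) f y"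
  have g: "inv_into (carrier M) f \<in> comodule_hom A X N M"
    by (rule comodule_hom_inv_into[OF M N f bij])
  have "?f \<in> comodule_hom A X M N"
    by (rule comodule_hom_cong[OF M N f]) simp
  moreover have "?g \<in> comodule_hom A X N M"
    by (rule comodule_hom_cong[OF N M g]) simp
  moreover have "compose (carrier M) ?g ?f = (\<lambda>x \<in> carrier M. x)" "compose (carrier N) ?f ?g = (\<lambda>y \<in> carrier N. y)"
    using bij rmod_homD(2)[OF comodule_homD(1)[OF f]] rmod_homD(2)[OF comodule_homD(1)[OF g]]
    by (auto simp: compose_def bij_betw_inv_into_left bij_betw_inv_into_right intro!: restrict_ext)
  ultimately show ?thesis
    unfolding isos_def comod_cat_sel by blast
qed

text \<open>The quasi-inverse of induction. Its values consist of elements of \<open>M\<close>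
  itself, so they stay in the universe without encoding.\<close>

definition coinv_functor ::
  "('a, 's) ring_scheme \<Rightarrow> ('a, 'x, 'z) coring_scheme \<Rightarrow> 'x
    \<Rightarrow> (('a, 'u, 'x) comod, 'u \<Rightarrow> 'u, ('a, 'u) rmod, 'u \<Rightarrow> 'u) funct" where
  "coinv_functor A X g = \<lparr>FOb = coinv A X g, FMor = (\<lambda>M M' f. \<lambda>m \<in> carrier (coinv A X g M). f m)\<rparr>"

context cleft_extension
begin

lemma is_functor_coinv: "is_functor (comod_cat A X) (rmod_cat BR) (coinv_functor A X g)"
proof (intro is_functor.intro category_comod_cat category_rmod_cat is_functor_axioms.intro)
  fix M assume "M \<in> Ob (comod_cat A X)"
  then have M: "coring_comodule A X M" by (simp add: comod_cat_sel)
  then show "FOb (coinv_functor A X g) M \<in> Ob (rmod_cat BR)"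
    by (simp add: coinv_functor_def rmod_cat_sel coinv_right_module)
  show "FMor (coinv_functor A X g) M M (Idn (comod_cat A X) M) = Idn (rmod_cat BR) (FOb (coinv_functor A X g) M)"
    by (auto simp: coinv_functor_def rmod_cat_sel comod_cat_sel coinv_sel(1) intro!: restrict_ext)
next
  fix M M' f assume "M \<in> Ob (comod_cat A X)" "M' \<in> Ob (comod_cat A X)" "f \<in> Mor (comod_cat A X) M M'"
  then have M: "coring_comodule A X M" "coring_comodule A X M'" "f \<in> comodule_hom A X M M'"
    by (simp_all add: comod_cat_sel)
  have "(\<lambda>m \<in> carrier (co M). f m) \<in> rmod_hom BR (co M) (co M')"
    by (rule rmod_hom_cong[OF coinv_right_module[OF M(1)] comodule_hom_co[OF M]]) simp
  then show "FMor (coinv_functor A X g) M M' f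
      \<in> Mor (rmod_cat BR) (FOb (coinv_functor A X g) M) (FOb (coinv_functor A X g) M')"
    by (simp add: coinv_functor_def rmod_cat_sel)
next
  fix L M M' f f'
  assume "L \<in> Ob (comod_cat A X)" "M \<in> Ob (comod_cat A X)" "M' \<in> Ob (comod_cat A X)"
    "f \<in> Mor (comod_cat A X) L M" "f' \<in> Mor (comod_cat A X) M M'"
  then have "coring_comodule A X L" "coring_comodule A X M" "f \<in> comodule_hom A X L M"
    by (simp_all add: comod_cat_sel)
  from rmod_homD(2)[OF comodule_hom_co[OF this]]
  show "FMor (coinv_functor A X g) L M' (Cmp (comod_cat A X) L M M' f' f)
      = Cmp (rmod_cat BR) (FOb (coinv_functor A X g) L) (FOb (coinv_functor A X g) M) (FOb (coinv_functor A X g) M')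
        (FMor (coinv_functor A X g) M M' f') (FMor (coinv_functor A X g) L M f)"
    by (auto simp: coinv_functor_def rmod_cat_sel comod_cat_sel compose_def coinv_sel(1)[of _ A X g L] intro!: restrict_ext)
qed

section \<open>Induction as a functor inside the universe \<open>'u\<close>\<close>

context
  fixes enc :: "('u \<times> 'a \<Rightarrow>\<^sub>0 int) \<Rightarrow> 'u"
  assumes enc: "inj enc"
begin

abbreviation (input) "\<theta> \<equiv> tensor_code enc"
abbreviation (input) "FO \<equiv> \<lambda>N. transport_comod A X \<theta> (ind N)"
abbreviation (input) "dec \<equiv> \<lambda>N. inv_into (carrier (ind N)) \<theta>"
abbreviation (input) "Ind \<equiv> induction_functor A B X \<rho> enc"

lemma Ind_sel:
  "FOb Ind N = FO N"
  "FMor Ind N N' f = (\<lambda>x \<in> carrier (FO N). \<theta> (tensor_map (ind N') f id (dec N x)))"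
  by (simp_all add: induction_functor_def Let_def)

text \<open>The encoding \<open>\<theta>\<close> is an isomorphism of comodules with inverse
  \<open>dec N\<close>, so results on \<open>ind N\<close> pass to the encoded object by composing
  with these two.\<close>

lemma
  assumes N: "right_module BR N"
  shows FO_comodule: "coring_comodule A X (FO N)"
    and code_hom: "\<theta> \<in> comodule_hom A X (ind N) (FO N)"
    and code_bij: "bij_betw \<theta> (carrier (ind N)) (carrier (FO N))"
    and dec_hom: "dec N \<in> comodule_hom A X (FO N) (ind N)"
    and dec_bij: "bij_betw (dec N) (carrier (FO N)) (carrier (ind N))"
    and dec_closed: "x \<in> carrier (FO N) \<Longrightarrow> dec N x \<in> carrier (ind N)"
    and code_dec: "x \<in> carrier (FO N) \<Longrightarrow> \<theta> (dec N x) = x"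
    and dec_code: "t \<in> carrier (ind N) \<Longrightarrow> dec N (\<theta> t) = t"
proof -
  have inj: "inj_on \<theta> (carrier (ind N))"
    by (rule tensor_product.inj_on_tensor_code[OF ind_tensor_product[OF N] enc])
  note M = ind_comodule[OF N]
  show FO: "coring_comodule A X (FO N)" and hom: "\<theta> \<in> comodule_hom A X (ind N) (FO N)"
    and bij: "bij_betw \<theta> (carrier (ind N)) (carrier (FO N))"
    by (rule transport_comodule[OF M inj], rule transport_comod_hom[OF M inj], rule bij_betw_transport_comod[OF M inj])
  show dec: "dec N \<in> comodule_hom A X (FO N) (ind N)"
    by (rule comodule_hom_inv_into[OF M FO hom bij])
  show "bij_betw (dec N) (carrier (FO N)) (carrier (ind N))"
    by (rule bij_betw_inv_into[OF bij])
  show "x \<in> carrier (FO N) \<Longrightarrow> dec N x \<in> carrier (ind N)"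
    by (rule rmod_homD(2)[OF comodule_homD(1)[OF dec]])
  show "x \<in> carrier (FO N) \<Longrightarrow> \<theta> (dec N x) = x"
    by (rule bij_betw_inv_into_right[OF bij])
  show "t \<in> carrier (ind N) \<Longrightarrow> dec N (\<theta> t) = t"
    by (rule bij_betw_inv_into_left[OF bij])
qed

lemma code_closed: "\<lbrakk>right_module BR N; t \<in> carrier (ind N)\<rbrakk> \<Longrightarrow> \<theta> t \<in> carrier (FO N)"
  using bij_betwE[OF code_bij] by blast

lemma ind_map_closed:
  "\<lbrakk>right_module BR N; right_module BR N'; f \<in> rmod_hom BR N N'; t \<in> carrier (ind N)\<rbrakk>
    \<Longrightarrow> tensor_map (ind N') f id t \<in> carrier (ind N')"
  by (rule rmod_homD(2)[OF comodule_homD(1)[OF ind_map_hom]])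

lemma is_functor_induction: "is_functor (rmod_cat BR) (comod_cat A X) Ind"
proof (intro is_functor.intro category_comod_cat category_rmod_cat is_functor_axioms.intro)
  fix N :: "('a, 'u) rmod" assume "N \<in> Ob (rmod_cat BR)"
  then have N: "right_module BR N" by (simp add: rmod_cat_sel)
  then show "FOb Ind N \<in> Ob (comod_cat A X)"
    by (simp add: Ind_sel comod_cat_sel FO_comodule)
  have id: "(\<lambda>n. n) \<in> rmod_hom BR N N"
    by (auto intro!: rmod_homI additive_mapI)
  have "tensor_map (ind N) (\<lambda>n \<in> carrier N. n) id t = t" if "t \<in> carrier (ind N)" for t
    using ind_map_cong[OF N N id _ that, of "\<lambda>n \<in> carrier N. n"] ind_map_id[OF N that] by simp
  then show "FMor Ind N N (Idn (rmod_cat BR) N) = Idn (comod_cat A X) (FOb Ind N)"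
    unfolding Ind_sel rmod_cat_sel comod_cat_sel
    by (intro restrict_ext) (simp add: dec_closed[OF N] code_dec[OF N])
next
  fix N N' :: "('a, 'u) rmod" and f
  assume "N \<in> Ob (rmod_cat BR)" "N' \<in> Ob (rmod_cat BR)" "f \<in> Mor (rmod_cat BR) N N'"
  then have N: "right_module BR N" "right_module BR N'" "f \<in> rmod_hom BR N N'"
    by (simp_all add: rmod_cat_sel)
  note c = FO_comodule[OF N(1)] ind_comodule[OF N(1)] ind_comodule[OF N(2)] FO_comodule[OF N(2)]
  have "(\<lambda>x. \<theta> (tensor_map (ind N') f id (dec N x))) \<in> comodule_hom A X (FO N) (FO N')"
    by (rule comodule_hom_comp[OF c(1,3,4) comodule_hom_comp[OF c(1-3) dec_hom[OF N(1)] ind_map_hom[OF N]] code_hom[OF N(2)]])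
  from comodule_hom_cong[OF c(1,4) this, of "FMor Ind N N' f"]
  have "FMor Ind N N' f \<in> comodule_hom A X (FO N) (FO N')"
    unfolding Ind_sel by simp
  then show "FMor Ind N N' f \<in> Mor (comod_cat A X) (FOb Ind N) (FOb Ind N')"
    by (simp add: comod_cat_sel Ind_sel(1)) (simp add: Ind_sel(2))
next
  fix L N N' :: "('a, 'u) rmod" and f f'
  assume "L \<in> Ob (rmod_cat BR)" "N \<in> Ob (rmod_cat BR)" "N' \<in> Ob (rmod_cat BR)"
    "f \<in> Mor (rmod_cat BR) L N" "f' \<in> Mor (rmod_cat BR) N N'"
  then have N: "right_module BR L" "right_module BR N" "right_module BR N'" "f \<in> rmod_hom BR L N" "f' \<in> rmod_hom BR N N'"
    by (simp_all add: rmod_cat_sel)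
  have "tensor_map (ind N') (compose (carrier L) f' f) id t = tensor_map (ind N') f' id (tensor_map (ind N) f id t)"
    if "t \<in> carrier (ind L)" for t
    using ind_map_cong[OF N(1,3) rmod_hom_comp[OF N(4,5)] _ that, of "compose (carrier L) f' f"]
    by (simp add: ind_map_comp[OF N that] compose_def)
  then show "FMor Ind L N' (Cmp (rmod_cat BR) L N N' f' f)
      = Cmp (comod_cat A X) (FOb Ind L) (FOb Ind N) (FOb Ind N') (FMor Ind N N' f') (FMor Ind L N f)"
    unfolding Ind_sel rmod_cat_sel comod_cat_sel compose_def[of "carrier (FO L)"]
    by (intro restrict_ext)
      (simp add: dec_closed[OF N(1)] ind_map_closed[OF N(1,2,4)] code_closed[OF N(2)] dec_code[OF N(2)])
qed

lemma comp_functor_sel: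
  "FOb (comp_functor G F) N = FOb G (FOb F N)"
  "FMor (comp_functor G F) N N' f = FMor G (FOb F N) (FOb F N') (FMor F N N' f)"
  "FOb id_functor N = N" "FMor id_functor N N' f = f"
  by (simp_all add: comp_functor_def id_functor_def)

lemma coinv_functor_sel:
  "FOb (coinv_functor A X g) M = co M"
  "FMor (coinv_functor A X g) M M' f = (\<lambda>m \<in> carrier (co M). f m)"
  by (simp_all add: coinv_functor_def)

text \<open>Bijectivity of the unit is kept as a premise: naturality is formal in any cleft
  extension, whereas bijectivity is obtained from the families \<open>v\<close> and
  \<open>d\<close>.\<close>

lemma unit_naturally_isomorphic:
  assumes unit: "\<And>N :: ('a, 'u) rmod. right_module BR N
    \<Longrightarrow> bij_betw (\<lambda>n. n \<boxtimes>\<^bsub>ind N\<^esub> \<one>\<^bsub>A\<^esub>) (carrier N) (carrier (co (ind N)))"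
  shows "naturally_isomorphic (rmod_cat BR) (rmod_cat BR) id_functor (comp_functor (coinv_functor A X g) Ind)"
proof -
  define \<eta> where "\<eta> N = (\<lambda>n \<in> carrier N. \<theta> (n \<boxtimes>\<^bsub>ind N\<^esub> \<one>\<^bsub>A\<^esub>))" for N :: "('a, 'u) rmod"
  have iso: "\<eta> N \<in> isos (rmod_cat BR) N (co (FO N))" if N: "right_module BR N" for N :: "('a, 'u) rmod"
  proof -
    note c = ind_comodule[OF N] FO_comodule[OF N] code_hom[OF N]
    have "bij_betw (\<lambda>n. \<theta> (n \<boxtimes>\<^bsub>ind N\<^esub> \<one>\<^bsub>A\<^esub>)) (carrier N) (carrier (co (FO N)))"
      using bij_betw_trans[OF unit[OF N] bij_betw_co[OF c code_bij[OF N]]] by (simp add: comp_def)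
    then show ?thesis
      unfolding \<eta>_def
      by (rule rmod_cat_iso[OF N coinv_right_module[OF c(2)] rmod_hom_comp[OF unit_hom[OF N] comodule_hom_co[OF c]]])
  qed
  have nat: "\<eta> N' (f n) = FMor Ind N N' f (\<eta> N n)" "\<eta> N n \<in> carrier (co (FO N))" "f n \<in> carrier N'"
    if N: "right_module BR N" "right_module BR N'" "f \<in> rmod_hom BR N N'" and n: "n \<in> carrier N"
    for N N' :: "('a, 'u) rmod" and f n
  proof -
    note c = ind_comodule[OF N(1)] FO_comodule[OF N(1)] code_hom[OF N(1)]
    have u: "n \<boxtimes>\<^bsub>ind N\<^esub> \<one>\<^bsub>A\<^esub> \<in> carrier (co (ind N))" "n \<boxtimes>\<^bsub>ind N\<^esub> \<one>\<^bsub>A\<^esub> \<in> carrier (ind N)"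
      using rmod_homD(2)[OF unit_hom[OF N(1)] n] by (simp_all add: coinv_sel(1))
    show fn: "f n \<in> carrier N'"
      by (rule rmod_homD(2)[OF N(3) n])
    show "\<eta> N n \<in> carrier (co (FO N))"
      using rmod_homD(2)[OF comodule_hom_co[OF c] u(1)] n by (simp add: \<eta>_def)
    show "\<eta> N' (f n) = FMor Ind N N' f (\<eta> N n)"
      unfolding \<eta>_def Ind_sel using n fn u(2)
      by (simp add: code_closed[OF N(1)] dec_code[OF N(1)] ind_map_pure[OF N])
  qed
  show ?thesis
    unfolding naturally_isomorphic_def comp_functor_sel coinv_functor_sel Ind_sel(1)
  proof (intro exI[of _ \<eta>] conjI ballI)
    fix N :: "('a, 'u) rmod" assume "N \<in> Ob (rmod_cat BR)"
    then show "\<eta> N \<in> isos (rmod_cat BR) N (co (FO N))"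
      by (simp add: rmod_cat_sel iso)
  next
    fix N N' :: "('a, 'u) rmod" and f
    assume "N \<in> Ob (rmod_cat BR)" "N' \<in> Ob (rmod_cat BR)" "f \<in> Mor (rmod_cat BR) N N'"
    then have N: "right_module BR N" "right_module BR N'" "f \<in> rmod_hom BR N N'"
      by (simp_all add: rmod_cat_sel)
    show "Cmp (rmod_cat BR) N N' (co (FO N')) (\<eta> N') f
        = Cmp (rmod_cat BR) N (co (FO N)) (co (FO N')) (\<lambda>m \<in> carrier (co (FO N)). FMor Ind N N' f m) (\<eta> N)"
      unfolding rmod_cat_sel compose_def by (intro restrict_ext) (simp add: nat[OF N])
  qed
qed

text \<open>Again formal apart from the premise, which \<open>bij_betw_act\<close> supplies once a
  cleaving map and its inverse are fixed. The component at \<open>M\<close> decodes and then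
  acts.\<close>

lemma counit_naturally_isomorphic:
  assumes counit: "\<And>M :: ('a, 'u, ('a, 'c) tensors) comod. coring_comodule A X M
    \<Longrightarrow> bij_betw (act M) (carrier (ind (co M))) (carrier M)"
  shows "naturally_isomorphic (comod_cat A X) (comod_cat A X) (comp_functor Ind (coinv_functor A X g)) id_functor"
proof -
  define \<epsilon> where "\<epsilon> M = (\<lambda>x \<in> carrier (FO (co M)). act M (dec (co M) x))" for M :: "('a, 'u, ('a, 'c) tensors) comod"
  have iso: "\<epsilon> M \<in> isos (comod_cat A X) (FO (co M)) M" if M: "coring_comodule A X M" for M :: "('a, 'u, ('a, 'c) tensors) comod"
  proof -
    note N = coinv_right_module[OF M]
    have "bij_betw (\<lambda>x. act M (dec (co M) x)) (carrier (FO (co M))) (carrier M)"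
      using bij_betw_trans[OF dec_bij[OF N] counit[OF M]] by (simp add: comp_def)
    then show ?thesis
      unfolding \<epsilon>_def
      by (rule comod_cat_iso[OF FO_comodule[OF N] M
            comodule_hom_comp[OF FO_comodule[OF N] ind_comodule[OF N] M dec_hom[OF N] act_hom[OF M]]])
  qed
  have nat: "\<epsilon> M' (FMor Ind (co M) (co M') (\<lambda>m \<in> carrier (co M). f m) x) = f (\<epsilon> M x)"
    if M: "coring_comodule A X M" "coring_comodule A X M'" "f \<in> comodule_hom A X M M'" and x: "x \<in> carrier (FO (co M))"
    for M M' :: "('a, 'u, ('a, 'c) tensors) comod" and f x
  proof -
    note N = coinv_right_module[OF M(1)] coinv_right_module[OF M(2)]
    note f = comodule_hom_co[OF M]
    have t: "dec (co M) x \<in> carrier (ind (co M))" by (rule dec_closed[OF N(1) x])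
    \<comment> \<open>The coinvariants functor delivers the restriction of \<open>f\<close>, while
      \<open>act_naturality\<close> speaks of \<open>f\<close> itself.\<close>
    have "tensor_map (ind (co M')) (\<lambda>m \<in> carrier (co M). f m) id (dec (co M) x) = tensor_map (ind (co M')) f id (dec (co M) x)"
      by (rule ind_map_cong[OF N f _ t, symmetric]) simp
    then show ?thesis
      unfolding \<epsilon>_def Ind_sel using x t
      by (simp add: code_closed[OF N(2)] dec_code[OF N(2)] ind_map_closed[OF N f] act_naturality[OF M])
  qed
  show ?thesis
    unfolding naturally_isomorphic_def comp_functor_sel coinv_functor_sel Ind_sel(1)
  proof (intro exI[of _ \<epsilon>] conjI ballI)
    fix M :: "('a, 'u, ('a, 'c) tensors) comod" assume "M \<in> Ob (comod_cat A X)"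
    then show "\<epsilon> M \<in> isos (comod_cat A X) (FO (co M)) M"
      by (simp add: comod_cat_sel iso)
  next
    fix M M' :: "('a, 'u, ('a, 'c) tensors) comod" and f
    assume "M \<in> Ob (comod_cat A X)" "M' \<in> Ob (comod_cat A X)" "f \<in> Mor (comod_cat A X) M M'"
    then have M: "coring_comodule A X M" "coring_comodule A X M'" "f \<in> comodule_hom A X M M'"
      by (simp_all add: comod_cat_sel)
    show "Cmp (comod_cat A X) (FO (co M)) (FO (co M')) M' (\<epsilon> M') (FMor Ind (co M) (co M') (\<lambda>m \<in> carrier (co M). f m))
        = Cmp (comod_cat A X) (FO (co M)) M M' f (\<epsilon> M)"
      unfolding comod_cat_sel compose_def by (intro restrict_ext) (simp add: nat[OF M])
  qed
qed

end

end

theorem theorem3p14: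
  fixes k :: "('k, 's) ring_scheme"
    and A :: "('k, 'a, 'y) module_scheme"
    and C :: "('k, 'c, 'z) coalg_scheme"
    and \<rho> :: "'a \<Rightarrow> ('a, 'c) tensors"
    and B :: "'a set"
    and r :: "('a, 'c) tensors \<Rightarrow> 'a \<Rightarrow> ('a, 'c) tensors"
    and I :: "'i set" and v :: "'i \<Rightarrow> 'c \<Rightarrow> 'a" and d :: "'i \<Rightarrow> 'c"
    and enc :: "('u \<times> 'a \<Rightarrow>\<^sub>0 int) \<Rightarrow> 'u"
  assumes cleft: "cleft_extension k A C \<rho> B r"
    and finite_I: "finite I"
    and v_hom: "\<And>i. i \<in> I \<Longrightarrow> v i \<in> kmod_hom k C (A\<lparr>carrier := B\<rparr>)"
    and d_in: "\<And>i. i \<in> I \<Longrightarrow> d i \<in> carrier C"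
    and sum_one: "(\<Oplus>\<^bsub>A\<^esub>i\<in>I. v i (d i)) = \<one>\<^bsub>A\<^esub>"
    and universe: "inj enc"
  shows "is_equivalence
    (rmod_cat (A\<lparr>carrier := B\<rparr>))
    (comod_cat A (cleft_coring k A C r))
    (induction_functor A B (cleft_coring k A C r) \<rho> enc)"
proof -
  interpret cleft_extension k A C \<rho> B r by (rule cleft)
  \<comment> \<open>A cleft extension only asserts that a cleaving map exists. Choosing
    \<open>j\<close> and \<open>i\<close> opens the locale \<open>cleaving\<close>; the functors do
    not depend on the choice.\<close>
  obtain j i where j: "j \<in> coalgebra_comodule_hom k C C (comult C) A \<rho>" and i: "i \<in> kmod_hom k C A"
    and conv: "\<And>c. c \<in> carrier C \<Longrightarrow> convolution C A j i c = counit C c \<odot>\<^bsub>A\<^esub> \<one>\<^bsub>A\<^esub>"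
      "\<And>c. c \<in> carrier C \<Longrightarrow> convolution C A i j c = counit C c \<odot>\<^bsub>A\<^esub> \<one>\<^bsub>A\<^esub>"
    using cleaving_map unfolding convolution_invertible_def by blast
  interpret cleaving k A C \<rho> B r j i
    by unfold_locales (use j i conv in auto)
  show ?thesis
    unfolding is_equivalence_def
    using is_functor_induction[OF universe] is_functor_coinv
      unit_naturally_isomorphic[OF universe bij_betw_unit[OF _ finite_I v_hom d_in sum_one]]
      counit_naturally_isomorphic[OF universe bij_betw_act]
    by blast
qed

end
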